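(* Assume (B1), (B2), (B3) and (B4). Let $x\in\mathsf{O}$. Then there exists $T_x>0$ such that every $\beta$-fluid limit $\mathbb{Q}^\beta_x$ satisfies $\mathbb{Q}^\beta_x=\delta_{\mu(\cdot;x)}$ on $\mathsf{D}([0,T_x],\mathsf{X})$.
   Context: $\mathsf{X}$ is a $d$-dimensional Euclidean space with norm $|\cdot|$ and Borel $\sigma$-field. $\{\Phi_k\}_{k\ge0}$ is a Markov chain on $\mathsf{X}$ with natural filtration $\{\mathcal{F}_k\}$; $\mathbb{P}_x,\mathbb{E}_x$ denote law and expectation of the chain given $\Phi_0=x$. It is assumed that $\mathbb{E}_x|\Phi_1|<\infty$ for all $x$. Put $\Delta(x)=\mathbb{E}_x[\Phi_1]-x$ and $\epsilon_k=\Phi_k-\mathbb{E}[\Phi_k\mid\mathcal{F}_{k-1}]$, $k\ge1$. (B1) There exists $p>1$ such that $\lim_{K\to\infty}\sup_{x\in\mathsf{X}}\mathbb{E}_x\big[|\epsilon_1|^p\mathbf{1}\{|\epsilon_1|\ge K\}\big]=0$. (B2) There exists $\beta\in[0,1\wedge(p-1))$ such that $N(\beta,\Delta)=\sup_{x\in\mathsf{X}}\{(1+|x|^\beta)|\Delta(x)|\}<\infty$. (B3) There exist an open cone $\mathsf{O}\subseteq\mathsf{X}\setminus\{0\}$ and a continuous function $\Delta_\infty:\mathsf{O}\to\mathsf{X}$ such that, for any compact $\mathsf{H}\subseteq\mathsf{O}$, $\lim_{r\to+\infty}\sup_{x\in\mathsf{H}}\big|r^\beta|x|^\beta\Delta(rx)-\Delta_\infty(x)\big|=0$,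 with $\beta$ from (B2). Let $h(x)=|x|^{-\beta}\Delta_\infty(x)$ on $\mathsf{O}$. A solution of the ODE $\dot\mu=h(\mu)$ on an interval $I\subset\mathbb{R}_+$ containing $0$, with initial condition $x$, is a continuously differentiable $\mu:I\to\mathsf{X}$ with $\mu(0)=x$, $\mu(t)\in\mathsf{O}$ and $\dot\mu(t)=h(\mu(t))$ for all $t\in I$. (B4) For all $x\in\mathsf{O}$ there exists $T_x>0$ such that the ODE with initial condition $x$ has a unique solution, denoted $\mu(\cdot;x)$, on the interval $[0,T_x]$ (uniqueness in the usual sense: any solution with initial condition $x$ on a subinterval $[0,T']\subseteq[0,T_x]$ coincides with $\mu(\cdot;x)$ there). Fluid limits: $\mathsf{D}(\mathbb{R}_+,\mathsf{X})$ is the space of càdlàg functions (Skorokhod topology), $\mathsf{D}([0,T],\mathsf{X})$ its analogue on $[0,T]$. For $r>0$, let $\eta^\beta_r(t;x)=r^{-1}\Phi_{\lfloor tr^{1+\beta}\rfloor}$ where $\Phi_0=rx$, and let $\mathbb{Q}^\beta_{r;x}$ be the law on $\mathsf{D}(\mathbb{R}_+,\mathsf{X})$ of $\eta^\beta_r(\cdot;x)$ under $\mathbb{P}_{rx}$. $\mathbb{Q}^\beta_x$ is a $\beta$-fluid limit (with initial point $x$) if there exist $r_n\to+\infty$, $x_n\to x$ with $\mathbb{Q}^\beta_{r_n;x_n}\Rightarrow\mathbb{Q}^\beta_x$ weakly. "$\mathbb{Q}^\beta_x=\delta_{\mu}$ on $\mathsf{D}([0,T],\mathsf{X})$" means that the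 image of $\mathbb{Q}^\beta_x$ under restriction of paths to $[0,T]$ is the Dirac mass at $\mu|_{[0,T]}$. *)

theory Defs
  imports "HOL-Probability.Probability"
begin

section \<open>Skorokhod space and weak convergence\<close>

text \<open>A path on a time interval is a function that is \<open>extensional\<close> on it, so that
  equality of paths is equality of functions.\<close>

definition cadlag_on :: "real set \<Rightarrow> (real \<Rightarrow> 'a::euclidean_space) \<Rightarrow> bool" where
  "cadlag_on I f \<longleftrightarrow>
     (\<forall>t\<in>I. (f \<longlongrightarrow> f t) (at t within I \<inter> {t<..}) \<and> (\<exists>l. (f \<longlongrightarrow> l) (at t within I \<inter> {..<t})))"

definition skorokhod_space :: "real set \<Rightarrow> (real \<Rightarrow> 'a::euclidean_space) set" where
  "skorokhod_space I = {f \<in> extensional I. cadlag_on I f}"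

text \<open>Increasing bijections of the interval onto itself; these are automatically continuous.\<close>

definition time_change :: "real set \<Rightarrow> (real \<Rightarrow> real) \<Rightarrow> bool" where
  "time_change I l \<longleftrightarrow> strict_mono_on I l \<and> l ` I = I"

definition skorokhod_nhd ::
  "real set \<Rightarrow> (real \<Rightarrow> 'a::euclidean_space) \<Rightarrow> real \<Rightarrow> real \<Rightarrow> (real \<Rightarrow> 'a) set" where
  "skorokhod_nhd I f S e = {g \<in> skorokhod_space I. \<exists>l. time_change I l \<and>
     (\<forall>t\<in>I. \<bar>l t - t\<bar> < e) \<and> (\<forall>t\<in>I. t \<le> S \<longrightarrow> dist (g (l t)) (f t) < e)}"

text \<open>
  The Skorokhod \<open>J\<^sub>1\<close> topology. On \<open>{0..}\<close> it is Billingsley's topology of \<open>D[0,\<infinity>)\<close>, where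
  \<open>f\<^sub>n\<close> tends to \<open>f\<close> iff there are time changes \<open>l\<^sub>n\<close> with \<open>sup\<^sub>t \<bar>l\<^sub>n t - t\<bar>\<close> tending to 0 and
  \<open>f\<^sub>n (l\<^sub>n t)\<close> tending to \<open>f t\<close> uniformly on every \<open>[0,S]\<close>. On \<open>{0..T}\<close> the neighbourhoods with
  \<open>S \<ge> T\<close> are the usual ones of \<open>D[0,T]\<close>, and those with \<open>S < T\<close> contain them.
\<close>

definition skorokhod :: "real set \<Rightarrow> (real \<Rightarrow> 'a::euclidean_space) topology" where
  "skorokhod I = topology (\<lambda>U. U \<subseteq> skorokhod_space I \<and>
     (\<forall>f\<in>U. \<exists>S e. 0 < e \<and> skorokhod_nhd I f S e \<subseteq> U))"

lemma skorokhod_nhd_mono: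
  "S \<le> S' \<Longrightarrow> e' \<le> e \<Longrightarrow> skorokhod_nhd I f S' e' \<subseteq> skorokhod_nhd I f S e"
  unfolding skorokhod_nhd_def
  by (intro Collect_mono impI, elim conjE exE, intro conjI exI) (assumption | force)+

lemma openin_skorokhod:
  fixes U :: "(real \<Rightarrow> 'a::euclidean_space) set"
  shows "openin (skorokhod I) U \<longleftrightarrow> U \<subseteq> skorokhod_space I \<and>
     (\<forall>f\<in>U. \<exists>S e. 0 < e \<and> skorokhod_nhd I f S e \<subseteq> U)"
proof -
  let ?P = "\<lambda>U :: (real \<Rightarrow> 'a) set. U \<subseteq> skorokhod_space I \<and> (\<forall>f\<in>U. \<exists>S e. 0 < e \<and> skorokhod_nhd I f S e \<subseteq> U)"
  have int: "?P (U \<inter> V)" if U: "?P U" and V: "?P V" for U V :: "(real \<Rightarrow> 'a) set"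
  proof (intro conjI ballI)
    fix f assume f: "f \<in> U \<inter> V"
    obtain S e where 1: "0 < e" "skorokhod_nhd I f S e \<subseteq> U" using U f by blast
    obtain S' e' where 2: "0 < e'" "skorokhod_nhd I f S' e' \<subseteq> V" using V f by blast
    have "skorokhod_nhd I f (max S S') (min e e') \<subseteq> U \<inter> V"
      using skorokhod_nhd_mono[of S "max S S'" "min e e'" e I f]
        skorokhod_nhd_mono[of S' "max S S'" "min e e'" e' I f] 1 2 by auto
    moreover have "0 < min e e'" using 1 2 by simp
    ultimately show "\<exists>S e. 0 < e \<and> skorokhod_nhd I f S e \<subseteq> U \<inter> V" by blast
  qed (use U in blast)
  have un: "?P (\<Union>\<K>)" if all: "\<forall>K\<in>\<K>. ?P K" for \<K> :: "(real \<Rightarrow> 'a) set set"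
  proof (intro conjI ballI)
    fix f assume "f \<in> \<Union>\<K>"
    then obtain K where K: "K \<in> \<K>" "f \<in> K" by blast
    then obtain S e where "0 < e" "skorokhod_nhd I f S e \<subseteq> K"
      using all K by blast
    then show "\<exists>S e. 0 < e \<and> skorokhod_nhd I f S e \<subseteq> \<Union>\<K>" using K(1) by blast
  qed (use all in blast)
  have "istopology ?P"
    unfolding istopology_def
  proof (intro conjI[of "\<forall>S. _ S"] allI impI)
    show "?P (U \<inter> V)" if "?P U" "?P V" for U V :: "(real \<Rightarrow> 'a) set" by (rule int[OF that])
    show "?P (\<Union>\<K>)" if "\<forall>K\<in>\<K>. ?P K" for \<K> :: "(real \<Rightarrow> 'a) set set" by (rule un[OF that])
  qed
  then show ?thesis unfolding skorokhod_def by (simp add: topology_inverse')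
qed

lemma topspace_skorokhod: "topspace (skorokhod I) = skorokhod_space I"
proof -
  have "openin (skorokhod I) (skorokhod_space I)"
    unfolding openin_skorokhod
    by (intro conjI ballI exI[of _ 0] exI[of _ 1]) (simp_all add: skorokhod_nhd_def)
  moreover have "topspace (skorokhod I) \<subseteq> skorokhod_space I"
    using openin_topspace[of "skorokhod I"] unfolding openin_skorokhod by blast
  ultimately show ?thesis using openin_subset by blast
qed

lemma time_change_id: "time_change I id"
  by (simp add: time_change_def strict_mono_on_def)

lemma time_change_mem: "time_change I l \<Longrightarrow> t \<in> I \<Longrightarrow> l t \<in> I"
  unfolding time_change_def using imageI[of t I l] by simp

lemma time_change_comp:
  assumes l: "time_change I l" and k: "time_change I k"
  shows "time_change I (k \<circ> l)"
  unfolding time_change_def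
proof
  have "l ` I = I" "k ` I = I" using l k unfolding time_change_def by (simp_all only:)
  then show "(k \<circ> l) ` I = I" by (simp only: image_comp[symmetric])
  show "strict_mono_on I (k \<circ> l)"
  proof (rule strict_mono_onI)
    fix r s assume *: "r \<in> I" "s \<in> I" "r < s"
    have sl: "strict_mono_on I l" and sk: "strict_mono_on I k"
      using l k by (simp_all only: time_change_def)
    have "k (l r) < k (l s)"
      by (rule strict_mono_onD[OF sk time_change_mem[OF l *(1)] time_change_mem[OF l *(2)]
            strict_mono_onD[OF sl *]])
    then show "(k \<circ> l) r < (k \<circ> l) s" by (simp only: comp_apply)
  qed
qed

lemma skorokhod_nhd_trans:
  assumes h: "h \<in> skorokhod_nhd I f S (e / 2)" and g: "g \<in> skorokhod_nhd I h (S + e) (e / 2)"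
  shows "g \<in> skorokhod_nhd I f S e"
proof -
  obtain l where l: "time_change I l" "\<And>t. t \<in> I \<Longrightarrow> \<bar>l t - t\<bar> < e / 2"
      "\<And>t. t \<in> I \<Longrightarrow> t \<le> S \<Longrightarrow> dist (h (l t)) (f t) < e / 2"
    using h unfolding skorokhod_nhd_def by blast
  obtain k where k: "time_change I k" "\<And>t. t \<in> I \<Longrightarrow> \<bar>k t - t\<bar> < e / 2"
      "\<And>t. t \<in> I \<Longrightarrow> t \<le> S + e \<Longrightarrow> dist (g (k t)) (h t) < e / 2"
    using g unfolding skorokhod_nhd_def by blast
  have lI: "l t \<in> I" if "t \<in> I" for t using time_change_mem[OF l(1) that] .
  have "\<bar>k (l t) - t\<bar> < e" if "t \<in> I" for t
    using l(2)[OF that] k(2)[OF lI[OF that]] by linarith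
  moreover have "dist (g (k (l t))) (f t) < e" if "t \<in> I" "t \<le> S" for t
  proof -
    have "l t \<le> S + e" using l(2)[OF that(1)] that by linarith
    then have "dist (g (k (l t))) (h (l t)) < e / 2" by (rule k(3)[OF lI[OF that(1)]])
    then show ?thesis
      using l(3)[OF that] dist_triangle[of "g (k (l t))" "f t" "h (l t)"] by linarith
  qed
  moreover have "g \<in> skorokhod_space I" using g by (simp add: skorokhod_nhd_def)
  ultimately show ?thesis
    unfolding skorokhod_nhd_def comp_apply[symmetric, of k l]
    using time_change_comp[OF l(1) k(1)] by blast
qed

lemma limitin_skorokhod:
  "limitin (skorokhod I) g f F \<longleftrightarrow> f \<in> skorokhod_space I \<and>
     (\<forall>S e. 0 < e \<longrightarrow> (\<forall>\<^sub>F n in F. g n \<in> skorokhod_nhd I f S e))"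
proof (intro iffI conjI allI impI)
  assume L: "limitin (skorokhod I) g f F"
  show f: "f \<in> skorokhod_space I" using L by (simp add: limitin_def topspace_skorokhod)
  fix S e :: real assume e: "0 < e"
  define V where "V = {h \<in> skorokhod_space I. \<exists>S' e'. 0 < e' \<and> skorokhod_nhd I h S' e' \<subseteq> skorokhod_nhd I f S e}"
  have "openin (skorokhod I) V"
    unfolding openin_skorokhod
  proof (intro conjI ballI)
    fix h assume "h \<in> V"
    then obtain S' e' where *: "0 < e'" "skorokhod_nhd I h S' e' \<subseteq> skorokhod_nhd I f S e"
      unfolding V_def by blast
    have "skorokhod_nhd I h S' (e' / 2) \<subseteq> V"
    proof
      fix k assume k: "k \<in> skorokhod_nhd I h S' (e' / 2)"
      then have "skorokhod_nhd I k (S' + e') (e' / 2) \<subseteq> skorokhod_nhd I f S e"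
        using subset_trans[OF subsetI *(2)] skorokhod_nhd_trans[OF k] by simp
      moreover have "k \<in> skorokhod_space I" using k by (simp add: skorokhod_nhd_def)
      ultimately show "k \<in> V"
        unfolding V_def using half_gt_zero[OF *(1)] by blast
    qed
    then show "\<exists>S e. 0 < e \<and> skorokhod_nhd I h S e \<subseteq> V" using half_gt_zero[OF *(1)] by blast
  qed (auto simp: V_def)
  moreover have "f \<in> V" using f e unfolding V_def by blast
  ultimately have ev: "\<forall>\<^sub>F n in F. g n \<in> V" using L unfolding limitin_def by blast
  have sub: "V \<subseteq> skorokhod_nhd I f S e"
  proof
    fix h assume "h \<in> V"
    then obtain S' e' where *: "0 < e'" "skorokhod_nhd I h S' e' \<subseteq> skorokhod_nhd I f S e"
        "h \<in> skorokhod_space I"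
      unfolding V_def by blast
    have "h \<in> skorokhod_nhd I h S' e'"
      using *(1,3) time_change_id unfolding skorokhod_nhd_def
      by (intro CollectI conjI exI[of _ id]) simp_all
    then show "h \<in> skorokhod_nhd I f S e" using * by blast
  qed
  show "\<forall>\<^sub>F n in F. g n \<in> skorokhod_nhd I f S e"
    by (rule eventually_mono[OF ev]) (rule subsetD[OF sub])
next
  assume R: "f \<in> skorokhod_space I \<and> (\<forall>S e. 0 < e \<longrightarrow> (\<forall>\<^sub>F n in F. g n \<in> skorokhod_nhd I f S e))"
  show "limitin (skorokhod I) g f F"
    unfolding limitin_def topspace_skorokhod
  proof (intro conjI allI impI)
    fix U assume "openin (skorokhod I) U \<and> f \<in> U"
    then obtain S e where e: "0 < e" and sub: "skorokhod_nhd I f S e \<subseteq> U"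
      unfolding openin_skorokhod by blast
    have ev: "\<forall>\<^sub>F n in F. g n \<in> skorokhod_nhd I f S e" using R e by blast
    show "\<forall>\<^sub>F n in F. g n \<in> U"
      by (rule eventually_mono[OF ev]) (rule subsetD[OF sub])
  qed (rule conjunct1[OF R])
qed

definition borel_of_topology :: "'b topology \<Rightarrow> 'b measure" where
  "borel_of_topology X = sigma (topspace X) {U. openin X U}"

definition weakly_converges :: "'b topology \<Rightarrow> (nat \<Rightarrow> 'b measure) \<Rightarrow> 'b measure \<Rightarrow> bool" where
  "weakly_converges X N Q \<longleftrightarrow>
     (\<forall>F. continuous_map X euclideanreal F \<and> bounded (F ` topspace X) \<longrightarrow>
        (\<lambda>n. \<integral>f. F f \<partial>N n) \<longlonglongrightarrow> (\<integral>f. F f \<partial>Q))"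


section \<open>Markov chains\<close>

definition natural_filtration ::
  "'w measure \<Rightarrow> (nat \<Rightarrow> 'w \<Rightarrow> 'a::euclidean_space) \<Rightarrow> nat \<Rightarrow> 'w measure" where
  "natural_filtration M Phi k =
     sigma (space M) {Phi j -` B \<inter> space M | j B. j \<le> k \<and> B \<in> sets borel}"

text \<open>The family \<open>P x\<close> lives on one measurable space \<open>M\<close>, and \<open>kern\<close> is the (time-homogeneous)
  transition kernel.\<close>

locale markov_chain =
  fixes M :: "'w measure"
    and kern :: "'a::euclidean_space \<Rightarrow> 'a measure"
    and P :: "'a \<Rightarrow> 'w measure"
    and Phi :: "nat \<Rightarrow> 'w \<Rightarrow> 'a"
  assumes kernel: "kern \<in> borel \<rightarrow>\<^sub>M prob_algebra borel"
    and prob: "\<And>x. prob_space (P x)"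
    and sets_P: "\<And>x. sets (P x) = sets M"
    and random: "\<And>k. Phi k \<in> M \<rightarrow>\<^sub>M borel"
    and start: "\<And>x. AE \<omega> in P x. Phi 0 \<omega> = x"
    and markov: "\<And>x k B. B \<in> sets borel \<Longrightarrow>
      AE \<omega> in P x. real_cond_exp (P x) (natural_filtration (P x) Phi k)
        (\<lambda>\<omega>'. indicator B (Phi (Suc k) \<omega>')) \<omega> = measure (kern (Phi k \<omega>)) B"

text \<open>The library has conditional expectations of real random variables only.\<close>

definition vec_cond_exp ::
  "'w measure \<Rightarrow> 'w measure \<Rightarrow> ('w \<Rightarrow> 'a::euclidean_space) \<Rightarrow> 'w \<Rightarrow> 'a" where
  "vec_cond_exp M F f \<omega> = (\<Sum>b\<in>Basis. real_cond_exp M F (\<lambda>\<omega>'. f \<omega>' \<bullet> b) \<omega> *\<^sub>R b)"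

definition drift ::
  "('a \<Rightarrow> 'w measure) \<Rightarrow> (nat \<Rightarrow> 'w \<Rightarrow> 'a::euclidean_space) \<Rightarrow> 'a \<Rightarrow> 'a" where
  "drift P Phi x = (\<integral>\<omega>. Phi 1 \<omega> \<partial>P x) - x"

text \<open>\<open>\<epsilon>\<^sub>k\<close> for \<open>k \<ge> 1\<close>, where \<open>N\<close> is the underlying probability \<open>P x\<close>.\<close>

definition innovation ::
  "'w measure \<Rightarrow> (nat \<Rightarrow> 'w \<Rightarrow> 'a::euclidean_space) \<Rightarrow> nat \<Rightarrow> 'w \<Rightarrow> 'a" where
  "innovation N Phi k \<omega> =
     Phi k \<omega> - vec_cond_exp N (natural_filtration N Phi (k - 1)) (Phi k) \<omega>"


section \<open>Fluid limits\<close>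

definition scaled_path ::
  "real \<Rightarrow> (nat \<Rightarrow> 'w \<Rightarrow> 'a::euclidean_space) \<Rightarrow> real \<Rightarrow> 'w \<Rightarrow> real \<Rightarrow> 'a" where
  "scaled_path \<beta> Phi r \<omega> =
     (\<lambda>t\<in>{0..}. (1 / r) *\<^sub>R Phi (nat \<lfloor>t * r powr (1 + \<beta>)\<rfloor>) \<omega>)"

definition scaled_law ::
  "real \<Rightarrow> ('a \<Rightarrow> 'w measure) \<Rightarrow> (nat \<Rightarrow> 'w \<Rightarrow> 'a::euclidean_space) \<Rightarrow> real \<Rightarrow> 'a
    \<Rightarrow> (real \<Rightarrow> 'a) measure" where
  "scaled_law \<beta> P Phi r x =
     distr (P (r *\<^sub>R x)) (borel_of_topology (skorokhod {0..})) (scaled_path \<beta> Phi r)"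

definition fluid_limit ::
  "real \<Rightarrow> ('a \<Rightarrow> 'w measure) \<Rightarrow> (nat \<Rightarrow> 'w \<Rightarrow> 'a::euclidean_space) \<Rightarrow> 'a
    \<Rightarrow> (real \<Rightarrow> 'a) measure \<Rightarrow> bool" where
  "fluid_limit \<beta> P Phi x Q \<longleftrightarrow>
     prob_space Q \<and> sets Q = sets (borel_of_topology (skorokhod {0..})) \<and>
     (\<exists>r xs. (\<forall>n. 0 < r n) \<and> filterlim r at_top sequentially \<and> xs \<longlonglongrightarrow> x \<and>
        weakly_converges (skorokhod {0..}) (\<lambda>n. scaled_law \<beta> P Phi (r n) (xs n)) Q)"

definition dirac_on ::
  "real \<Rightarrow> (real \<Rightarrow> 'a::euclidean_space) measure \<Rightarrow> (real \<Rightarrow> 'a) \<Rightarrow> bool" where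
  "dirac_on T Q \<mu> \<longleftrightarrow>
     distr Q (borel_of_topology (skorokhod {0..T})) (\<lambda>f. restrict f {0..T}) =
     return (borel_of_topology (skorokhod {0..T})) (restrict \<mu> {0..T})"


section \<open>Cones and the limiting ODE\<close>

text \<open>Unlike \<^const>\<open>cone\<close> and \<^const>\<open>conic\<close>, which force \<open>0\<close> into a nonempty set, only positive
  scalars are used here.\<close>

definition open_cone :: "'a::euclidean_space set \<Rightarrow> bool" where
  "open_cone C \<longleftrightarrow> open C \<and> (\<forall>x\<in>C. \<forall>c>0. c *\<^sub>R x \<in> C)"

definition ode_solution ::
  "'a::euclidean_space set \<Rightarrow> ('a \<Rightarrow> 'a) \<Rightarrow> 'a \<Rightarrow> real set \<Rightarrow> (real \<Rightarrow> 'a) \<Rightarrow> bool" where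
  "ode_solution C h x I \<mu> \<longleftrightarrow> \<mu> 0 = x \<and>
     (\<forall>t\<in>I. \<mu> t \<in> C \<and> (\<mu> has_vector_derivative h (\<mu> t)) (at t within I)) \<and>
     continuous_on I (\<lambda>t. h (\<mu> t))"

definition unique_ode_solution ::
  "'a::euclidean_space set \<Rightarrow> ('a \<Rightarrow> 'a) \<Rightarrow> 'a \<Rightarrow> real \<Rightarrow> (real \<Rightarrow> 'a) \<Rightarrow> bool" where
  "unique_ode_solution C h x T \<mu> \<longleftrightarrow> ode_solution C h x {0..T} \<mu> \<and>
     (\<forall>T' \<nu>. 0 < T' \<and> T' \<le> T \<and> ode_solution C h x {0..T'} \<nu> \<longrightarrow> (\<forall>t\<in>{0..T'}. \<nu> t = \<mu> t))"

end

(*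
  Let q = min p 2. Truncating the innovations at r and applying Kolmogorov's maximal inequality to the
  centered truncated part bounds the probability that the noise accumulated over T r^(1+beta) steps
  ever exceeds delta r by a constant times r^(1+beta-q), which tends to 0 because beta < q - 1. Without
  noise, the scaled path is, as long as it stays near x, an Euler scheme of step r^-(1+beta) with
  vector field converging uniformly to h, so Peano's compactness argument and uniqueness of the solution
  force it to be uniformly close to mu on a short interval [0,T]. This shows that the expectation of
  a continuous functional on D[0,infinity), a variant of the uniform distance to mu on [0,T], tends to
  0; it vanishes only on paths that agree with mu on [0,T). To pass to D[0,T/2], the restriction map is
  shown to be Borel measurable as a pointwise limit of samplings on finite grids.
*)

theory Submission
  imports Defs "HOL-Complex_Analysis.Great_Picard"
begin

section \<open>Borel functions on Skorokhod space\<close>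

text \<open>A fluid limit comes with its weak convergence, so one bounded continuous functional,
  integrated against the prelimit laws, decides the claim. Second moments of the innovations may be
  infinite, hence the truncation. Its level \<open>r\<close> is also the order of the tolerated
  error \<open>\<delta> * r\<close>, and this balances two costs: a truncated step has variance of
  order \<open>r powr (2 - q)\<close> against the squared error \<open>r\<^sup>2\<close>, a
  discarded tail has mean of order \<open>r powr (1 - q)\<close> against the error \<open>r\<close>.
  Either way a step costs \<open>r powr (- q)\<close>, and there are about
  \<open>T * r powr (1 + \<beta>)\<close> steps. On the path side the obstacle is that restriction
  to \<open>{0..T}\<close> is not continuous: a jump at \<open>T\<close> can be approximated by
  jumps just after \<open>T\<close>, which the restriction does not see. A Dirac image measure
  nevertheless requires this map to be measurable, for a Borel sigma-field known only through its
  open sets. The functional controls \<open>{0..<T}\<close> alone; halving \<open>T\<close> recovers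
  a closed interval.\<close>

lemma space_borel_of_topology [simp]: "space (borel_of_topology X) = topspace X"
  unfolding borel_of_topology_def by (rule space_measure_of) (auto dest: openin_subset)

lemma sets_borel_of_topology:
  "sets (borel_of_topology X) = sigma_sets (topspace X) {U. openin X U}"
  unfolding borel_of_topology_def by (rule sets_measure_of) (auto dest: openin_subset)

lemma openin_sets_borel_of_topology: "openin X U \<Longrightarrow> U \<in> sets (borel_of_topology X)"
  unfolding sets_borel_of_topology by auto

lemma borel_measurable_continuous_map:
  assumes "continuous_map X euclidean F"
  shows "F \<in> borel_measurable (borel_of_topology X)"
proof (rule borel_measurableI)
  fix S :: "'b set" assume "open S"
  then have "openin X {x \<in> topspace X. F x \<in> S}"
    using assms unfolding continuous_map by (simp add: vimage_def Int_def conj_commute)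
  then show "F -` S \<inter> space (borel_of_topology X) \<in> sets (borel_of_topology X)"
    by (intro openin_sets_borel_of_topology) (simp add: vimage_def Int_def conj_commute)
qed

lemma measurable_borel_of_topologyI:
  assumes "f \<in> space M \<rightarrow> topspace X"
    and "\<And>U. openin X U \<Longrightarrow> f -` U \<inter> space M \<in> sets M"
  shows "f \<in> M \<rightarrow>\<^sub>M borel_of_topology X"
  unfolding borel_of_topology_def
  using assms by (intro measurable_measure_of) (auto dest: openin_subset)

text \<open>Openness in \<open>skorokhod\<close> is defined through the sets
  \<open>skorokhod_nhd\<close>, so an epsilon-delta estimate on one such set around each path makes
  the preimages of open sets open.\<close>

lemma continuous_map_skorokhodI:
  fixes F :: "(real \<Rightarrow> 'a::euclidean_space) \<Rightarrow> 'b::metric_space"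
  assumes "\<And>f e. f \<in> skorokhod_space I \<Longrightarrow> 0 < e \<Longrightarrow>
    \<exists>S d. 0 < d \<and> (\<forall>g\<in>skorokhod_nhd I f S d. dist (F g) (F f) < e)"
  shows "continuous_map (skorokhod I) euclidean F"
  unfolding continuous_map
proof (intro conjI allI impI)
  fix U :: "'b set" assume "openin euclidean U"
  then have U: "open U" by simp
  show "openin (skorokhod I) {x \<in> topspace (skorokhod I). F x \<in> U}"
    unfolding openin_skorokhod topspace_skorokhod
  proof (intro conjI ballI)
    fix f assume f: "f \<in> {x \<in> skorokhod_space I. F x \<in> U}"
    then obtain e where e: "0 < e" "\<And>y. dist y (F f) < e \<Longrightarrow> y \<in> U"
      using U unfolding open_dist by blast
    obtain S d where "0 < d" "\<forall>g\<in>skorokhod_nhd I f S d. dist (F g) (F f) < e"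
      using assms f e(1) by blast
    then show "\<exists>S d. 0 < d \<and> skorokhod_nhd I f S d \<subseteq> {x \<in> skorokhod_space I. F x \<in> U}"
      using e(2) by (intro exI[of _ S] exI[of _ d]) (auto simp: skorokhod_nhd_def)
  qed auto
qed auto

section \<open>The deviation functional and its continuity\<close>

text \<open>Letting \<open>e\<close> also shorten the time interval makes this variant of the uniform distance to \<open>\<mu>\<close>
  continuous in the Skorokhod topology: time changes may move jumps across the end point \<open>T\<close>.\<close>

definition path_deviation :: "(real \<Rightarrow> 'a::euclidean_space) \<Rightarrow> real \<Rightarrow> (real \<Rightarrow> 'a) \<Rightarrow> real" where
  "path_deviation \<mu> T f = Inf {e. 0 \<le> e \<and> (\<forall>t\<in>{0..T - e}. norm (f t - \<mu> t) \<le> e)}"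

lemma path_deviation_le:
  assumes "0 \<le> e" "\<And>t. 0 \<le> t \<Longrightarrow> t \<le> T - e \<Longrightarrow> norm (f t - \<mu> t) \<le> e"
  shows "path_deviation \<mu> T f \<le> e"
  unfolding path_deviation_def using assms by (intro cInf_lower bdd_belowI[of _ 0]) auto

lemma path_deviation_lessD:
  assumes "path_deviation \<mu> T f < a" "0 < T"
  obtains e where "0 \<le> e" "e < a" "\<And>t. 0 \<le> t \<Longrightarrow> t \<le> T - e \<Longrightarrow> norm (f t - \<mu> t) \<le> e"
proof -
  \<comment> \<open>For \<open>e = T + 1\<close> the interval \<open>{0..T - e}\<close> is empty, so
    the infimum is taken over a nonempty set for every \<open>f\<close>. The same value is the
    universal upper bound in \<open>path_deviation_bounded\<close>.\<close>
  have "T + 1 \<in> {e. 0 \<le> e \<and> (\<forall>t\<in>{0..T - e}. norm (f t - \<mu> t) \<le> e)}" using assms by auto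
  then have "{e. 0 \<le> e \<and> (\<forall>t\<in>{0..T - e}. norm (f t - \<mu> t) \<le> e)} \<noteq> {}" by blast
  from cInf_lessD[OF this assms(1)[unfolded path_deviation_def]] that show ?thesis by auto
qed

lemma path_deviation_nonneg: "0 < T \<Longrightarrow> 0 \<le> path_deviation \<mu> T f"
  by (rule ccontr, erule path_deviation_lessD[of \<mu> T f 0, OF iffD1[OF not_le]]) auto

lemma path_deviation_bounded: "0 < T \<Longrightarrow> path_deviation \<mu> T f \<le> T + 1"
  by (rule path_deviation_le) auto

lemma path_deviation_eq_0D:
  assumes "path_deviation \<mu> T f = 0" "0 \<le> t" "t < T"
  shows "f t = \<mu> t"
proof (rule ccontr)
  assume "f t \<noteq> \<mu> t"
  \<comment> \<open>An \<open>e\<close> below \<open>T - t\<close> keeps \<open>t\<close> inside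
    \<open>{0..T - e}\<close>; being also below the norm, it contradicts the estimate at
    \<open>t\<close>. This is where \<open>t < T\<close> enters.\<close>
  then have pos: "0 < min (norm (f t - \<mu> t)) (T - t)" using assms by simp
  have T: "0 < T" using assms by simp
  obtain e where "e < min (norm (f t - \<mu> t)) (T - t)"
      "\<And>t. 0 \<le> t \<Longrightarrow> t \<le> T - e \<Longrightarrow> norm (f t - \<mu> t) \<le> e"
    by (rule path_deviation_lessD[of \<mu> T f "min (norm (f t - \<mu> t)) (T - t)", OF _ T]) (use pos assms in auto)
  from this(1) this(2)[of t] show False using assms by simp
qed

text \<open>If \<open>a\<close> is admissible for one of two close paths,
  \<open>a + 2 * \<epsilon>\<close> is admissible for the other: one \<open>\<epsilon>\<close> pays
  for the distance of the paths along the time change, the other for the oscillation of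
  \<open>\<mu>\<close> between a time and its image. Shortening the interval by
  \<open>2 * \<epsilon>\<close> keeps the moved times at most \<open>T - a\<close>.\<close>

lemma continuous_map_path_deviation:
  fixes \<mu> :: "real \<Rightarrow> 'a::euclidean_space"
  assumes \<mu>: "continuous_on {0..T} \<mu>" and T: "0 < T"
  shows "continuous_map (skorokhod {0..}) euclideanreal (path_deviation \<mu> T)"
proof (rule continuous_map_skorokhodI)
  fix f :: "real \<Rightarrow> 'a" and e :: real assume e: "0 < e"
  \<comment> \<open>Two thirds of \<open>e\<close> cover the loss \<open>2 * \<epsilon>\<close>, the
    last third the choice of an admissible \<open>a\<close> near the infimum.\<close>
  define \<epsilon> where "\<epsilon> = e / 3"
  have \<epsilon>: "0 < \<epsilon>" using e by (simp add: \<epsilon>_def)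
  obtain d where d: "0 < d" "\<And>s t. s \<in> {0..T} \<Longrightarrow> t \<in> {0..T} \<Longrightarrow> dist s t < d \<Longrightarrow> dist (\<mu> s) (\<mu> t) < \<epsilon>"
    using compact_uniformly_continuous[OF \<mu> compact_Icc] \<epsilon> unfolding uniformly_continuous_on_def
    by metis
  have "dist (path_deviation \<mu> T g) (path_deviation \<mu> T f) < e"
    if g: "g \<in> skorokhod_nhd {0..} f T (min d \<epsilon>)" for g
  proof -
    obtain l where l: "time_change {0..} l" "\<And>t. 0 \<le> t \<Longrightarrow> \<bar>l t - t\<bar> < min d \<epsilon>"
        "\<And>t. 0 \<le> t \<Longrightarrow> t \<le> T \<Longrightarrow> dist (g (l t)) (f t) < min d \<epsilon>"
      using g unfolding skorokhod_nhd_def by auto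
    have lp: "0 \<le> l t" if "0 \<le> t" for t using time_change_mem[OF l(1), of t] that by simp
    have ls: "\<exists>t\<ge>0. l t = s" if "0 \<le> s" for s
      using l(1) that unfolding time_change_def by (metis atLeast_iff imageE)
    have gf: "path_deviation \<mu> T g \<le> a + 2 * \<epsilon>"
      if a: "0 \<le> a" "\<And>t. 0 \<le> t \<Longrightarrow> t \<le> T - a \<Longrightarrow> norm (f t - \<mu> t) \<le> a" for a
    proof (rule path_deviation_le)
      fix s assume s: "0 \<le> s" "s \<le> T - (a + 2 * \<epsilon>)"
      obtain t where t: "0 \<le> t" "l t = s" using ls s by blast
      have "t \<le> T - a" using l(2)[OF t(1)] t s by auto
      moreover have "norm (g s - \<mu> s) \<le> dist (g (l t)) (f t) + norm (f t - \<mu> t) + dist (\<mu> t) (\<mu> s)"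
        unfolding dist_norm t(2) using norm_triangle_ineq[of "g s - f t" "f t - \<mu> t + (\<mu> t - \<mu> s)"]
          norm_triangle_ineq[of "f t - \<mu> t" "\<mu> t - \<mu> s"] by simp
      moreover have "dist (\<mu> t) (\<mu> s) < \<epsilon>"
        using l(2)[OF t(1)] t s a \<epsilon> \<open>t \<le> T - a\<close> by (intro d(2)) (auto simp: dist_real_def)
      ultimately show "norm (g s - \<mu> s) \<le> a + 2 * \<epsilon>"
        using a(2)[OF t(1)] l(3)[OF t(1)] a(1) by fastforce
    qed (use a \<epsilon> in auto)
    have fg: "path_deviation \<mu> T f \<le> a + 2 * \<epsilon>"
      if a: "0 \<le> a" "\<And>t. 0 \<le> t \<Longrightarrow> t \<le> T - a \<Longrightarrow> norm (g t - \<mu> t) \<le> a" for a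
    proof (rule path_deviation_le)
      fix t assume t: "0 \<le> t" "t \<le> T - (a + 2 * \<epsilon>)"
      have s: "l t \<le> T - a" using l(2)[OF t(1)] t \<epsilon> by auto
      moreover have "norm (f t - \<mu> t) \<le> dist (g (l t)) (f t) + norm (g (l t) - \<mu> (l t)) + dist (\<mu> (l t)) (\<mu> t)"
        unfolding dist_norm using norm_triangle_ineq[of "f t - g (l t)" "g (l t) - \<mu> (l t) + (\<mu> (l t) - \<mu> t)"]
          norm_triangle_ineq[of "g (l t) - \<mu> (l t)" "\<mu> (l t) - \<mu> t"] norm_minus_commute[of "f t" "g (l t)"] by simp
      moreover have "dist (\<mu> (l t)) (\<mu> t) < \<epsilon>"
        using l(2)[OF t(1)] t s a \<epsilon> lp[OF t(1)] by (intro d(2)) (auto simp: dist_real_def)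
      ultimately show "norm (f t - \<mu> t) \<le> a + 2 * \<epsilon>"
        using a(2)[OF lp[OF t(1)]] l(3)[OF t(1)] a(1) t \<epsilon> by fastforce
    qed (use a \<epsilon> in auto)
    have "path_deviation \<mu> T g < path_deviation \<mu> T f + e"
    proof -
      obtain a where "a < path_deviation \<mu> T f + \<epsilon>" "0 \<le> a"
          "\<And>t. 0 \<le> t \<Longrightarrow> t \<le> T - a \<Longrightarrow> norm (f t - \<mu> t) \<le> a"
        by (rule path_deviation_lessD[of \<mu> T f "path_deviation \<mu> T f + \<epsilon>", OF _ T]) (use \<epsilon> in auto)
      then show ?thesis using gf[of a] by (simp add: \<epsilon>_def)
    qed
    moreover have "path_deviation \<mu> T f < path_deviation \<mu> T g + e"
    proof -
      obtain a where "a < path_deviation \<mu> T g + \<epsilon>" "0 \<le> a"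
          "\<And>t. 0 \<le> t \<Longrightarrow> t \<le> T - a \<Longrightarrow> norm (g t - \<mu> t) \<le> a"
        by (rule path_deviation_lessD[of \<mu> T g "path_deviation \<mu> T g + \<epsilon>", OF _ T]) (use \<epsilon> in auto)
      then show ?thesis using fg[of a] by (simp add: \<epsilon>_def)
    qed
    ultimately show ?thesis by (simp add: dist_real_def abs_less_iff)
  qed
  then show "\<exists>S d. 0 < d \<and> (\<forall>g\<in>skorokhod_nhd {0..} f S d. dist (path_deviation \<mu> T g) (path_deviation \<mu> T f) < e)"
    using d(1) \<epsilon> by (intro exI[of _ T] exI[of _ "min d \<epsilon>"]) auto
qed

section \<open>Step functions and the measurability of rescaled paths\<close>

text \<open>With \<open>R\<close> steps per unit of time this covers two uses: on
  \<open>{0..}\<close> the rescaled path of the chain, on \<open>{0..T}\<close> the sampling of a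
  path on a finite grid.\<close>

definition step_path :: "real set \<Rightarrow> real \<Rightarrow> (nat \<Rightarrow> 'a) \<Rightarrow> real \<Rightarrow> 'a" where
  "step_path I R v = (\<lambda>t\<in>I. v (nat \<lfloor>t * R\<rfloor>))"

lemma step_path_in_skorokhod_space:
  fixes v :: "nat \<Rightarrow> 'a::euclidean_space"
  assumes R: "0 < R"
  shows "step_path I R v \<in> skorokhod_space I"
proof -
  have "(step_path I R v \<longlongrightarrow> step_path I R v t) (at t within I \<inter> {t<..}) \<and>
        (\<exists>l. (step_path I R v \<longlongrightarrow> l) (at t within I \<inter> {..<t}))" if t: "t \<in> I" for t
  proof (intro conjI exI)
    define d where "d = (of_int \<lfloor>t * R\<rfloor> + 1) / R - t"
    have d: "0 < d" unfolding d_def using R floor_correct[of "t * R"] by (simp add: field_simps)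
    have "\<lfloor>s * R\<rfloor> = \<lfloor>t * R\<rfloor>" if "t < s" "dist s t < d" for s
    proof (rule floor_unique)
      show "of_int \<lfloor>t * R\<rfloor> \<le> s * R" using that R
        by (meson less_eq_real_def mult_right_mono of_int_floor_le order_trans)
      show "s * R < of_int \<lfloor>t * R\<rfloor> + 1"
        using that R unfolding d_def dist_real_def by (simp add: field_simps)
    qed
    then show "(step_path I R v \<longlongrightarrow> step_path I R v t) (at t within I \<inter> {t<..})"
      using d t by (intro tendsto_eventually) (auto simp: eventually_at step_path_def intro!: exI[of _ d])
    \<comment> \<open>Just to the left of \<open>t\<close> the index is the ceiling of
      \<open>t * R\<close> minus one, also when \<open>t\<close> is itself a grid point; this
      identifies the left limit.\<close>
    define d where "d = t - (of_int \<lceil>t * R\<rceil> - 1) / R"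
    have d: "0 < d" unfolding d_def using R ceiling_correct[of "t * R"] by (simp add: field_simps)
    have "\<lfloor>s * R\<rfloor> = \<lceil>t * R\<rceil> - 1" if "s < t" "dist s t < d" for s
    proof (rule floor_unique)
      show "of_int (\<lceil>t * R\<rceil> - 1) \<le> s * R"
        using that R unfolding d_def dist_real_def by (simp add: field_simps)
      have "s * R < t * R" using that R by simp
      then show "s * R < of_int (\<lceil>t * R\<rceil> - 1) + 1"
        by (simp add: less_le_trans)
    qed
    then show "(step_path I R v \<longlongrightarrow> v (nat (\<lceil>t * R\<rceil> - 1))) (at t within I \<inter> {..<t})"
      using d t by (intro tendsto_eventually) (auto simp: eventually_at step_path_def intro!: exI[of _ d])
  qed
  then show ?thesis
    by (auto simp: skorokhod_space_def cadlag_on_def) (simp add: step_path_def)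
qed

lemma skorokhod_nhd_uniformI:
  assumes "g \<in> skorokhod_space I" "0 < e" "\<And>t. t \<in> I \<Longrightarrow> t \<le> S \<Longrightarrow> dist (g t) (f t) < e"
  shows "g \<in> skorokhod_nhd I f S e"
  unfolding skorokhod_nhd_def using assms time_change_id
  by (intro CollectI conjI exI[of _ id]) auto

text \<open>A neighbourhood constrains values only up to time \<open>S\<close>, hence only finitely
  many coordinates \<open>v k\<close>. The preimage of an open set is therefore open in the product
  topology.\<close>

lemma measurable_step_path:
  assumes R: "0 < R"
  shows "step_path I R \<in> (borel :: (nat \<Rightarrow> 'a::euclidean_space) measure) \<rightarrow>\<^sub>M borel_of_topology (skorokhod I)"
proof (rule measurable_borel_of_topologyI)
  show "step_path I R \<in> space borel \<rightarrow> topspace (skorokhod I)"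
    using step_path_in_skorokhod_space[OF R] by (auto simp: topspace_skorokhod)
  fix U assume U: "openin (skorokhod I) (U :: (real \<Rightarrow> 'a) set)"
  have "open (step_path I R -` U)"
  proof (subst open_subopen, intro ballI)
    fix v :: "nat \<Rightarrow> 'a" assume "v \<in> step_path I R -` U"
    then obtain S e where e: "0 < e" "skorokhod_nhd I (step_path I R v) S e \<subseteq> U"
      using U unfolding openin_skorokhod by auto
    define K where "K = {..nat \<lfloor>S * R\<rfloor>}"
    define V where "V = Pi\<^sub>E UNIV (\<lambda>k. if k \<in> K then ball (v k) e else UNIV)"
    have "open V" unfolding V_def
      by (rule open_PiE) (auto simp: K_def intro: finite_subset[of _ "{..nat \<lfloor>S * R\<rfloor>}"])
    moreover have "v \<in> V" using e by (auto simp: V_def)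
    moreover have "V \<subseteq> step_path I R -` U"
    proof
      fix w assume w: "w \<in> V"
      have "step_path I R w \<in> skorokhod_nhd I (step_path I R v) S e"
      proof (intro skorokhod_nhd_uniformI step_path_in_skorokhod_space R e(1))
        fix t assume t: "t \<in> I" "t \<le> S"
        have "nat \<lfloor>t * R\<rfloor> \<in> K" unfolding K_def using t R by (auto intro!: nat_mono floor_mono)
        then show "dist (step_path I R w t) (step_path I R v t) < e"
          using w t by (auto simp: V_def step_path_def PiE_iff dist_commute split: if_splits)
      qed
      then show "w \<in> step_path I R -` U" using e by auto
    qed
    ultimately show "\<exists>T. open T \<and> v \<in> T \<and> T \<subseteq> step_path I R -` U" by blast
  qed
  then show "step_path I R -` U \<inter> space borel \<in> sets borel" by simp
qed

section \<open>Measurability of the evaluations\<close>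

lemma skorokhod_right_tendsto:
  assumes "f \<in> skorokhod_space {0..}" "0 \<le> t"
  shows "(f \<longlongrightarrow> f t) (at_right t)"
proof -
  have "{0..} \<inter> {t<..} = {t<..}" using assms(2) by auto
  moreover have "(f \<longlongrightarrow> f t) (at t within {0..} \<inter> {t<..})"
    using assms unfolding skorokhod_space_def cadlag_on_def by auto
  ultimately show ?thesis by simp
qed

text \<open>The same slack \<open>\<eta>\<close> widens the time interval and raises the bound. A
  perturbation by \<open>\<eta> / 2\<close> in time and in space then leaves slack
  \<open>\<eta> / 2\<close>, so the condition is stable.\<close>

lemma openin_skorokhod_lower_bound:
  fixes i :: "'a::euclidean_space"
  assumes i: "i \<in> Basis"
  shows "openin (skorokhod {0..}) {f \<in> skorokhod_space {0..}.
    \<exists>\<eta>>0. \<forall>s\<ge>0. a - \<eta> \<le> s \<and> s \<le> b + \<eta> \<longrightarrow> c + \<eta> < f s \<bullet> i}" (is "openin _ ?W")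
  unfolding openin_skorokhod
proof (intro conjI ballI)
  fix f assume "f \<in> ?W"
  then obtain \<eta> where \<eta>: "0 < \<eta>" "\<And>s. 0 \<le> s \<Longrightarrow> a - \<eta> \<le> s \<Longrightarrow> s \<le> b + \<eta> \<Longrightarrow> c + \<eta> < f s \<bullet> i" by auto
  have "skorokhod_nhd {0..} f (b + \<eta>) (\<eta> / 2) \<subseteq> ?W"
  proof
    fix g assume g: "g \<in> skorokhod_nhd {0..} f (b + \<eta>) (\<eta> / 2)"
    then obtain l where l: "time_change {0..} l" "\<And>t. 0 \<le> t \<Longrightarrow> \<bar>l t - t\<bar> < \<eta> / 2"
        "\<And>t. 0 \<le> t \<Longrightarrow> t \<le> b + \<eta> \<Longrightarrow> dist (g (l t)) (f t) < \<eta> / 2"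
      unfolding skorokhod_nhd_def by auto
    have "c + \<eta> / 2 < g s \<bullet> i" if s: "0 \<le> s" "a - \<eta> / 2 \<le> s" "s \<le> b + \<eta> / 2" for s
    proof -
      obtain t where t: "0 \<le> t" "l t = s"
        using l(1) s(1) unfolding time_change_def by (metis atLeast_iff imageE)
      have "a - \<eta> \<le> t" "t \<le> b + \<eta>" using l(2)[OF t(1)] s unfolding t(2) by linarith+
      then have "c + \<eta> < f t \<bullet> i" "dist (g s) (f t) < \<eta> / 2" using \<eta>(2) l(3) t by auto
      moreover have "\<bar>(g s - f t) \<bullet> i\<bar> \<le> dist (g s) (f t)"
        using Basis_le_norm[OF i] by (simp add: dist_norm)
      ultimately show ?thesis by (simp add: inner_diff_left)
    qed
    then show "g \<in> ?W" using g \<eta>(1) by (auto simp: skorokhod_nhd_def intro!: exI[of _ "\<eta> / 2"])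
  qed
  then show "\<exists>S e. 0 < e \<and> skorokhod_nhd {0..} f S e \<subseteq> ?W" using \<eta>(1) half_gt_zero by blast
qed auto

text \<open>Evaluation at \<open>t\<close> is not continuous, but by right continuity \<open>f t \<bullet> i > a\<close> holds iff
  \<open>f \<bullet> i\<close> has a lower bound \<open>> a\<close> on some \<open>(t, t + \<delta>]\<close>, and lower bounds on compact intervals
  define open sets.\<close>

lemma measurable_skorokhod_eval:
  assumes t: "0 \<le> t"
  shows "(\<lambda>f. f t) \<in> borel_measurable (borel_of_topology (skorokhod {0..} :: (real \<Rightarrow> 'a::euclidean_space) topology))"
    (is "_ \<in> borel_measurable ?D")
proof (subst borel_measurable_euclidean_space, intro ballI, subst borel_measurable_iff_greater, intro allI)
  fix i :: 'a and a :: real assume i: "i \<in> Basis"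
  define \<delta> where "\<delta> n = inverse (real (Suc n))" for n
  have \<delta>: "0 < \<delta> n" for n by (simp add: \<delta>_def)
  have \<delta>_mono: "\<delta> n < \<delta> m" if "m < n" for m n using that by (simp add: \<delta>_def)
  \<comment> \<open>The intervals from \<open>t + \<delta> (Suc m + k)\<close> to
    \<open>t + \<delta> (Suc m)\<close> stay to the right of \<open>t\<close> and exhaust the
    punctured right neighbourhood as \<open>k\<close> grows. The margin \<open>\<delta> m\<close> in
    the bound keeps the inequality strict in the limit.\<close>
  define W where "W m k = {f \<in> skorokhod_space {0..}. \<exists>\<eta>>0. \<forall>s\<ge>0.
    t + \<delta> (Suc m + k) - \<eta> \<le> s \<and> s \<le> t + \<delta> (Suc m) + \<eta> \<longrightarrow> a + \<delta> m + \<eta> < f s \<bullet> i}" for m k :: nat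
  have "f t \<bullet> i > a \<longleftrightarrow> (\<exists>m. \<forall>k. f \<in> W m k)" if f: "f \<in> skorokhod_space {0..}" for f
  proof
    have lim: "((\<lambda>s. f s \<bullet> i) \<longlongrightarrow> f t \<bullet> i) (at_right t)"
      by (intro tendsto_intros skorokhod_right_tendsto f t)
    assume a: "f t \<bullet> i > a"
    define \<gamma> where "\<gamma> = (f t \<bullet> i - a) / 2"
    have \<gamma>: "0 < \<gamma>" "a + \<gamma> < f t \<bullet> i" using a by (auto simp: \<gamma>_def field_simps)
    obtain u where u: "t < u" "\<And>s. t < s \<Longrightarrow> s < u \<Longrightarrow> a + \<gamma> < f s \<bullet> i"
      using order_tendstoD(1)[OF lim \<gamma>(2)] unfolding eventually_at_right_field by blast
    obtain m where m: "\<delta> m < min (\<gamma> / 2) ((u - t) / 2)"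
      using reals_Archimedean[of "min (\<gamma> / 2) ((u - t) / 2)"] \<gamma> u by (auto simp: \<delta>_def)
    have "f \<in> W m k" for k
    proof -
      have "a + \<delta> m + \<delta> (Suc m + k) / 2 < f s \<bullet> i"
        if "t + \<delta> (Suc m + k) - \<delta> (Suc m + k) / 2 \<le> s" "s \<le> t + \<delta> (Suc m) + \<delta> (Suc m + k) / 2" for s
      proof -
        have "t < s" using that \<delta>[of "Suc m + k"] by simp
        moreover have "s < u" using that \<delta>_mono[of m "Suc m"] \<delta>_mono[of m "Suc m + k"] m \<delta>[of m] by simp
        ultimately show ?thesis using u(2)[of s] \<delta>_mono[of m "Suc m + k"] m \<delta>[of m] by simp
      qed
      then show ?thesis using f \<delta>[of "Suc m + k"] unfolding W_def
        by (intro CollectI conjI exI[of _ "\<delta> (Suc m + k) / 2"]) auto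
    qed
    then show "\<exists>m. \<forall>k. f \<in> W m k" by blast
  next
    assume "\<exists>m. \<forall>k. f \<in> W m k"
    then obtain m where m: "\<And>k. f \<in> W m k" by blast
    \<comment> \<open>The left end points of these intervals decrease to \<open>t\<close>, so right
      continuity carries the bound \<open>a + \<delta> m\<close> over to \<open>f t\<close>.\<close>
    have low: "a + \<delta> m \<le> f (t + \<delta> (Suc m + k)) \<bullet> i" for k
    proof -
      obtain \<eta> where \<eta>: "\<eta> > 0" "\<And>s. 0 \<le> s \<Longrightarrow> t + \<delta> (Suc m + k) - \<eta> \<le> s \<Longrightarrow>
          s \<le> t + \<delta> (Suc m) + \<eta> \<Longrightarrow> a + \<delta> m + \<eta> < f s \<bullet> i"
        using m[of k] unfolding W_def by blast
      have "\<delta> (Suc m + k) \<le> \<delta> (Suc m)" by (simp add: \<delta>_def)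
      with \<eta>(1) have "a + \<delta> m + \<eta> < f (t + \<delta> (Suc m + k)) \<bullet> i"
        using t \<delta>[of "Suc m + k"] by (intro \<eta>(2)) auto
      then show ?thesis using \<eta>(1) by simp
    qed
    have "(\<lambda>k. \<delta> (k + Suc m)) \<longlonglongrightarrow> 0"
      unfolding \<delta>_def by (intro LIMSEQ_ignore_initial_segment LIMSEQ_inverse_real_of_nat)
    then have "(\<lambda>k. t + \<delta> (Suc m + k)) \<longlonglongrightarrow> t + 0" by (intro tendsto_intros) (simp add: add.commute)
    then have "filterlim (\<lambda>k. t + \<delta> (Suc m + k)) (at_right t) sequentially"
      unfolding filterlim_at using \<delta> by (auto intro!: always_eventually simp: less_imp_neq[symmetric])
    then have "(\<lambda>k. f (t + \<delta> (Suc m + k)) \<bullet> i) \<longlonglongrightarrow> f t \<bullet> i"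
      by (intro tendsto_intros filterlim_compose[OF skorokhod_right_tendsto[OF f t]])
    then have "a + \<delta> m \<le> f t \<bullet> i"
      using low by (intro LIMSEQ_le_const) auto
    then show "f t \<bullet> i > a" using \<delta>[of m] by simp
  qed
  then have "{w \<in> space ?D. a < w t \<bullet> i} = (\<Union>m. \<Inter>k. W m k)"
    by (auto simp: topspace_skorokhod) (auto simp: W_def)
  also have "\<dots> \<in> sets ?D"
    unfolding W_def by (intro sets.countable_UN sets.countable_INT image_subsetI
      openin_sets_borel_of_topology openin_skorokhod_lower_bound i) auto
  finally show "{w \<in> space ?D. a < w t \<bullet> i} \<in> sets ?D" .
qed

section \<open>Sampling cadlag paths on finite grids\<close>

text \<open>A finite partition of \<open>{0..<b}\<close> into half-open pieces with oscillation
  below \<open>e\<close>, given inductively so that a time change can be built piece by piece by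
  rule induction.\<close>

inductive step_partition :: "(real \<Rightarrow> 'a::metric_space) \<Rightarrow> real \<Rightarrow> real \<Rightarrow> bool"
  for f e where
  zero: "step_partition f e 0"
| step: "step_partition f e b \<Longrightarrow> b < c \<Longrightarrow> (\<And>s t. b \<le> s \<Longrightarrow> s < c \<Longrightarrow> b \<le> t \<Longrightarrow> t < c \<Longrightarrow> dist (f s) (f t) < e)
    \<Longrightarrow> step_partition f e c"

lemma step_partition_nonneg: "step_partition f e b \<Longrightarrow> 0 \<le> b"
  by (induction rule: step_partition.induct) auto

text \<open>Take the supremum \<open>s\<close> of the reachable end points up to \<open>T\<close>.
  The left limit at \<open>s\<close> makes a last piece ending in \<open>s\<close> admissible, so
  \<open>s\<close> is reached; right continuity at \<open>s\<close> would allow one more piece if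
  \<open>s < T\<close>.\<close>

lemma cadlag_step_partition:
  fixes f :: "real \<Rightarrow> 'a::euclidean_space"
  assumes f: "f \<in> skorokhod_space {0..}" and e: "0 < e" and T: "0 \<le> T"
  shows "step_partition f e T"
proof -
  define B where "B = {b. b \<le> T \<and> step_partition f e b}"
  have B0: "0 \<in> B" using T by (simp add: B_def step_partition.zero)
  have bdd: "bdd_above B" by (intro bdd_aboveI[of _ T]) (simp add: B_def)
  define s where "s = Sup B"
  have "0 \<le> s" unfolding s_def by (rule cSup_upper[OF B0 bdd])
  moreover have "s \<le> T"
    unfolding s_def by (rule cSup_least) (use B0 in blast, simp add: B_def)
  ultimately have s: "0 \<le> s" "s \<le> T" .
  have "s \<in> B"
  proof (cases "s = 0")
    case False
    obtain l where "(f \<longlongrightarrow> l) (at s within {0..} \<inter> {..<s})"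
      using f s unfolding skorokhod_space_def cadlag_on_def by auto
    then have "\<forall>\<^sub>F x in at s within {0..} \<inter> {..<s}. dist (f x) l < e / 2"
      using e by (intro tendstoD) auto
    then obtain d where d: "0 < d" "\<And>x. 0 \<le> x \<Longrightarrow> x < s \<Longrightarrow> dist x s < d \<Longrightarrow> dist (f x) l < e / 2"
      unfolding eventually_at by auto
    have "\<exists>b\<in>B. s - d < b" unfolding s_def by (rule less_cSupD) (use B0 d(1) in auto)
    then obtain b where b: "b \<in> B" "s - d < b" by blast
    have bs: "b \<le> s" unfolding s_def using b bdd by (simp add: cSup_upper)
    show ?thesis
    proof (cases "b = s")
      case False
      have "step_partition f e s"
      proof (rule step_partition.step)
        have "0 \<le> b" using b(1) step_partition_nonneg unfolding B_def by blast
        have near: "dist (f x) l < e / 2" if x: "b \<le> x" "x < s" for x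
        proof (rule d(2))
          show "0 \<le> x" using \<open>0 \<le> b\<close> x(1) by (rule order_trans)
          show "dist x s < d" using x b(2) by (simp add: dist_real_def)
        qed (rule x)
        fix u v assume uv: "b \<le> u" "u < s" "b \<le> v" "v < s"
        have "dist (f u) l < e / 2" "dist (f v) l < e / 2" by (rule near; fact uv)+
        then show "dist (f u) (f v) < e" by (rule dist_triangle_half_l)
      qed (use b bs False in \<open>auto simp: B_def\<close>)
      then show ?thesis using s by (simp add: B_def)
    qed (use b in simp)
  qed (use B0 in simp)
  moreover have "s = T"
  proof (rule ccontr)
    assume "s \<noteq> T"
    then have "s < T" using s by simp
    have "\<forall>\<^sub>F x in at_right s. dist (f x) (f s) < e / 2"
      using skorokhod_right_tendsto[OF f s(1)] e by (intro tendstoD) auto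
    then obtain u where u: "s < u" "\<And>x. s < x \<Longrightarrow> x < u \<Longrightarrow> dist (f x) (f s) < e / 2"
      unfolding eventually_at_right_field by blast
    have u': "dist (f x) (f s) < e / 2" if "s \<le> x" "x < u" for x
      using u(2)[of x] that e by (cases "x = s") auto
    have "step_partition f e (min u T)"
    proof (rule step_partition.step)
      show "step_partition f e s" using \<open>s \<in> B\<close> by (simp add: B_def)
      fix x y assume "s \<le> x" "x < min u T" "s \<le> y" "y < min u T"
      then show "dist (f x) (f y) < e" by (intro dist_triangle_half_l[OF u' u']) auto
    qed (use u \<open>s < T\<close> in auto)
    then have "min u T \<in> B" by (simp add: B_def)
    then have "min u T \<le> s" unfolding s_def by (rule cSup_upper[OF _ bdd])
    then show False using u \<open>s < T\<close> by auto
  qed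
  ultimately show ?thesis by (simp add: B_def)
qed

text \<open>The partition points are moved to the next larger grid points, linearly in between, so that
  sampling \<open>f\<close> on the grid never looks across a partition point.\<close>

lemma step_partition_time_change:
  assumes "step_partition f e b"
  shows "\<exists>\<eta>0>0. \<forall>\<eta>. 0 < \<eta> \<and> \<eta> < \<eta>0 \<longrightarrow> (\<exists>l. strict_mono_on {0..b} l \<and>
    l ` {0..b} = {0..\<eta> * of_int \<lceil>b / \<eta>\<rceil>} \<and> (\<forall>t\<in>{0..b}. \<bar>l t - t\<bar> \<le> \<eta>) \<and>
    (\<forall>t\<in>{0..<b}. dist (f (\<eta> * of_int \<lfloor>l t / \<eta>\<rfloor>)) (f t) < e))"
  using assms
proof (induction rule: step_partition.induct)
  case zero
  show ?case by (intro exI[of _ 1] conjI allI impI exI[of _ id]) (auto simp: strict_mono_on_def)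
next
  case (step b c)
  obtain \<eta>0 where \<eta>0: "0 < \<eta>0" "\<And>\<eta>. 0 < \<eta> \<and> \<eta> < \<eta>0 \<Longrightarrow> \<exists>l. strict_mono_on {0..b} l \<and>
    l ` {0..b} = {0..\<eta> * of_int \<lceil>b / \<eta>\<rceil>} \<and> (\<forall>t\<in>{0..b}. \<bar>l t - t\<bar> \<le> \<eta>) \<and>
    (\<forall>t\<in>{0..<b}. dist (f (\<eta> * of_int \<lfloor>l t / \<eta>\<rfloor>)) (f t) < e)"
    using step.IH by blast
  have b0: "0 \<le> b" using step.hyps(1) by (rule step_partition_nonneg)
  show ?case
  proof (intro exI[of _ "min \<eta>0 (c - b)"] conjI allI impI)
    fix \<eta> assume "0 < \<eta> \<and> \<eta> < min \<eta>0 (c - b)"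
    then have \<eta>: "0 < \<eta>" "\<eta> < \<eta>0" "\<eta> < c - b" by auto
    obtain l where l: "strict_mono_on {0..b} l" "l ` {0..b} = {0..\<eta> * of_int \<lceil>b / \<eta>\<rceil>}"
        "\<And>t. t \<in> {0..b} \<Longrightarrow> \<bar>l t - t\<bar> \<le> \<eta>"
        "\<And>t. t \<in> {0..<b} \<Longrightarrow> dist (f (\<eta> * of_int \<lfloor>l t / \<eta>\<rfloor>)) (f t) < e"
      using \<eta>0(2)[OF conjI[OF \<eta>(1,2)]] by (elim exE conjE) (rule that; (assumption | erule (1) bspec))
    define B where "B = \<eta> * of_int \<lceil>b / \<eta>\<rceil>"
    define E where "E = \<eta> * of_int \<lceil>c / \<eta>\<rceil>"
    \<comment> \<open>On the new piece the time change is the affine map from \<open>{b..c}\<close>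
      onto \<open>{B..E}\<close>, the interval between the rounded end points.\<close>
    define l' where "l' t = (if t \<le> b then l t else B + (t - b) / (c - b) * (E - B))" for t
    have grid: "x \<le> \<eta> * of_int \<lceil>x / \<eta>\<rceil>" "\<eta> * of_int \<lceil>x / \<eta>\<rceil> \<le> x + \<eta>" for x
    proof -
      have "\<eta> * (x / \<eta>) \<le> \<eta> * of_int \<lceil>x / \<eta>\<rceil>"
        using \<eta>(1) by (intro mult_left_mono) auto
      then show "x \<le> \<eta> * of_int \<lceil>x / \<eta>\<rceil>" using \<eta>(1) by simp
      have "\<eta> * of_int \<lceil>x / \<eta>\<rceil> \<le> \<eta> * (x / \<eta> + 1)"
        using \<eta>(1) by (intro mult_left_mono) (auto intro: less_imp_le of_int_ceiling_le_add_one)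
      then show "\<eta> * of_int \<lceil>x / \<eta>\<rceil> \<le> x + \<eta>" using \<eta>(1) by (simp add: distrib_left)
    qed
    have bB: "b \<le> B" "B \<le> b + \<eta>" and cE: "c \<le> E" "E \<le> c + \<eta>"
      unfolding B_def E_def by (rule grid)+
    \<comment> \<open>The mesh is below \<open>c - b\<close> so that \<open>b\<close> and
      \<open>c\<close> are not rounded to the same grid point; otherwise \<open>l'\<close> would be
      constant on the piece.\<close>
    have "b / \<eta> + 1 \<le> c / \<eta>"
      using \<eta> divide_right_mono[of "b + \<eta>" c \<eta>] by (simp add: add_divide_distrib)
    then have "\<lceil>b / \<eta>\<rceil> + 1 \<le> \<lceil>c / \<eta>\<rceil>" using ceiling_mono[of "b / \<eta> + 1" "c / \<eta>"] by simp
    then have BE: "B < E" unfolding B_def E_def using \<eta>(1) by simp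
    have lb: "l b = B"
    proof -
      have "l b \<in> l ` {0..b}" using b0 by (intro imageI) simp
      then have "l b \<in> {0..B}" unfolding l(2) B_def .
      moreover have "B \<in> l ` {0..b}" unfolding l(2) using bB b0 by (simp add: B_def[symmetric])
      then obtain u where "u \<in> {0..b}" "l u = B" by auto
      moreover have "l u \<le> l b"
        by (rule strict_mono_on_leD[OF l(1)]) (use \<open>u \<in> {0..b}\<close> b0 in auto)
      ultimately show ?thesis by simp
    qed
    have l'c: "l' t = B + (t - b) / (c - b) * (E - B)" if "b \<le> t" for t
      using that lb by (cases "t = b") (auto simp: l'_def)
    have incr: "l' s < l' t" if "b \<le> s" "s < t" for s t
    proof -
      have "(s - b) / (c - b) * (E - B) < (t - b) / (c - b) * (E - B)"
        using that step.hyps(2) BE by (intro mult_strict_right_mono divide_strict_right_mono) auto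
      then show ?thesis using that by (simp add: l'c)
    qed
    have l'_b: "l' b = B" by (simp add: l'_def lb)
    have l'_c: "l' c = E" using step.hyps(2) by (simp add: l'c)
    show "\<exists>l. strict_mono_on {0..c} l \<and> l ` {0..c} = {0..\<eta> * of_int \<lceil>c / \<eta>\<rceil>} \<and>
      (\<forall>t\<in>{0..c}. \<bar>l t - t\<bar> \<le> \<eta>) \<and> (\<forall>t\<in>{0..<c}. dist (f (\<eta> * of_int \<lfloor>l t / \<eta>\<rfloor>)) (f t) < e)"
    proof (intro exI[of _ l'] conjI ballI)
      show "strict_mono_on {0..c} l'"
      proof (rule strict_mono_onI)
        fix r s assume rs: "r \<in> {0..c}" "s \<in> {0..c}" "r < s"
        have *: "l r \<le> l b" if "r \<le> b"
          by (rule strict_mono_on_leD[OF l(1)]) (use rs b0 that in auto)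
        consider "s \<le> b" | "b \<le> r" | "r < b" "b < s" by linarith
        then show "l' r < l' s"
        proof cases
          case 1
          then show ?thesis using rs strict_mono_onD[OF l(1), of r s] by (simp add: l'_def)
        next
          case 3
          then have "l' r \<le> l' b" using * by (simp add: l'_def)
          then show ?thesis using incr[of b s] 3 by simp
        qed (use incr rs in auto)
      qed
      have "l' ` {0..b} = {0..B}" using l(2) by (simp add: l'_def B_def)
      moreover have "l' ` {b..c} = {B..E}"
      proof (intro equalityI subsetI)
        fix y assume "y \<in> l' ` {b..c}"
        then obtain t where t: "b \<le> t" "t \<le> c" "y = l' t" by auto
        moreover have "l' b \<le> l' t" using incr[of b t] t by (cases "t = b") auto
        moreover have "l' t \<le> l' c" using incr[of t c] t by (cases "t = c") auto
        ultimately show "y \<in> {B..E}" using l'_c l'_b by simp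
      next
        fix y assume y: "y \<in> {B..E}"
        define \<theta> where "\<theta> = (y - B) / (E - B)"
        define t where "t = b + \<theta> * (c - b)"
        have \<theta>: "0 \<le> \<theta>" "\<theta> \<le> 1" using y BE by (auto simp: \<theta>_def)
        have cb: "0 \<le> c - b" using step.hyps(2) by simp
        have "b \<le> t" "t \<le> c"
          unfolding t_def using mult_nonneg_nonneg[OF \<theta>(1) cb] mult_right_mono[OF \<theta>(2) cb] by simp_all
        moreover have "(t - b) / (c - b) = \<theta>" using step.hyps(2) by (simp add: t_def)
        then have "l' t = y" using \<open>b \<le> t\<close> BE by (simp add: l'c \<theta>_def)
        ultimately show "y \<in> l' ` {b..c}" by (metis atLeastAtMost_iff image_eqI)
      qed
      moreover have "{0..c} = {0..b} \<union> {b..c}" "{0..E} = {0..B} \<union> {B..E}"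
        using b0 bB cE BE step.hyps(2) by auto
      ultimately show "l' ` {0..c} = {0..\<eta> * of_int \<lceil>c / \<eta>\<rceil>}"
        unfolding E_def[symmetric] by (simp add: image_Un)
    next
      fix t assume t: "t \<in> {0..c}"
      show "\<bar>l' t - t\<bar> \<le> \<eta>"
      proof (cases "t \<le> b")
        case False
        define \<theta> where "\<theta> = (t - b) / (c - b)"
        have \<theta>: "0 \<le> \<theta>" "\<theta> \<le> 1" using False t step.hyps(2) by (auto simp: \<theta>_def field_simps)
        have "t = b + \<theta> * (c - b)" using step.hyps(2) by (simp add: \<theta>_def)
        \<comment> \<open>The displacement of \<open>t\<close> is a convex combination of those of
          \<open>b\<close> and \<open>c\<close>, both between \<open>0\<close> and
          \<open>\<eta>\<close>.\<close>
        then have "l' t - t = (1 - \<theta>) * (B - b) + \<theta> * (E - c)"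
          using False by (simp add: l'c \<theta>_def[symmetric] algebra_simps)
        moreover have "(1 - \<theta>) * (B - b) + \<theta> * (E - c) \<le> (1 - \<theta>) * \<eta> + \<theta> * \<eta>"
          using \<theta> bB cE by (intro add_mono mult_left_mono) auto
        moreover have "0 \<le> (1 - \<theta>) * (B - b) + \<theta> * (E - c)" using \<theta> bB cE by simp
        ultimately show ?thesis by (simp add: algebra_simps)
      qed (use l(3) t in \<open>simp add: l'_def\<close>)
    next
      fix t assume t: "t \<in> {0..<c}"
      show "dist (f (\<eta> * of_int \<lfloor>l' t / \<eta>\<rfloor>)) (f t) < e"
      proof (cases "t < b")
        case False
        then have "l' b \<le> l' t" using incr[of b t] t by (cases "t = b") auto
        moreover have "l' t < l' c" using incr[of t c] False t by simp
        ultimately have "B \<le> l' t" "l' t < E" unfolding l'_b l'_c .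
        \<comment> \<open>Rounding \<open>l' t\<close> down to the grid gives a point between
          \<open>B\<close> and the last grid point before \<open>E\<close>, which lies in the piece
          from \<open>b\<close> to \<open>c\<close> that contains \<open>t\<close>.\<close>
        then have "of_int \<lceil>b / \<eta>\<rceil> \<le> l' t / \<eta>" "l' t / \<eta> < of_int \<lceil>c / \<eta>\<rceil>"
          using \<eta>(1) unfolding B_def E_def
          by (simp_all add: pos_le_divide_eq pos_divide_less_eq mult.commute)
        then have "\<lceil>b / \<eta>\<rceil> \<le> \<lfloor>l' t / \<eta>\<rfloor>" "\<lfloor>l' t / \<eta>\<rfloor> < \<lceil>c / \<eta>\<rceil>"
          by (simp_all add: le_floor_iff floor_less_iff)
        then have "b / \<eta> \<le> of_int \<lfloor>l' t / \<eta>\<rfloor>" "of_int \<lfloor>l' t / \<eta>\<rfloor> < c / \<eta>"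
          by (simp_all add: ceiling_le_iff less_ceiling_iff)
        then have "b \<le> \<eta> * of_int \<lfloor>l' t / \<eta>\<rfloor>" "\<eta> * of_int \<lfloor>l' t / \<eta>\<rfloor> < c"
          using \<eta>(1) by (simp_all add: pos_le_divide_eq pos_divide_le_eq pos_less_divide_eq mult.commute)
        then show ?thesis using False t by (intro step.hyps(3)) auto
      qed (use l(4) t in \<open>simp add: l'_def\<close>)
    qed
  qed (use \<eta>0(1) step.hyps(2) in auto)
qed

section \<open>Restriction to a finite horizon\<close>

lemma restrict_skorokhod_space:
  assumes "f \<in> skorokhod_space {0..}"
  shows "restrict f {0..T} \<in> skorokhod_space {0..T}"
proof -
  have "((restrict f {0..T} \<longlongrightarrow> restrict f {0..T} t) (at t within {0..T} \<inter> {t<..})) \<and>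
     (\<exists>l. (restrict f {0..T} \<longlongrightarrow> l) (at t within {0..T} \<inter> {..<t}))" if t: "t \<in> {0..T}" for t
  proof
    have c: "(f \<longlongrightarrow> f t) (at t within {0..} \<inter> {t<..})" "\<exists>l. (f \<longlongrightarrow> l) (at t within {0..} \<inter> {..<t})"
      using assms t unfolding skorokhod_space_def cadlag_on_def by auto
    have ev: "\<forall>\<^sub>F x in at t within {0..T} \<inter> A. restrict f {0..T} x = f x" for A
      unfolding eventually_at by (intro exI[of _ 1]) auto
    have "(f \<longlongrightarrow> f t) (at t within {0..T} \<inter> {t<..})"
      by (rule tendsto_within_subset[OF c(1)]) auto
    then show "(restrict f {0..T} \<longlongrightarrow> restrict f {0..T} t) (at t within {0..T} \<inter> {t<..})"
      by (subst tendsto_cong[OF ev]) (use t in auto)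
    obtain l where "(f \<longlongrightarrow> l) (at t within {0..} \<inter> {..<t})" using c by blast
    then have "(f \<longlongrightarrow> l) (at t within {0..T} \<inter> {..<t})"
      by (rule tendsto_within_subset) auto
    then show "\<exists>l. (restrict f {0..T} \<longlongrightarrow> l) (at t within {0..T} \<inter> {..<t})"
      using tendsto_cong[OF ev] by blast
  qed
  then show ?thesis by (simp add: skorokhod_space_def cadlag_on_def)
qed

text \<open>The mesh \<open>T / real (Suc n)\<close> divides \<open>T\<close>, so rounding up fixes
  \<open>T\<close> and the time change obtained from the partition maps \<open>{0..T}\<close> onto
  itself, as a time change of this interval must.\<close>

lemma limitin_skorokhod_samples:
  assumes f: "f \<in> skorokhod_space {0..}" and T: "0 < T"
  shows "limitin (skorokhod {0..T})
    (\<lambda>n. step_path {0..T} (real (Suc n) / T) (\<lambda>k. f (real k * (T / real (Suc n)))))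
    (restrict f {0..T}) sequentially"
  unfolding limitin_skorokhod
proof (intro conjI restrict_skorokhod_space f allI impI)
  fix S e :: real assume e: "0 < e"
  obtain \<eta>0 where \<eta>0: "0 < \<eta>0" "\<And>\<eta>. 0 < \<eta> \<and> \<eta> < \<eta>0 \<Longrightarrow> \<exists>l. strict_mono_on {0..T} l \<and>
    l ` {0..T} = {0..\<eta> * of_int \<lceil>T / \<eta>\<rceil>} \<and> (\<forall>t\<in>{0..T}. \<bar>l t - t\<bar> \<le> \<eta>) \<and>
    (\<forall>t\<in>{0..<T}. dist (f (\<eta> * of_int \<lfloor>l t / \<eta>\<rfloor>)) (f t) < e)"
    using step_partition_time_change[OF cadlag_step_partition[OF f e, of T]] T by auto
  have "(\<lambda>n. T * inverse (real (Suc n))) \<longlonglongrightarrow> T * 0"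
    by (intro tendsto_intros LIMSEQ_inverse_real_of_nat)
  then have "\<forall>\<^sub>F n in sequentially. T * inverse (real (Suc n)) < min \<eta>0 e"
    using \<eta>0(1) e by (intro order_tendstoD) auto
  then show "\<forall>\<^sub>F n in sequentially. step_path {0..T} (real (Suc n) / T) (\<lambda>k. f (real k * (T / real (Suc n))))
      \<in> skorokhod_nhd {0..T} (restrict f {0..T}) S e"
  proof (rule eventually_mono)
    fix n assume n: "T * inverse (real (Suc n)) < min \<eta>0 e"
    define \<eta> where "\<eta> = T / real (Suc n)"
    have \<eta>: "0 < \<eta>" "\<eta> < \<eta>0" "\<eta> < e" using n T by (auto simp: \<eta>_def field_simps)
    have grid: "T / \<eta> = of_int (int (Suc n))" "real (Suc n) / T = 1 / \<eta>" using T by (auto simp: \<eta>_def)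
    then have ceil: "\<eta> * of_int \<lceil>T / \<eta>\<rceil> = T" unfolding grid using T by (simp add: \<eta>_def)
    obtain l where l: "strict_mono_on {0..T} l" "l ` {0..T} = {0..T}"
        "\<And>t. t \<in> {0..T} \<Longrightarrow> \<bar>l t - t\<bar> \<le> \<eta>"
        "\<And>t. t \<in> {0..<T} \<Longrightarrow> dist (f (\<eta> * of_int \<lfloor>l t / \<eta>\<rfloor>)) (f t) < e"
      using \<eta>0(2)[OF conjI[OF \<eta>(1,2)], unfolded ceil] by (elim exE conjE) (rule that; (assumption | erule (1) bspec))
    have tc: "time_change {0..T} l" using l(1,2) by (simp add: time_change_def)
    have lT: "l T = T"
    proof -
      obtain u where u: "u \<in> {0..T}" "l u = T" using l(2) T
        by (metis atLeastAtMost_iff imageE less_eq_real_def order_refl)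
      have "l u \<le> l T"
        by (rule strict_mono_on_leD[OF l(1)]) (use T u in auto)
      moreover have "l T \<in> {0..T}" using time_change_mem[OF tc, of T] T by simp
      ultimately show ?thesis using u by simp
    qed
    have samp: "step_path {0..T} (1 / \<eta>) (\<lambda>k. f (real k * \<eta>)) (l t) = f (\<eta> * of_int \<lfloor>l t / \<eta>\<rfloor>)"
      if "t \<in> {0..T}" for t
    proof -
      have "0 \<le> \<lfloor>l t / \<eta>\<rfloor>" using time_change_mem[OF tc that] \<eta>(1) by simp
      then show ?thesis using time_change_mem[OF tc that] by (simp add: step_path_def mult.commute)
    qed
    have "dist (step_path {0..T} (1 / \<eta>) (\<lambda>k. f (real k * \<eta>)) (l t)) (restrict f {0..T} t) < e"
      if t: "t \<in> {0..T}" for t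
    proof (cases "t = T")
      case True
      \<comment> \<open>The half-open pieces leave out the end point \<open>T\<close>. There the
        sample is exact, because \<open>T\<close> is a grid point and
        \<open>l T = T\<close>.\<close>
      have "\<eta> * of_int \<lfloor>T / \<eta>\<rfloor> = T" unfolding grid using T by (simp add: \<eta>_def)
      then show ?thesis unfolding samp[OF t] using True lT e t by simp
    qed (use samp l(4) t in auto)
    moreover have "\<bar>l t - t\<bar> < e" if "t \<in> {0..T}" for t using l(3)[OF that] \<eta> by simp
    ultimately show "step_path {0..T} (real (Suc n) / T) (\<lambda>k. f (real k * (T / real (Suc n))))
      \<in> skorokhod_nhd {0..T} (restrict f {0..T}) S e"
      unfolding grid \<eta>_def[symmetric] skorokhod_nhd_def using tc \<eta>
      by (intro CollectI conjI step_path_in_skorokhod_space exI[of _ l]) auto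
  qed
qed

text \<open>The inverse of the time change serves in the other direction. The horizon
  \<open>T\<close> makes the estimate hold at all times of the interval, so it can be read off at
  the preimages.\<close>

lemma skorokhod_nhd_sym:
  assumes "g \<in> skorokhod_nhd {0..T} f T e" "f \<in> skorokhod_space {0..T}"
  shows "f \<in> skorokhod_nhd {0..T} g T e"
proof -
  obtain l where l: "time_change {0..T} l" "\<And>t. t \<in> {0..T} \<Longrightarrow> \<bar>l t - t\<bar> < e"
      "\<And>t. t \<in> {0..T} \<Longrightarrow> dist (g (l t)) (f t) < e"
    using assms unfolding skorokhod_nhd_def by auto
  define k where "k = inv_into {0..T} l"
  have img: "l ` {0..T} = {0..T}" and sm: "strict_mono_on {0..T} l" using l(1) by (auto simp: time_change_def)
  have inj: "inj_on l {0..T}" by (rule strict_mono_on_imp_inj_on[OF sm])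
  have lk: "l (k t) = t" "k t \<in> {0..T}" if "t \<in> {0..T}" for t
    using that img f_inv_into_f[of t l "{0..T}"] inv_into_into[of t l "{0..T}"] by (auto simp: k_def)
  have "time_change {0..T} k"
    unfolding time_change_def
  proof
    show "strict_mono_on {0..T} k"
    proof (rule strict_mono_onI)
      fix r s assume rs: "r \<in> {0..T}" "s \<in> {0..T}" "r < s"
      show "k r < k s"
      proof (rule ccontr)
        assume "\<not> k r < k s"
        then have "l (k s) \<le> l (k r)" using lk rs sm by (intro strict_mono_on_leD[OF sm]) auto
        then show False using lk rs by simp
      qed
    qed
    show "k ` {0..T} = {0..T}"
      unfolding k_def using inv_into_image_cancel[OF inj order_refl] img by simp
  qed
  moreover have "\<bar>k t - t\<bar> < e" "dist (f (k t)) (g t) < e" if "t \<in> {0..T}" for t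
    using l(2,3)[OF lk(2)[OF that]] lk(1)[OF that] by (auto simp: dist_commute)
  ultimately show ?thesis unfolding skorokhod_nhd_def using assms(2) by auto
qed

text \<open>The witness is the interior: all paths with some neighbourhood inside
  \<open>skorokhod_nhd I f S e\<close>. Its openness rests on the triangle inequality
  \<open>skorokhod_nhd_trans\<close>, which halves the radius.\<close>

lemma openin_subset_skorokhod_nhd:
  assumes f: "f \<in> skorokhod_space I" and e: "0 < e"
  shows "\<exists>W. openin (skorokhod I) W \<and> f \<in> W \<and> W \<subseteq> skorokhod_nhd I f S e"
proof (intro exI conjI)
  let ?W = "{h \<in> skorokhod_space I. \<exists>S' e'. 0 < e' \<and> skorokhod_nhd I h S' e' \<subseteq> skorokhod_nhd I f S e}"
  show "openin (skorokhod I) ?W"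
    unfolding openin_skorokhod
  proof (intro conjI ballI)
    fix h assume "h \<in> ?W"
    then obtain S' e' where *: "0 < e'" "skorokhod_nhd I h S' e' \<subseteq> skorokhod_nhd I f S e" by blast
    have "skorokhod_nhd I h S' (e' / 2) \<subseteq> ?W"
    proof
      fix k assume k: "k \<in> skorokhod_nhd I h S' (e' / 2)"
      then have "skorokhod_nhd I k (S' + e') (e' / 2) \<subseteq> skorokhod_nhd I f S e"
        using subset_trans[OF subsetI *(2)] skorokhod_nhd_trans[OF k] by simp
      moreover have "k \<in> skorokhod_space I" using k by (simp add: skorokhod_nhd_def)
      ultimately show "k \<in> ?W" using half_gt_zero[OF *(1)] by blast
    qed
    then show "\<exists>S e. 0 < e \<and> skorokhod_nhd I h S e \<subseteq> ?W" using half_gt_zero[OF *(1)] by blast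
  qed auto
  show "f \<in> ?W" using f e by blast
  have "h \<in> skorokhod_nhd I h S' e'" if "h \<in> skorokhod_space I" "0 < e'" for h :: "real \<Rightarrow> 'a" and S' e'
    by (rule skorokhod_nhd_uniformI) (use that in auto)
  then show "?W \<subseteq> skorokhod_nhd I f S e" by blast
qed

text \<open>The samplings \<open>G n\<close> are built from evaluations, hence measurable, and
  converge pointwise to the restriction. As for limits in a metric space, an open set is written as
  an increasing union of open sets with a margin, and membership of the limit becomes eventual
  membership of the approximations in one of them.\<close>

lemma measurable_skorokhod_restrict:
  assumes T: "0 < T"
  shows "(\<lambda>f. restrict f {0..T}) \<in>
    borel_of_topology (skorokhod {0..} :: (real \<Rightarrow> 'a::euclidean_space) topology)
    \<rightarrow>\<^sub>M borel_of_topology (skorokhod {0..T})" (is "_ \<in> ?D \<rightarrow>\<^sub>M ?DT")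
proof (rule measurable_borel_of_topologyI)
  show "(\<lambda>f. restrict f {0..T}) \<in> space ?D \<rightarrow> topspace (skorokhod {0..T})"
    by (auto simp: topspace_skorokhod restrict_skorokhod_space)
  fix U :: "(real \<Rightarrow> 'a) set" assume U: "openin (skorokhod {0..T}) U"
  define G where "G n f = step_path {0..T} (real (Suc n) / T) (\<lambda>k. f (real k * (T / real (Suc n))))"
    for n and f :: "real \<Rightarrow> 'a"
  have G: "G n \<in> ?D \<rightarrow>\<^sub>M ?DT" for n
    unfolding G_def using T
    by (intro measurable_compose[OF _ measurable_step_path] measurable_coordinatewise_then_product
        measurable_skorokhod_eval) auto
  \<comment> \<open>This stands in for the points whose distance to the complement of
    \<open>U\<close> exceeds \<open>inverse (real (Suc m))\<close>; it is a union of open sets and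
    hence open.\<close>
  define V where "V m = \<Union>{V. openin (skorokhod {0..T}) V \<and>
    (\<forall>g\<in>V. skorokhod_nhd {0..T} g T (inverse (real (Suc m))) \<subseteq> U)}" for m
  have Vopen: "openin (skorokhod {0..T}) (V m)" for m unfolding V_def by (intro openin_Union) auto
  have V: "skorokhod_nhd {0..T} g T (inverse (real (Suc m))) \<subseteq> U" if "g \<in> V m" for g m
    using that unfolding V_def by blast
  have "restrict f {0..T} \<in> U \<longleftrightarrow> (\<exists>m N. \<forall>n\<ge>N. G n f \<in> V m)" if f: "f \<in> skorokhod_space {0..}" for f
  proof
    have lim: "limitin (skorokhod {0..T}) (\<lambda>n. G n f) (restrict f {0..T}) sequentially"
      unfolding G_def by (rule limitin_skorokhod_samples[OF f T])
    {
      assume "restrict f {0..T} \<in> U"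
      then obtain S e where e: "0 < e" "skorokhod_nhd {0..T} (restrict f {0..T}) S e \<subseteq> U"
        using U unfolding openin_skorokhod by blast
      obtain m where m: "inverse (real (Suc m)) < e / 4" using reals_Archimedean[of "e / 4"] e by auto
      obtain W where W: "openin (skorokhod {0..T}) W" "restrict f {0..T} \<in> W"
          "W \<subseteq> skorokhod_nhd {0..T} (restrict f {0..T}) (max S T) (e / 2)"
        using openin_subset_skorokhod_nhd[OF restrict_skorokhod_space[OF f] half_gt_zero[OF e(1)]] by blast
      have "skorokhod_nhd {0..T} g T (inverse (real (Suc m))) \<subseteq> U" if "g \<in> W" for g
      proof
        fix k assume k: "k \<in> skorokhod_nhd {0..T} g T (inverse (real (Suc m)))"
        \<comment> \<open>On \<open>{0..T}\<close> all horizons from \<open>T\<close> on impose the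
          same condition, so the horizon can be raised to the one that
          \<open>skorokhod_nhd_trans\<close> asks for.\<close>
        have "k \<in> skorokhod_nhd {0..T} g (max S T + e) (e / 2)"
          using k m e(1) unfolding skorokhod_nhd_def by fastforce
        moreover have "g \<in> skorokhod_nhd {0..T} (restrict f {0..T}) (max S T) (e / 2)" using that W(3) by blast
        ultimately have "k \<in> skorokhod_nhd {0..T} (restrict f {0..T}) (max S T) e"
          using skorokhod_nhd_trans by blast
        then show "k \<in> U" using e(2) skorokhod_nhd_mono[of S "max S T" e e] by fastforce
      qed
      then have "restrict f {0..T} \<in> V m" unfolding V_def using W(1,2) by blast
      then have "\<forall>\<^sub>F n in sequentially. G n f \<in> V m"
        using lim Vopen unfolding limitin_def by blast
      then show "\<exists>m N. \<forall>n\<ge>N. G n f \<in> V m" unfolding eventually_sequentially by blast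
    }
    assume "\<exists>m N. \<forall>n\<ge>N. G n f \<in> V m"
    then obtain m N where N: "\<And>n. n \<ge> N \<Longrightarrow> G n f \<in> V m" by blast
    have "\<forall>\<^sub>F n in sequentially. G n f \<in> skorokhod_nhd {0..T} (restrict f {0..T}) T (inverse (real (Suc m)))"
      using lim unfolding limitin_skorokhod by simp
    then obtain n where n: "n \<ge> N" "G n f \<in> skorokhod_nhd {0..T} (restrict f {0..T}) T (inverse (real (Suc m)))"
      unfolding eventually_sequentially by (metis nle_le)
    \<comment> \<open>Membership in \<open>V m\<close> speaks of neighbourhoods of
      \<open>G n f\<close>, whereas convergence gives one of the limit; symmetry exchanges the
      two.\<close>
    have "restrict f {0..T} \<in> skorokhod_nhd {0..T} (G n f) T (inverse (real (Suc m)))"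
      by (rule skorokhod_nhd_sym[OF n(2) restrict_skorokhod_space[OF f]])
    then show "restrict f {0..T} \<in> U" using V[OF N[OF n(1)]] by blast
  qed
  then have "(\<lambda>f. restrict f {0..T}) -` U \<inter> space ?D = (\<Union>m. \<Union>N. \<Inter>n\<in>{N..}. G n -` V m \<inter> space ?D)"
    by (fastforce simp: topspace_skorokhod)
  also have "\<dots> \<in> sets ?D"
    by (intro sets.countable_UN sets.countable_INT image_subsetI measurable_sets[OF G]
        openin_sets_borel_of_topology Vopen) auto
  finally show "(\<lambda>f. restrict f {0..T}) -` U \<inter> space ?D \<in> sets ?D" .
qed

lemma dirac_onI:
  fixes Q :: "(real \<Rightarrow> 'a::euclidean_space) measure"
  assumes Q: "prob_space Q" "sets Q = sets (borel_of_topology (skorokhod {0..}))"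
    and T: "0 < T" and eq: "AE f in Q. \<forall>t\<in>{0..T}. f t = \<mu> t"
  shows "dirac_on T Q \<mu>"
proof -
  let ?DT = "borel_of_topology (skorokhod {0..T} :: (real \<Rightarrow> 'a) topology)"
  interpret prob_space Q by (rule Q)
  have meas: "(\<lambda>f. restrict f {0..T}) \<in> Q \<rightarrow>\<^sub>M ?DT"
    using measurable_skorokhod_restrict[OF T] measurable_cong_sets[OF Q(2) refl] by blast
  have ae: "AE f in Q. restrict f {0..T} = restrict \<mu> {0..T}"
    using eq by eventually_elim (auto simp: restrict_def)
  \<comment> \<open>That \<open>\<mu>\<close> is cadlag on the interval follows from
    \<open>eq\<close>: almost every path restricts to \<open>restrict \<mu> {0..T}\<close>, and a
    probability measure has at least one such path.\<close>
  have mem: "restrict \<mu> {0..T} \<in> space ?DT"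
  proof (rule ccontr)
    assume nmem: "restrict \<mu> {0..T} \<notin> space ?DT"
    have "AE f in Q. False"
      using ae AE_space[of Q]
    proof eventually_elim
      case (elim f)
      then show ?case using measurable_space[OF meas elim(2)] nmem by simp
    qed
    then show False by simp
  qed
  have "distr Q ?DT (\<lambda>f. restrict f {0..T}) = distr Q ?DT (\<lambda>_. restrict \<mu> {0..T})"
    using ae meas mem by (intro distr_cong_AE) auto
  also have "\<dots> = return ?DT (restrict \<mu> {0..T})" by (rule distr_const[OF mem])
  finally show ?thesis unfolding dirac_on_def .
qed

section \<open>Euler schemes\<close>

text \<open>For \<open>t \<ge> 0\<close> this is the length of the overlap of \<open>{0..t}\<close>
  with the cell from \<open>j / R\<close> to \<open>(j + 1) / R\<close>.\<close>

definition ramp :: "real \<Rightarrow> nat \<Rightarrow> real \<Rightarrow> real" where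
  "ramp R j t = max 0 (min (t - real j / R) (1 / R))"

text \<open>The integral from \<open>0\<close> to \<open>t\<close> of the step function with value
  \<open>w j\<close> on cell \<open>j\<close>, as a finite sum: an Euler polygon without its
  starting point.\<close>

definition interpolate :: "real \<Rightarrow> nat \<Rightarrow> (nat \<Rightarrow> 'a::real_normed_vector) \<Rightarrow> real \<Rightarrow> 'a" where
  "interpolate R J w t = (\<Sum>j<J. ramp R j t *\<^sub>R w j)"

lemma ramp_mono: "s \<le> t \<Longrightarrow> ramp R j s \<le> ramp R j t"
  by (auto simp: ramp_def)

lemma sum_ramp:
  assumes "0 < R" "0 \<le> t"
  shows "(\<Sum>j<J. ramp R j t) = min t (real J / R)"
proof (induction J)
  case (Suc J)
  define q where "q = 1 / R"
  have "real (Suc J) / R = real J / R + q" "0 < q"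
    using assms by (simp_all add: add_divide_distrib q_def)
  then show ?case
    unfolding sum.lessThan_Suc Suc by (simp add: ramp_def q_def[symmetric] min_def max_def del: of_nat_Suc)
qed (use assms in auto)

lemma ramp_eq:
  assumes "0 < R"
  shows "t \<le> real j / R \<Longrightarrow> ramp R j t = 0" "real (Suc j) / R \<le> t \<Longrightarrow> ramp R j t = 1 / R"
  using assms by (auto simp: ramp_def add_divide_distrib)

lemma interpolate_0: "0 < R \<Longrightarrow> interpolate R J w 0 = 0"
  by (simp add: interpolate_def ramp_eq)

lemma interpolate_grid:
  assumes "0 < R" "k \<le> J"
  shows "interpolate R J w (real k / R) = (1 / R) *\<^sub>R (\<Sum>j<k. w j)"
proof -
  have "ramp R j (real k / R) *\<^sub>R w j = (if j < k then (1 / R) *\<^sub>R w j else 0)" for j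
  proof (cases "j < k")
    case True
    then have "real (Suc j) / R \<le> real k / R" using assms(1) by (intro divide_right_mono) auto
    then show ?thesis using True assms(1) by (simp add: ramp_eq(2))
  next
    case False
    then have "real k / R \<le> real j / R" using assms(1) by (intro divide_right_mono) auto
    then show ?thesis using False assms(1) by (simp add: ramp_eq(1))
  qed
  then have "interpolate R J w (real k / R) = (\<Sum>j<J. if j < k then (1 / R) *\<^sub>R w j else 0)"
    by (simp add: interpolate_def)
  also have "\<dots> = (\<Sum>j\<in>{..<J} \<inter> {j. j < k}. (1 / R) *\<^sub>R w j)"
    by (simp add: sum.inter_restrict)
  also have "{..<J} \<inter> {j. j < k} = {..<k}" using assms by auto
  finally show ?thesis by (simp add: scaleR_sum_right)
qed

text \<open>The increments of the ramps are nonnegative weights with sum \<open>t - s\<close>, and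
  only cells that meet the interval from \<open>s\<close> to \<open>t\<close> carry weight. With
  \<open>v = 0\<close> this gives Lipschitz continuity, with \<open>v = h (g s)\<close> the
  derivative of the limit polygon.\<close>

lemma interpolate_diff:
  assumes R: "0 < R" and st: "0 \<le> s" "s \<le> t" "t \<le> real J / R"
    and w: "\<And>j. j < J \<Longrightarrow> real j / R < t \<Longrightarrow> s < real (Suc j) / R \<Longrightarrow> norm (w j - v) \<le> W"
  shows "norm (interpolate R J w t - interpolate R J w s - (t - s) *\<^sub>R v) \<le> W * (t - s)"
proof -
  have ts: "(\<Sum>j<J. ramp R j t - ramp R j s) = t - s"
    using sum_ramp[OF R, of t J] sum_ramp[OF R, of s J] st by (simp add: sum_subtractf)
  have "interpolate R J w t - interpolate R J w s - (t - s) *\<^sub>R v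
      = (\<Sum>j<J. (ramp R j t - ramp R j s) *\<^sub>R (w j - v))"
    unfolding ts[symmetric] interpolate_def
    by (simp add: sum_subtractf scaleR_diff_left scaleR_diff_right scaleR_sum_left)
  also have "norm \<dots> \<le> (\<Sum>j<J. (ramp R j t - ramp R j s) * W)"
  proof (rule sum_norm_le)
    fix j assume "j \<in> {..<J}"
    then have j: "j < J" by simp
    show "norm ((ramp R j t - ramp R j s) *\<^sub>R (w j - v)) \<le> (ramp R j t - ramp R j s) * W"
    proof (cases "real j / R < t \<and> s < real (Suc j) / R")
      case True
      then show ?thesis using w[OF j] ramp_mono[OF st(2), of R j] by (simp add: mult_left_mono)
    next
      case False
      then have "ramp R j t = ramp R j s"
        using ramp_eq(1)[OF R, of t j] ramp_eq(1)[OF R, of s j]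
          ramp_eq(2)[OF R, of j t] ramp_eq(2)[OF R, of j s] st by linarith
      then show ?thesis by simp
    qed
  qed
  also have "\<dots> = W * (t - s)" by (simp add: sum_distrib_right[symmetric] ts)
  finally show ?thesis .
qed

lemma interpolate_lipschitz:
  assumes R: "0 < R" and st: "s \<in> {0..real J / R}" "t \<in> {0..real J / R}"
    and w: "\<And>j. j < J \<Longrightarrow> norm (w j) \<le> A"
  shows "norm (interpolate R J w t - interpolate R J w s) \<le> A * \<bar>t - s\<bar>"
proof (cases "s \<le> t")
  case True
  then show ?thesis using interpolate_diff[OF R, of s t J w 0 A] st w by simp
next
  case False
  then show ?thesis using interpolate_diff[OF R, of t s J w 0 A] st w by (simp add: norm_minus_commute)
qed

section \<open>Convergence of perturbed Euler schemes\<close>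

text \<open>Peano's compactness argument: otherwise Euler polygons staying \<open>\<epsilon>\<close>-far from \<open>\<mu>\<close> would,
  by Arzela-Ascoli, have a limit point, which solves the equation.\<close>

lemma euler_scheme_close_to_ode:
  fixes h :: "'a::euclidean_space \<Rightarrow> 'a"
  assumes \<rho>: "0 < \<rho>" "cball x \<rho> \<subseteq> C" and cont: "continuous_on (cball x \<rho>) h"
    and A: "0 \<le> A" "\<And>y. y \<in> cball x \<rho> \<Longrightarrow> norm (h y) \<le> A"
    and T: "0 < T" "A * T < \<rho>"
    and uniq: "\<And>\<nu>. ode_solution C h x {0..T} \<nu> \<Longrightarrow> \<forall>t\<in>{0..T}. \<nu> t = \<mu> t"
    and \<epsilon>: "0 < \<epsilon>"
  shows "\<exists>\<delta>>0. \<exists>R0>0. \<forall>R\<ge>R0. \<forall>z.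
    (\<forall>k. real k \<le> T * R \<longrightarrow> (\<forall>j<k. z j \<in> cball x \<rho>) \<longrightarrow>
      norm (z k - x - (1 / R) *\<^sub>R (\<Sum>j<k. h (z j))) \<le> \<delta>) \<longrightarrow>
    (\<forall>t\<in>{0..T}. norm (z (nat \<lfloor>t * R\<rfloor>) - \<mu> t) \<le> \<epsilon>)" (is "\<exists>\<delta>>0. \<exists>R0>0. ?P \<delta> R0")
proof (rule ccontr)
  assume "\<not> ?thesis"
  then have neg: "\<not> ?P \<delta> R0" if "0 < \<delta>" "0 < R0" for \<delta> R0 using that by blast
  \<comment> \<open>The first bound keeps the scheme within the ball, as drift and error add up to
    at most \<open>A * T + \<delta> n \<le> \<rho>\<close>; the second makes the error
    vanish.\<close>
  define \<delta> where "\<delta> n = min (\<rho> - A * T) (inverse (real (Suc n)))" for n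
  have \<delta>: "0 < \<delta> n" "\<delta> n \<le> \<rho> - A * T" "\<delta> n \<le> inverse (real (Suc n))" for n
    using T by (auto simp: \<delta>_def)
  have "\<exists>R z t. real (Suc n) \<le> R \<and> (\<forall>k. real k \<le> T * R \<longrightarrow> (\<forall>j<k. z j \<in> cball x \<rho>) \<longrightarrow>
      norm (z k - x - (1 / R) *\<^sub>R (\<Sum>j<k. h (z j))) \<le> \<delta> n) \<and> t \<in> {0..T} \<and>
      \<epsilon> < norm (z (nat \<lfloor>t * R\<rfloor>) - \<mu> t)" for n
  proof -
    have "\<not> ?P (\<delta> n) (real (Suc n))" by (rule neg) (use \<delta> in auto)
    then show ?thesis unfolding not_all not_imp not_le Ball_def by blast
  qed
  then obtain R z \<tau> where R: "\<And>n. real (Suc n) \<le> R n"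
    and z: "\<And>n k. real k \<le> T * R n \<Longrightarrow> (\<forall>j<k. z n j \<in> cball x \<rho>) \<Longrightarrow>
      norm (z n k - x - (1 / R n) *\<^sub>R (\<Sum>j<k. h (z n j))) \<le> \<delta> n"
    and \<tau>: "\<And>n. \<tau> n \<in> {0..T}" "\<And>n. \<epsilon> < norm (z n (nat \<lfloor>\<tau> n * R n\<rfloor>) - \<mu> (\<tau> n))"
    by metis
  have Rpos: "0 < R n" for n using R[of n] by simp
  \<comment> \<open>The error bound at \<open>k\<close> is available only while all earlier points
    lie in the ball; strong induction turns this into containment of every point up to time
    \<open>T\<close>.\<close>
  have z_ball: "z n k \<in> cball x \<rho>" if "real k \<le> T * R n" for n k
    using that
  proof (induction k rule: less_induct)
    case (less k)
    have ball: "\<forall>j<k. z n j \<in> cball x \<rho>"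
    proof (intro allI impI)
      fix j assume "j < k"
      then show "z n j \<in> cball x \<rho>" using less.prems by (intro less.IH) auto
    qed
    have "norm (\<Sum>j<k. h (z n j)) \<le> real k * A"
      using sum_norm_le[of "{..<k}" "\<lambda>j. h (z n j)" "\<lambda>_. A"] ball A(2) by auto
    then have "norm ((1 / R n) *\<^sub>R (\<Sum>j<k. h (z n j))) \<le> (1 / R n) * (real k * A)"
      using Rpos[of n] by (simp add: divide_right_mono)
    also have "\<dots> = real k / R n * A" by simp
    also have "\<dots> \<le> T * A"
      using less.prems Rpos[of n] A(1) by (intro mult_right_mono) (simp_all add: pos_divide_le_eq)
    finally have "norm ((1 / R n) *\<^sub>R (\<Sum>j<k. h (z n j))) \<le> A * T" by (simp add: mult.commute)
    moreover have "norm (z n k - x) \<le> norm (z n k - x - (1 / R n) *\<^sub>R (\<Sum>j<k. h (z n j)))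
        + norm ((1 / R n) *\<^sub>R (\<Sum>j<k. h (z n j)))"
      using norm_triangle_ineq[of "z n k - x - (1 / R n) *\<^sub>R (\<Sum>j<k. h (z n j))"
        "(1 / R n) *\<^sub>R (\<Sum>j<k. h (z n j))"] by simp
    ultimately have "norm (z n k - x) \<le> \<rho>" using z[OF less.prems ball] \<delta>(2)[of n] by simp
    then show ?case by (simp add: dist_norm norm_minus_commute)
  qed
  \<comment> \<open>One cell more than the floor of \<open>T * R n\<close>: the cells then cover
    \<open>{0..T}\<close>, and every index below \<open>J n\<close> still satisfies
    \<open>real j \<le> T * R n\<close>, as \<open>z_ball\<close> requires.\<close>
  define J where "J n = Suc (nat \<lfloor>T * R n\<rfloor>)" for n
  have TR: "0 \<le> T * R n" for n using T(1) Rpos[of n] by simp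
  have J: "real j \<le> T * R n" if "j < J n" for n j
  proof -
    have "j \<le> nat \<lfloor>T * R n\<rfloor>" using that by (simp add: J_def)
    then have "real j \<le> real (nat \<lfloor>T * R n\<rfloor>)" by simp
    also have "\<dots> \<le> T * R n" using TR by (simp add: of_nat_floor)
    finally show ?thesis .
  qed
  have TJ: "T \<le> real (J n) / R n" for n
  proof -
    have "T * R n \<le> real (J n)" using TR[of n] real_of_int_floor_add_one_ge[of "T * R n"]
      by (simp add: J_def add.commute)
    then show ?thesis using Rpos[of n] by (simp add: pos_le_divide_eq)
  qed
  define w where "w n j = h (z n j)" for n j
  have w: "norm (w n j) \<le> A" if "j < J n" for n j unfolding w_def by (rule A(2)[OF z_ball[OF J[OF that]]])
  define y where "y n t = x + interpolate (R n) (J n) (w n) t" for n t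
  have lip: "norm (y n t - y n s) \<le> A * \<bar>t - s\<bar>" if "s \<in> {0..T}" "t \<in> {0..T}" for n s t
    using interpolate_lipschitz[OF Rpos, of s "J n" n t "w n" A] w that TJ[of n] by (auto simp: y_def)
  have y0: "y n 0 = x" for n by (simp add: y_def interpolate_0 Rpos)
  have y_grid: "norm (z n k - y n (real k / R n)) \<le> \<delta> n" if "k < J n" for n k
  proof -
    have "norm (z n k - x - (1 / R n) *\<^sub>R (\<Sum>j<k. h (z n j))) \<le> \<delta> n"
    proof (rule z[OF J[OF that]])
      show "\<forall>j<k. z n j \<in> cball x \<rho>" using that by (intro allI impI z_ball J) auto
    qed
    then show ?thesis
      using interpolate_grid[OF Rpos, of k "J n" n "w n"] that by (simp add: y_def w_def diff_diff_eq)
  qed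
  have zy: "norm (z n (nat \<lfloor>t * R n\<rfloor>) - y n t) \<le> \<delta> n + A / R n" if t: "t \<in> {0..T}" for n t
  proof -
    define k where "k = nat \<lfloor>t * R n\<rfloor>"
    have tR: "0 \<le> t * R n" "t * R n \<le> T * R n" using t Rpos[of n] by auto
    have k: "real k \<le> t * R n" "t * R n \<le> real k + 1"
      unfolding k_def using tR real_of_int_floor_add_one_ge[of "t * R n"] by (auto simp: of_nat_floor)
    have "k < J n" unfolding k_def J_def using tR by (simp add: nat_mono floor_mono le_imp_less_Suc)
    have "t \<le> (real k + 1) / R n" using k Rpos[of n] by (simp add: pos_le_divide_eq)
    then have kt: "real k / R n \<le> t" "t - real k / R n \<le> 1 / R n"
      using k Rpos[of n] by (simp_all add: pos_divide_le_eq add_divide_distrib)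
    have "norm (y n t - y n (real k / R n)) \<le> A * \<bar>t - real k / R n\<bar>"
      using kt t Rpos[of n] by (intro lip) auto
    also have "\<dots> \<le> A * (1 / R n)" using kt A(1) by (intro mult_left_mono) auto
    finally have "norm (y n (real k / R n) - y n t) \<le> A / R n" by (simp add: norm_minus_commute)
    then show ?thesis
      using y_grid[OF \<open>k < J n\<close>] norm_triangle_ineq[of "z n k - y n (real k / R n)" "y n (real k / R n) - y n t"]
      by (simp add: k_def)
  qed
  obtain g \<kappa> where g: "continuous_on {0..T} g" "strict_mono (\<kappa> :: nat \<Rightarrow> nat)"
      "\<And>e. 0 < e \<Longrightarrow> \<exists>N. \<forall>n t. N \<le> n \<and> t \<in> {0..T} \<longrightarrow> norm (y (\<kappa> n) t - g t) < e"
  proof (rule Arzela_Ascoli[of "{0..T}" y "norm x + A * T"])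
    show "norm (y n t) \<le> norm x + A * T" if t: "t \<in> {0..T}" for n t
    proof -
      have "norm (y n t - x) \<le> A * \<bar>t - 0\<bar>" using lip[of 0 t n] t T y0[of n] by simp
      also have "\<dots> \<le> A * T" using t A(1) by (intro mult_left_mono) auto
      finally show ?thesis using norm_triangle_ineq[of x "y n t - x"] by simp
    qed
    show "\<exists>d>0. \<forall>n t. t \<in> {0..T} \<and> norm (s - t) < d \<longrightarrow> norm (y n s - y n t) < e"
      if s: "s \<in> {0..T}" and e: "0 < e" for s e
    \<comment> \<open>The summand \<open>1\<close> allows for \<open>A = 0\<close>.\<close>
    proof (intro exI[of _ "e / (A + 1)"] conjI allI impI)
      fix n t assume t: "t \<in> {0..T} \<and> norm (s - t) < e / (A + 1)"
      have "norm (y n s - y n t) \<le> A * \<bar>s - t\<bar>" using lip s t by blast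
      also have "\<dots> \<le> (A + 1) * \<bar>s - t\<bar>" by (intro mult_right_mono) auto
      also have "\<dots> < e" using t A(1) by (simp add: pos_less_divide_eq mult.commute)
      finally show "norm (y n s - y n t) < e" .
    qed (use e A(1) in auto)
  qed (auto intro: that)
  have \<kappa>: "n \<le> \<kappa> n" for n using g(2) by (rule seq_suble)
  have small: "\<delta> (\<kappa> n) \<le> inverse (real (Suc n))" "1 / R (\<kappa> n) \<le> inverse (real (Suc n))" for n
  proof -
    have *: "inverse (real (Suc (\<kappa> n))) \<le> inverse (real (Suc n))" using \<kappa>[of n] by simp
    then show "\<delta> (\<kappa> n) \<le> inverse (real (Suc n))" using \<delta>(3)[of "\<kappa> n"] by (rule order_trans[rotated])
    have "1 / R (\<kappa> n) \<le> inverse (real (Suc (\<kappa> n)))"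
      using R[of "\<kappa> n"] by (simp add: inverse_eq_divide frac_le)
    then show "1 / R (\<kappa> n) \<le> inverse (real (Suc n))" using * by (rule order_trans)
  qed
  have inv_small: "\<exists>N. \<forall>n\<ge>N. inverse (real (Suc n)) < e" if "0 < e" for e :: real
  proof -
    have "\<forall>\<^sub>F n in sequentially. inverse (real (Suc n)) < e"
      using LIMSEQ_inverse_real_of_nat that by (rule order_tendstoD)
    then show ?thesis by (simp add: eventually_sequentially)
  qed
  have g_lim: "(\<lambda>n. y (\<kappa> n) t) \<longlonglongrightarrow> g t" if "t \<in> {0..T}" for t
    using g(3) that unfolding LIMSEQ_iff by meson
  have g_ball: "g t \<in> cball x \<rho>" if t: "t \<in> {0..T}" for t
  proof -
    have "norm (y n t - x) \<le> \<rho>" for n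
    proof -
      have "norm (y n t - x) \<le> A * \<bar>t - 0\<bar>" using lip[of 0 t n] t T y0[of n] by simp
      also have "\<dots> \<le> A * T" using t A(1) by (intro mult_left_mono) auto
      finally show ?thesis using T(2) by simp
    qed
    then have "y n t \<in> cball x \<rho>" for n by (simp add: dist_norm norm_minus_commute)
    then show ?thesis by (intro closed_sequentially[OF closed_cball _ g_lim[OF t]])
  qed
  have uc: "uniformly_continuous_on (cball x \<rho>) h"
    using cont by (rule compact_uniformly_continuous) simp
  \<comment> \<open>The difference quotient estimate is shown for the polygons, with a radius
    \<open>d\<close> independent of \<open>n\<close>, and passes to the limit because the inequality
    is not strict.\<close>
  have deriv: "(g has_vector_derivative h (g s)) (at s within {0..T})" if s: "s \<in> {0..T}" for s
    unfolding has_vector_derivative_def has_derivative_within_alt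
  proof (intro conjI allI impI bounded_linear_scaleR_left)
    fix e :: real assume e: "0 < e"
    obtain \<omega> where \<omega>: "0 < \<omega>" "\<And>a b. a \<in> cball x \<rho> \<Longrightarrow> b \<in> cball x \<rho> \<Longrightarrow> dist a b < \<omega> \<Longrightarrow> dist (h a) (h b) < e"
      using uc e unfolding uniformly_continuous_on_def by metis
    \<comment> \<open>A quarter of \<open>\<omega>\<close> each goes to the motion of the polygon
      during time \<open>d\<close>, to the distance of polygon and limit at \<open>s\<close>, and to
      the error terms of order \<open>1 / n\<close>; together they stay below
      \<open>\<omega>\<close>.\<close>
    define d where "d = \<omega> / (4 * (A + 1))"
    have d: "0 < d" "A * d \<le> \<omega> / 4"
      using \<omega> A(1) by (auto simp: d_def field_simps)
    have "norm (g t - g s - (t - s) *\<^sub>R h (g s)) \<le> e * norm (t - s)"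
      if t: "t \<in> {0..T}" "norm (t - s) < d" for t
    proof -
      obtain N1 where N1: "\<And>n t. N1 \<le> n \<Longrightarrow> t \<in> {0..T} \<Longrightarrow> norm (y (\<kappa> n) t - g t) < \<omega> / 4"
        using g(3)[of "\<omega> / 4"] \<omega>(1) by (metis divide_pos_pos zero_less_numeral)
      obtain N2 where N2: "\<And>n. N2 \<le> n \<Longrightarrow> inverse (real (Suc n)) < \<omega> / (4 * (A + 1))"
        using inv_small[OF d(1)[unfolded d_def]] by blast
      have "norm (y (\<kappa> n) t - y (\<kappa> n) s - (t - s) *\<^sub>R h (g s)) \<le> e * norm (t - s)" if n: "max N1 N2 \<le> n" for n
      proof -
        have inv: "(A + 1) * inverse (real (Suc n)) < \<omega> / 4"
          using N2[of n] n A(1) by (simp add: field_simps)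
        have close: "norm (w (\<kappa> n) j - h (g s)) \<le> e"
          if j: "j < J (\<kappa> n)" and jts: "real j / R (\<kappa> n) < max s t" "min s t < real (Suc j) / R (\<kappa> n)" for j
        proof -
          define u where "u = real j / R (\<kappa> n)"
          have u: "u \<in> {0..T}" using J[OF j] Rpos[of "\<kappa> n"] by (simp add: u_def pos_divide_le_eq)
          have "real (Suc j) / R (\<kappa> n) = u + 1 / R (\<kappa> n)" by (simp add: u_def add_divide_distrib)
          then have "min s t < u + inverse (real (Suc n))" "u < max s t"
            using jts small(2)[of n] by (auto simp: u_def)
          \<comment> \<open>A cell meeting the interval between \<open>s\<close> and
            \<open>t\<close> may begin up to one cell length before it.\<close>
          then have us: "\<bar>u - s\<bar> \<le> d + inverse (real (Suc n))"
            using t(2)[unfolded real_norm_def] inverse_nonnegative_iff_nonnegative[of "real (Suc n)"] of_nat_0_le_iff[of "Suc n"]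
            by linarith
          have "norm (y (\<kappa> n) u - y (\<kappa> n) s) \<le> A * (d + inverse (real (Suc n)))"
            using lip[OF s u] us A(1) by (meson mult_left_mono order_trans)
          moreover have "norm (z (\<kappa> n) j - y (\<kappa> n) u) \<le> inverse (real (Suc n))"
            using y_grid[OF j] small(1)[of n] by (simp add: u_def)
          moreover have "norm (y (\<kappa> n) s - g s) < \<omega> / 4" using N1 n s by simp
          moreover have "norm (z (\<kappa> n) j - g s) \<le> norm (z (\<kappa> n) j - y (\<kappa> n) u) +
              norm (y (\<kappa> n) u - y (\<kappa> n) s) + norm (y (\<kappa> n) s - g s)"
            using norm_triangle_ineq[of "z (\<kappa> n) j - y (\<kappa> n) u" "y (\<kappa> n) u - g s"]
              norm_triangle_ineq[of "y (\<kappa> n) u - y (\<kappa> n) s" "y (\<kappa> n) s - g s"] by simp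
          ultimately have "norm (z (\<kappa> n) j - g s) < \<omega>"
            using inv d(2) \<omega>(1) by (simp add: distrib_left distrib_right)
          then have "dist (h (z (\<kappa> n) j)) (h (g s)) < e"
            by (intro \<omega>(2) z_ball[OF J[OF j]] g_ball s) (simp add: dist_norm)
          then show ?thesis by (simp add: dist_norm w_def)
        qed
        show ?thesis
        proof (cases "s \<le> t")
          case True
          then show ?thesis
            using interpolate_diff[OF Rpos, of s t "J (\<kappa> n)" "\<kappa> n" "w (\<kappa> n)" "h (g s)" e] close s t TJ[of "\<kappa> n"]
            by (simp add: y_def max_def min_def split: if_splits)
        next
          case False
          have "norm (interpolate (R (\<kappa> n)) (J (\<kappa> n)) (w (\<kappa> n)) s - interpolate (R (\<kappa> n)) (J (\<kappa> n)) (w (\<kappa> n)) t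
              - (s - t) *\<^sub>R h (g s)) \<le> e * (s - t)"
            using False close s t TJ[of "\<kappa> n"]
            by (intro interpolate_diff Rpos) (auto simp: max_def min_def)
          moreover have "y (\<kappa> n) t - y (\<kappa> n) s - (t - s) *\<^sub>R h (g s) =
            - (interpolate (R (\<kappa> n)) (J (\<kappa> n)) (w (\<kappa> n)) s - interpolate (R (\<kappa> n)) (J (\<kappa> n)) (w (\<kappa> n)) t
              - (s - t) *\<^sub>R h (g s))" by (simp add: y_def scaleR_diff_left)
          ultimately show ?thesis using False by (simp only: norm_minus_cancel) simp
        qed
      qed
      moreover have "(\<lambda>n. norm (y (\<kappa> n) t - y (\<kappa> n) s - (t - s) *\<^sub>R h (g s)))
          \<longlonglongrightarrow> norm (g t - g s - (t - s) *\<^sub>R h (g s))"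
        by (intro tendsto_intros g_lim s t)
      ultimately show ?thesis by (intro LIMSEQ_le_const2) blast+
    qed
    then show "\<exists>d>0. \<forall>t\<in>{0..T}. norm (t - s) < d \<longrightarrow> norm (g t - g s - (t - s) *\<^sub>R h (g s)) \<le> e * norm (t - s)"
      using d(1) by blast
  qed
  have "ode_solution C h x {0..T} g"
    unfolding ode_solution_def
  proof (intro conjI ballI)
    have "(\<lambda>n. y (\<kappa> n) 0) \<longlonglongrightarrow> g 0" using T by (intro g_lim) auto
    then show "g 0 = x" by (simp add: y0 LIMSEQ_const_iff)
    show "continuous_on {0..T} (\<lambda>t. h (g t))"
      by (rule continuous_on_compose2[OF cont g(1)]) (use g_ball in blast)
  qed (use g_ball \<rho>(2) deriv in auto)
  then have g\<mu>: "g t = \<mu> t" if "t \<in> {0..T}" for t using uniq that by blast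
  obtain N1 where N1: "\<And>n t. N1 \<le> n \<Longrightarrow> t \<in> {0..T} \<Longrightarrow> norm (y (\<kappa> n) t - g t) < \<epsilon> / 2"
    using g(3)[OF half_gt_zero[OF \<epsilon>]] by blast
  obtain N2 where N2: "\<And>n. N2 \<le> n \<Longrightarrow> inverse (real (Suc n)) < \<epsilon> / (2 * (A + 1))"
    using inv_small[of "\<epsilon> / (2 * (A + 1))"] \<epsilon> A(1) by (metis add_nonneg_pos divide_pos_pos mult_pos_pos zero_less_numeral zero_less_one)
  define n where "n = max N1 N2"
  define t where "t = \<tau> (\<kappa> n)"
  have t: "t \<in> {0..T}" unfolding t_def by (rule \<tau>(1))
  have "(A + 1) * inverse (real (Suc n)) < \<epsilon> / 2"
    using N2[of n] A(1) by (simp add: n_def field_simps)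
  moreover have "norm (z (\<kappa> n) (nat \<lfloor>t * R (\<kappa> n)\<rfloor>) - y (\<kappa> n) t) \<le> inverse (real (Suc n)) + A * inverse (real (Suc n))"
    using zy[OF t, of "\<kappa> n"] small[of n] mult_left_mono[OF small(2)[of n] A(1)] by simp
  moreover have "norm (y (\<kappa> n) t - \<mu> t) < \<epsilon> / 2" using N1[of n t] t g\<mu>[OF t] by (simp add: n_def)
  moreover have "norm (z (\<kappa> n) (nat \<lfloor>t * R (\<kappa> n)\<rfloor>) - \<mu> t)
      \<le> norm (z (\<kappa> n) (nat \<lfloor>t * R (\<kappa> n)\<rfloor>) - y (\<kappa> n) t) + norm (y (\<kappa> n) t - \<mu> t)"
    using norm_triangle_ineq[of "z (\<kappa> n) (nat \<lfloor>t * R (\<kappa> n)\<rfloor>) - y (\<kappa> n) t" "y (\<kappa> n) t - \<mu> t"] by simp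
  ultimately show False using \<tau>(2)[of "\<kappa> n"] by (simp add: t_def distrib_right)
qed

section \<open>The chain as a perturbed Euler scheme\<close>

text \<open>The error in the hypothesis is multiplied by \<open>norm y powr (- \<beta>)\<close>,
  which is bounded on a compact set away from the origin.\<close>

lemma scaled_drift_uniform_limit:
  fixes \<Delta> h \<Delta>inf :: "'a::euclidean_space \<Rightarrow> 'a"
  assumes lim: "((\<lambda>r::real. SUP y\<in>H. ennreal (norm ((r powr \<beta> * norm y powr \<beta>) *\<^sub>R \<Delta> (r *\<^sub>R y)
            - \<Delta>inf y))) \<longlongrightarrow> 0) at_top"
    and H: "compact H" "0 \<notin> H"
    and h: "\<And>y. y \<in> H \<Longrightarrow> h y = norm y powr (- \<beta>) *\<^sub>R \<Delta>inf y"
    and \<gamma>: "0 < \<gamma>"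
  shows "\<exists>r0. \<forall>r\<ge>r0. \<forall>y\<in>H. norm (r powr \<beta> *\<^sub>R \<Delta> (r *\<^sub>R y) - h y) \<le> \<gamma>"
proof -
  have "continuous_on H (\<lambda>y. norm y powr (- \<beta>))"
    using H(2) by (intro continuous_intros) auto
  then have "bounded ((\<lambda>y. norm y powr (- \<beta>)) ` H)"
    using H(1) by (intro compact_imp_bounded compact_continuous_image)
  then obtain M where M: "0 < M" "\<And>y. y \<in> H \<Longrightarrow> norm y powr (- \<beta>) \<le> M"
    unfolding bounded_pos by auto
  have "0 < ennreal (\<gamma> / M)" using \<gamma> M(1) by simp
  from order_tendstoD(2)[OF lim this] obtain r0 where r0: "\<And>r. r0 \<le> r \<Longrightarrow>
      (SUP y\<in>H. ennreal (norm ((r powr \<beta> * norm y powr \<beta>) *\<^sub>R \<Delta> (r *\<^sub>R y) - \<Delta>inf y))) < ennreal (\<gamma> / M)"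
    unfolding eventually_at_top_linorder by blast
  have "norm (r powr \<beta> *\<^sub>R \<Delta> (r *\<^sub>R y) - h y) \<le> \<gamma>" if r: "r0 \<le> r" and y: "y \<in> H" for r y
  proof -
    let ?v = "(r powr \<beta> * norm y powr \<beta>) *\<^sub>R \<Delta> (r *\<^sub>R y) - \<Delta>inf y"
    have "ennreal (norm ?v) < ennreal (\<gamma> / M)"
      using r0[OF r] by (rule le_less_trans[rotated]) (rule SUP_upper[OF y])
    then have v: "norm ?v < \<gamma> / M" by (simp add: ennreal_less_iff)
    have "norm y powr (- \<beta>) * norm y powr \<beta> = 1"
      using y H(2) by (simp add: powr_add[symmetric]) (metis powr_zero_eq_one norm_eq_zero)
    then have "r powr \<beta> *\<^sub>R \<Delta> (r *\<^sub>R y) - h y = norm y powr (- \<beta>) *\<^sub>R ?v"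
      by (simp add: h[OF y] scaleR_diff_right mult.left_commute)
    then have "norm (r powr \<beta> *\<^sub>R \<Delta> (r *\<^sub>R y) - h y) = norm y powr (- \<beta>) * norm ?v" by simp
    also have "\<dots> \<le> M * (\<gamma> / M)" using M v y by (intro mult_mono) (auto intro: less_imp_le)
    finally show ?thesis using M(1) by simp
  qed
  then show ?thesis by blast
qed

text \<open>With \<open>z = \<phi> / r\<close> and \<open>R = r powr (1 + \<beta>)\<close>, a drift
  increment becomes \<open>(1 / R) *\<^sub>R (r powr \<beta> *\<^sub>R \<Delta> (r *\<^sub>R
  z))\<close>, close to an Euler step of length \<open>1 / R\<close> for \<open>h\<close>. The
  statement is pathwise in \<open>\<phi>\<close>, so that randomness enters later through the noise
  sums alone.\<close>

lemma scaled_recursion_close_to_ode: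
  fixes \<Delta> h \<Delta>inf :: "'a::euclidean_space \<Rightarrow> 'a"
  assumes \<beta>: "0 \<le> \<beta>"
    and C: "open C" "0 \<notin> C" and cont: "continuous_on C \<Delta>inf"
    and lim: "\<And>H. compact H \<Longrightarrow> H \<subseteq> C \<Longrightarrow>
      ((\<lambda>r::real. SUP y\<in>H. ennreal (norm ((r powr \<beta> * norm y powr \<beta>) *\<^sub>R \<Delta> (r *\<^sub>R y)
            - \<Delta>inf y))) \<longlongrightarrow> 0) at_top"
    and h: "\<And>y. y \<in> C \<Longrightarrow> h y = norm y powr (- \<beta>) *\<^sub>R \<Delta>inf y"
    and \<mu>: "0 < Tx" "unique_ode_solution C h x Tx \<mu>"
    and x: "x \<in> C"
  obtains T where "0 < T" "T \<le> Tx"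
    "\<forall>\<epsilon>>0. \<exists>\<delta>>0. \<exists>r0>0. \<forall>r\<ge>r0. \<forall>\<phi>. norm ((1 / r) *\<^sub>R \<phi> 0 - x) \<le> \<delta> \<and>
      (\<forall>k. real k \<le> T * r powr (1 + \<beta>) \<longrightarrow>
        norm (\<Sum>j<k. \<phi> (Suc j) - \<phi> j - \<Delta> (\<phi> j)) \<le> \<delta> * r) \<longrightarrow>
      (\<forall>t\<in>{0..T}. norm ((1 / r) *\<^sub>R \<phi> (nat \<lfloor>t * r powr (1 + \<beta>)\<rfloor>) - \<mu> t) \<le> \<epsilon>)"
proof -
  obtain \<rho> where \<rho>: "0 < \<rho>" "cball x \<rho> \<subseteq> C" using C(1) x open_contains_cball by blast
  have "continuous_on C (\<lambda>y. norm y powr (- \<beta>) *\<^sub>R \<Delta>inf y)"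
    using C(2) by (intro continuous_intros cont) auto
  then have "continuous_on C h" using h by (simp cong: continuous_on_cong)
  then have h_cont: "continuous_on (cball x \<rho>) h" using \<rho>(2) by (rule continuous_on_subset)
  then have "bounded (h ` cball x \<rho>)" by (intro compact_imp_bounded compact_continuous_image) auto
  then obtain A where A: "0 < A" "\<And>y. y \<in> cball x \<rho> \<Longrightarrow> norm (h y) \<le> A"
    unfolding bounded_pos by auto
  \<comment> \<open>At speed at most \<open>A\<close> the solution moves by at most
    \<open>\<rho> / 2\<close> up to this time, which leaves room in the ball for errors.\<close>
  define T where "T = min Tx (\<rho> / (2 * A))"
  have T: "0 < T" "T \<le> Tx" using \<mu> \<rho> A by (auto simp: T_def)
  have "A * T \<le> A * (\<rho> / (2 * A))" using A(1) by (intro mult_left_mono) (auto simp: T_def)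
  then have AT: "A * T < \<rho>" using A(1) \<rho>(1) by simp
  have uniq: "\<forall>t\<in>{0..T}. \<nu> t = \<mu> t" if "ode_solution C h x {0..T} \<nu>" for \<nu>
    using \<mu>(2) T that unfolding unique_ode_solution_def by blast
  have "\<exists>\<delta>>0. \<exists>r0>0. \<forall>r\<ge>r0. \<forall>\<phi>. norm ((1 / r) *\<^sub>R \<phi> 0 - x) \<le> \<delta> \<and>
      (\<forall>k. real k \<le> T * r powr (1 + \<beta>) \<longrightarrow>
        norm (\<Sum>j<k. \<phi> (Suc j) - \<phi> j - \<Delta> (\<phi> j)) \<le> \<delta> * r) \<longrightarrow>
      (\<forall>t\<in>{0..T}. norm ((1 / r) *\<^sub>R \<phi> (nat \<lfloor>t * r powr (1 + \<beta>)\<rfloor>) - \<mu> t) \<le> \<epsilon>)"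
    if \<epsilon>: "0 < \<epsilon>" for \<epsilon>
  proof -
    obtain \<delta> R0 where \<delta>: "0 < \<delta>" and "0 < R0" and euler: "\<And>R z. R0 \<le> R \<Longrightarrow>
        (\<And>k. real k \<le> T * R \<Longrightarrow> (\<forall>j<k. z j \<in> cball x \<rho>) \<Longrightarrow>
          norm (z k - x - (1 / R) *\<^sub>R (\<Sum>j<k. h (z j))) \<le> \<delta>) \<Longrightarrow>
        (\<forall>t\<in>{0..T}. norm (z (nat \<lfloor>t * R\<rfloor>) - \<mu> t) \<le> \<epsilon>)"
      using euler_scheme_close_to_ode[OF \<rho> h_cont less_imp_le[OF A(1)] A(2) T(1) AT uniq \<epsilon>] by blast
    have "0 < \<delta> / (2 * T)" using \<delta> T by simp
    then have "\<exists>r0. \<forall>r\<ge>r0. \<forall>y\<in>cball x \<rho>. norm (r powr \<beta> *\<^sub>R \<Delta> (r *\<^sub>R y) - h y) \<le> \<delta> / (2 * T)"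
      by (intro scaled_drift_uniform_limit[OF lim] h) (use \<rho>(2) C(2) compact_cball in blast)+
    then obtain r1 where r1: "\<And>r y. r1 \<le> r \<Longrightarrow> y \<in> cball x \<rho> \<Longrightarrow>
        norm (r powr \<beta> *\<^sub>R \<Delta> (r *\<^sub>R y) - h y) \<le> \<delta> / (2 * T)" by blast
    show ?thesis
    \<comment> \<open>The budget \<open>\<delta>\<close> is split: a quarter for the starting point,
      a quarter for the noise, and half for the drift, where at most \<open>T * R\<close> steps of
      weight \<open>1 / R\<close> each err by \<open>\<delta> / (2 * T)\<close>.\<close>
    proof (rule exI[of _ "\<delta> / 4"], rule conjI[OF _ exI[of _ "max 1 (max R0 r1)"]], goal_cases)
      case 1
      show ?case using \<delta> by simp
    next
      case 2
      show ?case
      proof (intro conjI allI impI)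
      fix r \<phi>
      assume r: "max 1 (max R0 r1) \<le> r"
      assume \<phi>: "norm ((1 / r) *\<^sub>R \<phi> 0 - x) \<le> \<delta> / 4 \<and> (\<forall>k. real k \<le> T * r powr (1 + \<beta>) \<longrightarrow>
        norm (\<Sum>j<k. \<phi> (Suc j) - \<phi> j - \<Delta> (\<phi> j)) \<le> \<delta> / 4 * r)"
      define R where "R = r powr (1 + \<beta>)"
      have "r powr 1 \<le> R" unfolding R_def using r \<beta> by (intro powr_mono) auto
      then have R: "R0 \<le> R" "0 < R" using r by auto
      have R_eq: "1 / r = r powr \<beta> / R" using r by (simp add: R_def powr_add)
      define z where "z k = (1 / r) *\<^sub>R \<phi> k" for k
      have rz: "r *\<^sub>R z k = \<phi> k" for k using r by (simp add: z_def)
      show "\<forall>t\<in>{0..T}. norm ((1 / r) *\<^sub>R \<phi> (nat \<lfloor>t * r powr (1 + \<beta>)\<rfloor>) - \<mu> t) \<le> \<epsilon>"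
        unfolding R_def[symmetric] z_def[symmetric]
      proof (rule euler[OF R(1)])
        fix k assume k: "real k \<le> T * R" and ball: "\<forall>j<k. z j \<in> cball x \<rho>"
        let ?e = "\<Sum>j<k. \<phi> (Suc j) - \<phi> j - \<Delta> (\<phi> j)"
        let ?g = "\<Sum>j<k. r powr \<beta> *\<^sub>R \<Delta> (r *\<^sub>R z j) - h (z j)"
        have "?e = \<phi> k - \<phi> 0 - (\<Sum>j<k. \<Delta> (\<phi> j))"
          using sum_lessThan_telescope[of \<phi> k] by (simp add: sum_subtractf)
        then have "(1 / r) *\<^sub>R ?e = z k - z 0 - (1 / r) *\<^sub>R (\<Sum>j<k. \<Delta> (\<phi> j))"
          by (simp add: z_def scaleR_diff_right)
        moreover have "(1 / R) *\<^sub>R ?g = (1 / r) *\<^sub>R (\<Sum>j<k. \<Delta> (\<phi> j)) - (1 / R) *\<^sub>R (\<Sum>j<k. h (z j))"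
          unfolding R_eq by (simp add: sum_subtractf scaleR_diff_right rz scaleR_sum_right)
        ultimately have "z k - x - (1 / R) *\<^sub>R (\<Sum>j<k. h (z j)) = (z 0 - x) + (1 / r) *\<^sub>R ?e + (1 / R) *\<^sub>R ?g"
          by simp
        also have "norm \<dots> \<le> norm (z 0 - x) + norm ((1 / r) *\<^sub>R ?e) + norm ((1 / R) *\<^sub>R ?g)"
          by (intro norm_triangle_mono order_refl)
        also have "norm (z 0 - x) \<le> \<delta> / 4" using \<phi> by (simp add: z_def)
        also have "norm ((1 / r) *\<^sub>R ?e) \<le> \<delta> / 4"
        proof -
          have "norm ?e \<le> \<delta> / 4 * r" using \<phi> k unfolding R_def by blast
          then have "norm ?e / r \<le> \<delta> / 4" using r by (simp add: pos_divide_le_eq)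
          then show ?thesis using r by simp
        qed
        also have "norm ((1 / R) *\<^sub>R ?g) \<le> \<delta> / 2"
        proof -
          have "norm ?g \<le> real k * (\<delta> / (2 * T))"
            using sum_norm_le[of "{..<k}" "\<lambda>j. r powr \<beta> *\<^sub>R \<Delta> (r *\<^sub>R z j) - h (z j)" "\<lambda>_. \<delta> / (2 * T)"]
              ball r1 r by auto
          also have "\<dots> \<le> T * R * (\<delta> / (2 * T))" using k \<delta> T by (intro mult_right_mono) auto
          also have "\<dots> = \<delta> / 2 * R" using T by simp
          finally have "norm ?g / R \<le> \<delta> / 2" using R(2) by (simp add: pos_divide_le_eq)
          then show ?thesis using R(2) by simp
        qed
        finally show "norm (z k - x - (1 / R) *\<^sub>R (\<Sum>j<k. h (z j))) \<le> \<delta>" by simp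
      qed
      qed simp
    qed
  qed
  with T that show thesis by blast
qed

section \<open>The accumulated noise\<close>

context markov_chain
begin

lemma space_P: "space (P x) = space M"
  using sets_P by (rule sets_eq_imp_space_eq)

lemma Phi_measurable [measurable]: "Phi k \<in> borel_measurable (P x)"
  using random sets_P by (simp cong: measurable_cong_sets)

lemma sets_natural_filtration:
  "sets (natural_filtration (P x) Phi k) =
    sigma_sets (space M) {Phi j -` B \<inter> space M | j B. j \<le> k \<and> B \<in> sets borel}"
  unfolding natural_filtration_def space_P by (rule sets_measure_of) auto

lemma space_natural_filtration: "space (natural_filtration (P x) Phi k) = space M"
  unfolding natural_filtration_def space_P by (rule space_measure_of) auto

lemma subalgebra_natural_filtration: "subalgebra (P x) (natural_filtration (P x) Phi k)"
  unfolding subalgebra_def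
proof
  show "space (natural_filtration (P x) Phi k) = space (P x)"
    by (simp add: space_natural_filtration space_P)
  show "sets (natural_filtration (P x) Phi k) \<subseteq> sets (P x)"
    unfolding sets_natural_filtration sets_P
    by (rule sets.sigma_sets_subset) (use random in \<open>auto intro: measurable_sets\<close>)
qed

lemma measurable_natural_filtration:
  "j \<le> k \<Longrightarrow> Phi j \<in> borel_measurable (natural_filtration (P x) Phi k)"
  by (rule measurableI) (auto simp: sets_natural_filtration space_natural_filtration)

lemma measurable_from_filtration:
  "f \<in> natural_filtration (P x) Phi k \<rightarrow>\<^sub>M N \<Longrightarrow> f \<in> P x \<rightarrow>\<^sub>M N"
  using measurable_from_subalg[OF subalgebra_natural_filtration] .

lemma measurable_transition:
  "(\<lambda>\<omega>. (\<omega>, Phi (Suc k) \<omega>)) \<in> P x \<rightarrow>\<^sub>M natural_filtration (P x) Phi k \<Otimes>\<^sub>M borel"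
  by (rule measurable_Pair[OF measurable_from_filtration[OF measurable_ident_sets[OF refl]] Phi_measurable])

lemma sigma_finite_subalgebra_natural_filtration:
  "sigma_finite_subalgebra (P x) (natural_filtration (P x) Phi k)"
  by (intro finite_measure_subalgebra_is_sigma_finite finite_measure_subalgebra.intro
      finite_measure_subalgebra_axioms.intro subalgebra_natural_filtration prob_space.finite_measure prob)

lemma kern_subprob [measurable]: "kern \<in> borel \<rightarrow>\<^sub>M subprob_algebra borel"
  by (rule measurable_prob_algebraD[OF kernel])

lemma prob_space_kern: "prob_space (kern y)" and sets_kern [measurable_cong]: "sets (kern y) = sets borel"
  using measurable_space[OF kernel, of y] by (auto simp: space_prob_algebra)

text \<open>The axiom \<open>markov\<close> only treats events of the next state. Integrated over
  past events it determines the joint law of \<open>\<omega>\<close> and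
  \<open>Phi (Suc k) \<omega>\<close> on rectangles, an intersection-stable generator. Keeping all
  of \<open>\<omega>\<close> in the first coordinate admits integrands that depend on the whole
  past, such as the stopping weights of the maximal inequality.\<close>

lemma nn_integral_markov:
  assumes g [measurable]: "g \<in> borel_measurable (natural_filtration (P x) Phi k \<Otimes>\<^sub>M borel)"
  shows "(\<integral>\<^sup>+ \<omega>. g (\<omega>, Phi (Suc k) \<omega>) \<partial>P x) = (\<integral>\<^sup>+ \<omega>. \<integral>\<^sup>+ v. g (\<omega>, v) \<partial>kern (Phi k \<omega>) \<partial>P x)"
proof -
  let ?F = "natural_filtration (P x) Phi k"
  let ?R = "restr_to_subalg (P x) ?F"
  let ?K = "\<lambda>\<omega>. distr (kern (Phi k \<omega>)) (?F \<Otimes>\<^sub>M borel) (\<lambda>v. (\<omega>, v))"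
  interpret prob_space "P x" by (rule prob)
  interpret sigma_finite_subalgebra "P x" ?F by (rule sigma_finite_subalgebra_natural_filtration)
  have sub: "subalgebra (P x) ?F" by (rule subalgebra_natural_filtration)
  have Phi_F [measurable]: "Phi k \<in> borel_measurable ?F" by (rule measurable_natural_filtration) simp
  have pair [measurable]: "(\<lambda>\<omega>. (\<omega>, Phi (Suc k) \<omega>)) \<in> P x \<rightarrow>\<^sub>M ?F \<Otimes>\<^sub>M borel"
    by (rule measurable_transition)
  have K [measurable]: "?K \<in> ?F \<rightarrow>\<^sub>M subprob_algebra (?F \<Otimes>\<^sub>M borel)"
    by (rule measurable_distr2[where M=borel]) measurable
  have R_sets: "sets ?R = sets ?F" by (rule sets_restr_to_subalg[OF sub])
  have K': "?K \<in> ?R \<rightarrow>\<^sub>M subprob_algebra (?F \<Otimes>\<^sub>M borel)"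
    using K R_sets by (simp cong: measurable_cong_sets)
  have ne: "space ?R \<noteq> {}"
    using not_empty by (simp add: space_restr_to_subalg)
  have nnR: "(\<integral>\<^sup>+ \<omega>. f \<omega> \<partial>?R) = (\<integral>\<^sup>+ \<omega>. f \<omega> \<partial>P x)" if "f \<in> borel_measurable ?F" for f
    using nn_integral_subalgebra2[OF sub that] .
  have "distr (P x) (?F \<Otimes>\<^sub>M borel) (\<lambda>\<omega>. (\<omega>, Phi (Suc k) \<omega>)) = ?R \<bind> ?K"
  proof (rule measure_eqI_generator_eq)
    let ?E = "{a \<times> b | a b. a \<in> sets ?F \<and> b \<in> sets (borel :: 'a measure)}"
    show "Int_stable ?E" by (rule Int_stable_pair_measure_generator)
    show "?E \<subseteq> Pow (space ?F \<times> space borel)" by (rule pair_measure_closed)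
    show "sets (distr (P x) (?F \<Otimes>\<^sub>M borel) (\<lambda>\<omega>. (\<omega>, Phi (Suc k) \<omega>))) = sigma_sets (space ?F \<times> space borel) ?E"
      by (simp add: sets_pair_measure)
    show "sets (?R \<bind> ?K) = sigma_sets (space ?F \<times> space borel) ?E"
      using sets_bind[OF _ ne, of ?K "?F \<Otimes>\<^sub>M borel"] by (simp add: sets_pair_measure)
    show "range (\<lambda>_::nat. space ?F \<times> space borel) \<subseteq> ?E"
      using sets.top[of ?F] sets.top[of "borel :: 'a measure"] by blast
    show "(\<Union>i::nat. space ?F \<times> space borel) = space ?F \<times> space (borel :: 'a measure)" by simp
    show "emeasure (distr (P x) (?F \<Otimes>\<^sub>M borel) (\<lambda>\<omega>. (\<omega>, Phi (Suc k) \<omega>))) (space ?F \<times> space borel) \<noteq> \<infinity>"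
      by (simp add: emeasure_distr del: space_borel)
    fix X assume "X \<in> ?E"
    then obtain A B where X: "X = A \<times> B" and A: "A \<in> sets ?F" and B: "B \<in> sets borel" by auto
    have A' [measurable]: "A \<in> sets (P x)" using A sub by (auto simp: subalgebra_def)
    note [measurable] = A B
    have XF: "X \<in> sets (?F \<Otimes>\<^sub>M borel)" unfolding X using A B by simp
    have ind: "(\<lambda>\<omega>. indicator B (Phi (Suc k) \<omega>) :: real) \<in> borel_measurable (P x)" by measurable
    have int: "integrable (P x) (\<lambda>\<omega>. indicator A \<omega> * (indicator B (Phi (Suc k) \<omega>) :: real))"
      by (rule integrable_const_bound[where B=1]) (auto simp: indicator_def)
    have mB: "(\<lambda>y. measure (kern y) B) \<in> borel_measurable borel"
      using measurable_compose[OF kern_subprob measurable_measure_subprob_algebra[OF B]] by simp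
    have mB' [measurable]: "(\<lambda>\<omega>. measure (kern (Phi k \<omega>)) B) \<in> borel_measurable (P x)"
      using measurable_compose[OF Phi_measurable mB] .
    have "emeasure (distr (P x) (?F \<Otimes>\<^sub>M borel) (\<lambda>\<omega>. (\<omega>, Phi (Suc k) \<omega>))) X
        = (\<integral>\<^sup>+\<omega>. indicator X (\<omega>, Phi (Suc k) \<omega>) \<partial>P x)"
      using XF by (subst nn_integral_indicator[symmetric], simp, subst nn_integral_distr) simp_all
    also have "\<dots> = (\<integral>\<^sup>+\<omega>. ennreal (indicator A \<omega> * indicator B (Phi (Suc k) \<omega>)) \<partial>P x)"
      unfolding X by (intro nn_integral_cong) (auto simp: indicator_def)
    also have "\<dots> = ennreal (\<integral>\<omega>. indicator A \<omega> * indicator B (Phi (Suc k) \<omega>) \<partial>P x)"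
      by (rule nn_integral_eq_integral[OF int]) auto
    also have "(\<integral>\<omega>. indicator A \<omega> * indicator B (Phi (Suc k) \<omega>) \<partial>P x)
        = (\<integral>\<omega>. indicator A \<omega> * real_cond_exp (P x) ?F (\<lambda>\<omega>. indicator B (Phi (Suc k) \<omega>)) \<omega> \<partial>P x)"
      by (rule real_cond_exp_intg(2)[symmetric, OF int _ ind]) measurable
    \<comment> \<open>Here the Markov axiom enters, under the integral over a past event
      \<open>A\<close>.\<close>
    also have "\<dots> = (\<integral>\<omega>. indicator A \<omega> * measure (kern (Phi k \<omega>)) B \<partial>P x)"
      using markov[OF B, of x k] by (intro integral_cong_AE) auto
    also have "ennreal \<dots> = (\<integral>\<^sup>+\<omega>. ennreal (indicator A \<omega> * measure (kern (Phi k \<omega>)) B) \<partial>P x)"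
      using prob_space.prob_le_1[OF prob_space_kern]
      by (intro nn_integral_eq_integral[symmetric] integrable_const_bound[where B=1])
        (auto simp: indicator_def)
    also have "\<dots> = (\<integral>\<^sup>+\<omega>. emeasure (?K \<omega>) X \<partial>P x)"
    proof (rule nn_integral_cong)
      fix \<omega> assume \<omega>: "\<omega> \<in> space (P x)"
      interpret K: prob_space "kern (Phi k \<omega>)" by (rule prob_space_kern)
      have *: "(\<lambda>v. (\<omega>, v)) -` X \<inter> space (kern (Phi k \<omega>)) = (if \<omega> \<in> A then B else {})"
        using sets.sets_into_space[OF B] sets_eq_imp_space_eq[OF sets_kern, of "Phi k \<omega>"] by (auto simp: X)
      have "\<omega> \<in> space ?F" using \<omega> by (simp add: space_natural_filtration space_P)
      then have "emeasure (?K \<omega>) X = emeasure (kern (Phi k \<omega>)) (if \<omega> \<in> A then B else {})"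
        unfolding *[symmetric] X by (intro emeasure_distr) measurable
      then show "ennreal (indicator A \<omega> * measure (kern (Phi k \<omega>)) B) = emeasure (?K \<omega>) X"
        by (simp add: K.emeasure_eq_measure)
    qed
    also have "\<dots> = emeasure (?R \<bind> ?K) X"
    proof -
      have "emeasure (?R \<bind> ?K) X = (\<integral>\<^sup>+\<omega>. emeasure (?K \<omega>) X \<partial>?R)"
        by (rule emeasure_bind[OF ne K' XF])
      also have "\<dots> = (\<integral>\<^sup>+\<omega>. emeasure (?K \<omega>) X \<partial>P x)"
        by (rule nnR, rule measurable_compose[OF K measurable_emeasure_subprob_algebra[OF XF]])
      finally show ?thesis by simp
    qed
    finally show "emeasure (distr (P x) (?F \<Otimes>\<^sub>M borel) (\<lambda>\<omega>. (\<omega>, Phi (Suc k) \<omega>))) X = emeasure (?R \<bind> ?K) X" .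
  qed
  then have "(\<integral>\<^sup>+ z. g z \<partial>distr (P x) (?F \<Otimes>\<^sub>M borel) (\<lambda>\<omega>. (\<omega>, Phi (Suc k) \<omega>))) = (\<integral>\<^sup>+ z. g z \<partial>(?R \<bind> ?K))"
    by simp
  also have "\<dots> = (\<integral>\<^sup>+ \<omega>. \<integral>\<^sup>+ z. g z \<partial>?K \<omega> \<partial>?R)"
    by (rule nn_integral_bind[OF g K'])
  also have "\<dots> = (\<integral>\<^sup>+ \<omega>. \<integral>\<^sup>+ z. g z \<partial>?K \<omega> \<partial>P x)"
    by (rule nnR, rule measurable_compose[OF K nn_integral_measurable_subprob_algebra[OF g]])
  also have "\<dots> = (\<integral>\<^sup>+ \<omega>. \<integral>\<^sup>+ v. g (\<omega>, v) \<partial>kern (Phi k \<omega>) \<partial>P x)"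
  proof (rule nn_integral_cong)
    fix \<omega> assume "\<omega> \<in> space (P x)"
    then have "\<omega> \<in> space ?F" by (simp add: space_natural_filtration space_P)
    then show "(\<integral>\<^sup>+ z. g z \<partial>?K \<omega>) = (\<integral>\<^sup>+ v. g (\<omega>, v) \<partial>kern (Phi k \<omega>))"
      by (intro nn_integral_distr g) measurable
  qed
  finally show ?thesis by (simp add: nn_integral_distr)
qed

lemma nn_integral_step:
  assumes [measurable]: "g \<in> borel_measurable (borel \<Otimes>\<^sub>M borel)"
  shows "(\<integral>\<^sup>+ \<omega>. g (Phi k \<omega>, Phi (Suc k) \<omega>) \<partial>P x) = (\<integral>\<^sup>+ \<omega>. \<integral>\<^sup>+ v. g (Phi k \<omega>, v) \<partial>kern (Phi k \<omega>) \<partial>P x)"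
proof -
  have [measurable]: "Phi k \<in> borel_measurable (natural_filtration (P x) Phi k)"
    by (rule measurable_natural_filtration) simp
  show ?thesis
    by (rule nn_integral_markov[where g="\<lambda>(\<omega>, v). g (Phi k \<omega>, v)", simplified]) measurable
qed

text \<open>Drift and innovation are defined through \<open>P x\<close>, the step estimates through
  the kernel; this identity translates between them.\<close>

lemma distr_Phi_1: "distr (P x) borel (Phi 1) = kern x"
proof (rule measure_eqI)
  fix B assume "B \<in> sets (distr (P x) borel (Phi 1))"
  then have [measurable]: "B \<in> sets borel" by simp
  interpret prob_space "P x" by (rule prob)
  have "emeasure (distr (P x) borel (Phi 1)) B = (\<integral>\<^sup>+ \<omega>. indicator B (Phi (Suc 0) \<omega>) \<partial>P x)"
    by (subst nn_integral_indicator[symmetric], simp, subst nn_integral_distr) simp_all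
  also have "\<dots> = (\<integral>\<^sup>+ \<omega>. \<integral>\<^sup>+ v. indicator B v \<partial>kern (Phi 0 \<omega>) \<partial>P x)"
    using nn_integral_step[where g="\<lambda>z. indicator B (snd z)" and x=x and k=0] by simp
  also have "\<dots> = (\<integral>\<^sup>+ \<omega>. emeasure (kern x) B \<partial>P x)"
    by (rule nn_integral_cong_AE) (use start[of x] sets_kern in auto)
  finally show "emeasure (distr (P x) borel (Phi 1)) B = emeasure (kern x) B"
    by (simp add: emeasure_space_1)
qed (simp add: sets_kern)

text \<open>Adding the bound \<open>B\<close> makes the integrand nonnegative, so that
  \<open>nn_integral_markov\<close> applies; subtracting it again leaves zero. This provides the
  orthogonality of the centered truncated innovations to the past.\<close>

lemma integral_markov_eq_0:
  fixes g :: "'w \<times> 'a \<Rightarrow> real"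
  assumes g [measurable]: "g \<in> borel_measurable (natural_filtration (P x) Phi k \<Otimes>\<^sub>M borel)"
    and bound: "\<And>z. \<bar>g z\<bar> \<le> B"
    and zero: "\<And>\<omega>. \<omega> \<in> space M \<Longrightarrow> (\<integral>v. g (\<omega>, v) \<partial>kern (Phi k \<omega>)) = 0"
  shows "(\<integral>\<omega>. g (\<omega>, Phi (Suc k) \<omega>) \<partial>P x) = 0"
proof -
  let ?F = "natural_filtration (P x) Phi k"
  interpret prob_space "P x" by (rule prob)
  have nonneg: "0 \<le> g z + B" for z using bound[of z] by (simp add: abs_le_iff)
  have B: "0 \<le> B" using bound[of undefined] by simp
  have [measurable]: "(\<lambda>\<omega>. (\<omega>, Phi (Suc k) \<omega>)) \<in> P x \<rightarrow>\<^sub>M ?F \<Otimes>\<^sub>M borel"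
    by (rule measurable_transition)
  have int: "integrable (P x) (\<lambda>\<omega>. g (\<omega>, Phi (Suc k) \<omega>))"
    by (rule integrable_const_bound[where B=B]) (use bound in auto)
  have "ennreal (\<integral>\<omega>. g (\<omega>, Phi (Suc k) \<omega>) + B \<partial>P x) = (\<integral>\<^sup>+\<omega>. ennreal (g (\<omega>, Phi (Suc k) \<omega>) + B) \<partial>P x)"
    using int nonneg by (intro nn_integral_eq_integral[symmetric]) auto
  also have "\<dots> = (\<integral>\<^sup>+ \<omega>. \<integral>\<^sup>+ v. ennreal (g (\<omega>, v) + B) \<partial>kern (Phi k \<omega>) \<partial>P x)"
    by (rule nn_integral_markov[where g="\<lambda>z. ennreal (g z + B)"]) measurable
  also have "\<dots> = (\<integral>\<^sup>+ \<omega>. ennreal B \<partial>P x)"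
  proof (rule nn_integral_cong)
    fix \<omega> assume \<omega>: "\<omega> \<in> space (P x)"
    interpret K: prob_space "kern (Phi k \<omega>)" by (rule prob_space_kern)
    have "\<omega> \<in> space ?F" using \<omega> by (simp add: space_natural_filtration space_P)
    then have "(\<lambda>v. g (\<omega>, v)) \<in> borel_measurable borel"
      by (rule measurable_compose[OF measurable_Pair1' g])
    then have gm: "(\<lambda>v. g (\<omega>, v)) \<in> borel_measurable (kern (Phi k \<omega>))"
      using measurable_cong_sets[OF sets_kern refl] by blast
    have i: "integrable (kern (Phi k \<omega>)) (\<lambda>v. g (\<omega>, v))"
      by (rule K.integrable_const_bound[where B=B, OF _ gm]) (simp add: bound)
    then have "(\<integral>\<^sup>+ v. ennreal (g (\<omega>, v) + B) \<partial>kern (Phi k \<omega>)) = ennreal (\<integral>v. g (\<omega>, v) + B \<partial>kern (Phi k \<omega>))"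
      using nonneg by (intro nn_integral_eq_integral) auto
    then show "(\<integral>\<^sup>+ v. ennreal (g (\<omega>, v) + B) \<partial>kern (Phi k \<omega>)) = ennreal B"
      using zero \<omega> i by (simp add: space_P K.prob_space)
  qed
  finally have "ennreal (\<integral>\<omega>. g (\<omega>, Phi (Suc k) \<omega>) + B \<partial>P x) = ennreal B"
    by (simp add: emeasure_space_1)
  then have "(\<integral>\<omega>. g (\<omega>, Phi (Suc k) \<omega>) + B \<partial>P x) = B"
    using B nonneg by (subst (asm) ennreal_inj) (auto intro: integral_nonneg)
  then show ?thesis using int by (simp add: prob_space)
qed

end

section \<open>A maximal inequality for orthogonal increments\<close>

text \<open>Stopping the sums when they first exceed \<open>a\<close> multiplies the
  increments by the predictable indicators \<open>H\<close> and hence keeps them orthogonal.\<close>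

lemma (in prob_space) kolmogorov_maximal_inequality:
  fixes \<xi> :: "nat \<Rightarrow> 'a \<Rightarrow> 'b::euclidean_space"
  assumes sub: "\<And>k. subalgebra M (F k)"
    and adapted: "\<And>j k. j < k \<Longrightarrow> \<xi> j \<in> borel_measurable (F k)"
    and bound: "\<And>j \<omega>. norm (\<xi> j \<omega>) \<le> b"
    and second: "\<And>j. expectation (\<lambda>\<omega>. (norm (\<xi> j \<omega>))\<^sup>2) \<le> V"
    and orth: "\<And>k W w. W \<in> borel_measurable (F k) \<Longrightarrow> (\<And>\<omega>. norm (W \<omega>) \<le> w) \<Longrightarrow>
      expectation (\<lambda>\<omega>. \<xi> k \<omega> \<bullet> W \<omega>) = 0"
    and a: "0 < a"
  shows "prob {\<omega> \<in> space M. \<exists>k\<le>n. a < norm (\<Sum>j<k. \<xi> j \<omega>)} \<le> real n * V / a\<^sup>2"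
proof -
  define S where "S k \<omega> = (\<Sum>j<k. \<xi> j \<omega>)" for k \<omega>
  \<comment> \<open>\<open>S k\<close> contains only \<open>\<xi> j\<close> with
    \<open>j < k\<close>, so \<open>H k\<close> is measurable with respect to \<open>F k\<close>,
    and \<open>orth\<close> applies to \<open>\<xi> k\<close> paired with
    \<open>H k \<omega> *\<^sub>R Z k \<omega>\<close>.\<close>
  define H where "H k \<omega> = (if \<forall>i\<in>{..k}. norm (S i \<omega>) \<le> a then 1 else 0 :: real)" for k \<omega>
  define Z where "Z k \<omega> = (\<Sum>j<k. H j \<omega> *\<^sub>R \<xi> j \<omega>)" for k \<omega>
  have b0: "0 \<le> b" using bound[of 0 undefined] norm_ge_zero order_trans by blast
  have S_F: "S i \<in> borel_measurable (F k)" if "i \<le> k" for i k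
    unfolding S_def using adapted that by (intro borel_measurable_sum) auto
  have H_F: "H j \<in> borel_measurable (F k)" if "j \<le> k" for j k
  proof -
    have "Measurable.pred (F k) (\<lambda>\<omega>. norm (S i \<omega>) \<le> a)" if "i \<le> j" for i
    proof -
      have [measurable]: "S i \<in> borel_measurable (F k)" using S_F \<open>j \<le> k\<close> that by simp
      show ?thesis by measurable
    qed
    then have "Measurable.pred (F k) (\<lambda>\<omega>. \<forall>i\<in>{..j}. norm (S i \<omega>) \<le> a)"
      by (intro pred_intros_finite) auto
    then show ?thesis unfolding H_def by (intro measurable_If) auto
  qed
  have Z_F: "Z k \<in> borel_measurable (F k)" for k
    unfolding Z_def using adapted H_F by (intro borel_measurable_sum borel_measurable_scaleR) auto
  have meas [measurable]: "\<xi> j \<in> borel_measurable M" "S j \<in> borel_measurable M"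
      "H j \<in> borel_measurable M" "Z j \<in> borel_measurable M" for j
    using measurable_from_subalg[OF sub] adapted[of j "Suc j"] S_F[of j j] H_F[of j j] Z_F[of j] by blast+
  have H01: "0 \<le> H j \<omega>" "H j \<omega> \<le> 1" "H j \<omega> * H j \<omega> = H j \<omega>" for j \<omega> by (auto simp: H_def)
  have Hxi: "norm (H j \<omega> *\<^sub>R \<xi> j \<omega>) \<le> b" for j \<omega>
    using bound[of j \<omega>] b0 by (auto simp: H_def)
  have Z_bound: "norm (Z k \<omega>) \<le> real k * b" for k \<omega>
    unfolding Z_def using sum_norm_le[of "{..<k}" "\<lambda>j. H j \<omega> *\<^sub>R \<xi> j \<omega>" "\<lambda>_. b"] Hxi by simp
  have int_Z: "integrable M (\<lambda>\<omega>. (norm (Z k \<omega>))\<^sup>2)" for k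
    by (rule integrable_const_bound[where B="(real k * b)\<^sup>2"])
      (use Z_bound in \<open>auto intro!: power_mono\<close>)
  have int_xi: "integrable M (\<lambda>\<omega>. (norm (\<xi> k \<omega>))\<^sup>2)" for k
    by (rule integrable_const_bound[where B="b\<^sup>2"]) (use bound in \<open>auto intro!: power_mono\<close>)
  have int_cross: "integrable M (\<lambda>\<omega>. \<xi> k \<omega> \<bullet> (H k \<omega> *\<^sub>R Z k \<omega>))" for k
  proof (rule integrable_const_bound[where B="b * (1 * (real k * b))"])
    have "norm (\<xi> k \<omega> \<bullet> (H k \<omega> *\<^sub>R Z k \<omega>)) \<le> b * (1 * (real k * b))" for \<omega>
    proof -
      have "norm (\<xi> k \<omega> \<bullet> (H k \<omega> *\<^sub>R Z k \<omega>)) \<le> norm (\<xi> k \<omega>) * (\<bar>H k \<omega>\<bar> * norm (Z k \<omega>))"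
        using Cauchy_Schwarz_ineq2[of "\<xi> k \<omega>" "H k \<omega> *\<^sub>R Z k \<omega>"] by simp
      also have "\<dots> \<le> b * (1 * (real k * b))"
        using bound Z_bound H01 b0 by (intro mult_mono) auto
      finally show ?thesis .
    qed
    then show "AE \<omega> in M. norm (\<xi> k \<omega> \<bullet> (H k \<omega> *\<^sub>R Z k \<omega>)) \<le> b * (1 * (real k * b))" by simp
  qed measurable
  have Z_second: "expectation (\<lambda>\<omega>. (norm (Z k \<omega>))\<^sup>2) \<le> real k * V" for k
  proof (induction k)
    case (Suc k)
    have "(norm (Z (Suc k) \<omega>))\<^sup>2 = (norm (Z k \<omega>))\<^sup>2 + 2 * (\<xi> k \<omega> \<bullet> (H k \<omega> *\<^sub>R Z k \<omega>)) + H k \<omega> * (norm (\<xi> k \<omega>))\<^sup>2" for \<omega>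
    proof -
      have "Z (Suc k) \<omega> = Z k \<omega> + H k \<omega> *\<^sub>R \<xi> k \<omega>" by (simp add: Z_def)
      then show ?thesis
        using H01(3)[of k \<omega>] unfolding power2_norm_eq_inner
        by (simp add: inner_add_left inner_add_right inner_commute flip: mult.assoc)
    qed
    then have "(norm (Z (Suc k) \<omega>))\<^sup>2 \<le> (norm (Z k \<omega>))\<^sup>2 + 2 * (\<xi> k \<omega> \<bullet> (H k \<omega> *\<^sub>R Z k \<omega>)) + (norm (\<xi> k \<omega>))\<^sup>2" for \<omega>
      using H01(2)[of k \<omega>] mult_right_mono[of "H k \<omega>" 1 "(norm (\<xi> k \<omega>))\<^sup>2"] by simp
    then have "expectation (\<lambda>\<omega>. (norm (Z (Suc k) \<omega>))\<^sup>2) \<le>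
        expectation (\<lambda>\<omega>. (norm (Z k \<omega>))\<^sup>2 + 2 * (\<xi> k \<omega> \<bullet> (H k \<omega> *\<^sub>R Z k \<omega>)) + (norm (\<xi> k \<omega>))\<^sup>2)"
      using int_Z int_xi int_cross by (intro integral_mono) auto
    also have "\<dots> = expectation (\<lambda>\<omega>. (norm (Z k \<omega>))\<^sup>2) + 2 * expectation (\<lambda>\<omega>. \<xi> k \<omega> \<bullet> (H k \<omega> *\<^sub>R Z k \<omega>))
        + expectation (\<lambda>\<omega>. (norm (\<xi> k \<omega>))\<^sup>2)"
      using int_Z int_xi int_cross[of k] by (subst Bochner_Integration.integral_add; simp)+
    also have "expectation (\<lambda>\<omega>. \<xi> k \<omega> \<bullet> (H k \<omega> *\<^sub>R Z k \<omega>)) = 0"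
    proof (rule orth)
      show "(\<lambda>\<omega>. H k \<omega> *\<^sub>R Z k \<omega>) \<in> borel_measurable (F k)"
        using H_F[of k k] Z_F[of k] by (intro borel_measurable_scaleR) auto
      show "norm (H k \<omega> *\<^sub>R Z k \<omega>) \<le> real k * b" for \<omega>
        using mult_mono[OF H01(2)[of k \<omega>] Z_bound[of k \<omega>]] H01(1)[of k \<omega>] by simp
    qed
    finally show ?case using Suc second[of k] by (simp add: distrib_right)
  qed (simp add: Z_def)
  have "{\<omega> \<in> space M. \<exists>k\<le>n. a < norm (\<Sum>j<k. \<xi> j \<omega>)} \<subseteq> {\<omega> \<in> space M. a\<^sup>2 \<le> (norm (Z n \<omega>))\<^sup>2}"
  proof
    fix \<omega> assume \<omega>: "\<omega> \<in> {\<omega> \<in> space M. \<exists>k\<le>n. a < norm (\<Sum>j<k. \<xi> j \<omega>)}"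
    \<comment> \<open>At the first exceedance time \<open>k\<close> the weights switch off, so
      \<open>Z n \<omega> = S k \<omega>\<close>: an exceedance at any time up to \<open>n\<close>
      is visible in the single variable \<open>Z n\<close>.\<close>
    define k where "k = (LEAST k. a < norm (S k \<omega>))"
    obtain k0 where k0: "k0 \<le> n" "a < norm (S k0 \<omega>)" using \<omega> by (auto simp: S_def)
    have k: "a < norm (S k \<omega>)" unfolding k_def by (rule LeastI[of _ k0]) (rule k0)
    have kn: "k \<le> n" using Least_le[of "\<lambda>k. a < norm (S k \<omega>)" k0] k0 by (simp add: k_def)
    have less: "norm (S i \<omega>) \<le> a" if "i < k" for i
      using not_less_Least[of i "\<lambda>k. a < norm (S k \<omega>)"] that by (simp add: k_def not_less)
    have "H j \<omega> = (if j < k then 1 else 0)" for j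
    proof (cases "j < k")
      case False
      then have "\<not> (\<forall>i\<in>{..j}. norm (S i \<omega>) \<le> a)" using k by (auto simp: not_le not_less)
      then show ?thesis using False by (simp only: H_def if_False)
    qed (use less in \<open>auto simp: H_def\<close>)
    then have "Z n \<omega> = (\<Sum>j<n. if j < k then \<xi> j \<omega> else 0)"
      unfolding Z_def by (intro sum.cong) auto
    also have "\<dots> = (\<Sum>j\<in>{..<n} \<inter> {j. j < k}. \<xi> j \<omega>)" by (simp add: sum.inter_restrict)
    also have "{..<n} \<inter> {j. j < k} = {..<k}" using kn by auto
    finally have "a \<le> norm (Z n \<omega>)" using k by (simp add: S_def)
    then have "a\<^sup>2 \<le> (norm (Z n \<omega>))\<^sup>2" using a by (intro power_mono) auto
    then show "\<omega> \<in> {\<omega> \<in> space M. a\<^sup>2 \<le> (norm (Z n \<omega>))\<^sup>2}" using \<omega> by simp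
  qed
  then have "prob {\<omega> \<in> space M. \<exists>k\<le>n. a < norm (\<Sum>j<k. \<xi> j \<omega>)} \<le> prob {\<omega> \<in> space M. a\<^sup>2 \<le> (norm (Z n \<omega>))\<^sup>2}"
    by (rule finite_measure_mono) measurable
  also have "\<dots> \<le> expectation (\<lambda>\<omega>. (norm (Z n \<omega>))\<^sup>2) / a\<^sup>2"
    using a int_Z[of n] by (intro integral_Markov_inequality_measure[where A="space M"]) auto
  also have "\<dots> \<le> real n * V / a\<^sup>2"
    using Z_second[of n] a by (intro divide_right_mono) auto
  finally show ?thesis .
qed

section \<open>Truncated innovations and the noise bound\<close>

text \<open>The part of the hypotheses that the noise bound uses, stated for the kernel. An exponent
  \<open>q\<close> at most 2 lets the second moment of a truncated variable be bounded by its
  \<open>q\<close>-th moment.\<close>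

locale moment_chain = markov_chain M kern P Phi
  for M :: "'w measure" and kern :: "'a::euclidean_space \<Rightarrow> 'a measure" and P and Phi +
  fixes q K :: real
  assumes q: "1 < q" "q \<le> 2" and K: "0 \<le> K"
    and integrable_kern: "\<And>y. integrable (kern y) (\<lambda>v. v)"
    and moment: "\<And>y. (\<integral>\<^sup>+ v. ennreal (norm (v - (\<integral>u. u \<partial>kern y)) powr q) \<partial>kern y) \<le> ennreal K"
begin

definition mean :: "'a \<Rightarrow> 'a" where
  "mean y = (\<integral>v. v \<partial>kern y)"

definition core :: "real \<Rightarrow> 'a \<Rightarrow> 'a \<Rightarrow> 'a" where
  "core r y v = (if norm (v - mean y) \<le> r then v - mean y else 0)"

definition bias :: "real \<Rightarrow> 'a \<Rightarrow> 'a" where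
  "bias r y = (\<integral>v. core r y v \<partial>kern y)"

lemma measurable_mean [measurable]: "mean \<in> borel_measurable borel"
  unfolding mean_def
  by (rule measurable_compose[OF kern_subprob integral_measurable_subprob_algebra]) simp

lemma measurable_core [measurable]: "(\<lambda>(y, v). core r y v) \<in> borel_measurable (borel \<Otimes>\<^sub>M borel)"
  unfolding core_def by measurable

lemma measurable_core_right: "core r y \<in> borel_measurable borel"
  unfolding core_def by measurable

text \<open>The integrand depends on \<open>y\<close> as well as the kernel. Transporting
  \<open>kern y\<close> to pairs whose first entry is \<open>y\<close> turns this into integrating a
  fixed function against a measurable family of measures.\<close>

lemma measurable_bias [measurable]: "bias r \<in> borel_measurable borel"
proof -
  have "(\<lambda>y. distr (kern y) (borel \<Otimes>\<^sub>M borel) (\<lambda>v. (y, v))) \<in> borel \<rightarrow>\<^sub>M subprob_algebra (borel \<Otimes>\<^sub>M (borel :: 'a measure))"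
    by (rule measurable_distr2[OF _ kern_subprob]) simp
  then have *: "(\<lambda>y. \<integral>z. (\<lambda>(y, v). core r y v) z \<partial>distr (kern y) (borel \<Otimes>\<^sub>M borel) (\<lambda>v. (y, v))) \<in> borel_measurable borel"
    by (rule measurable_compose[OF _ integral_measurable_subprob_algebra[OF measurable_core]])
  have eq: "bias r = (\<lambda>y. \<integral>z. (\<lambda>(y, v). core r y v) z \<partial>distr (kern y) (borel \<Otimes>\<^sub>M borel) (\<lambda>v. (y, v)))"
  proof
    fix y
    have "(\<lambda>v. (y, v)) \<in> kern y \<rightarrow>\<^sub>M borel \<Otimes>\<^sub>M borel"
      using measurable_cong_sets[OF sets_kern refl] measurable_Pair1'[of y borel borel] by auto
    then show "bias r y = (\<integral>z. (\<lambda>(y, v). core r y v) z \<partial>distr (kern y) (borel \<Otimes>\<^sub>M borel) (\<lambda>v. (y, v)))"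
      unfolding bias_def by (subst integral_distr[OF _ measurable_core]) auto
  qed
  show ?thesis unfolding eq by (rule *)
qed

lemma measurable_kern_iff: "f \<in> kern y \<rightarrow>\<^sub>M N \<longleftrightarrow> f \<in> borel \<rightarrow>\<^sub>M N"
  using measurable_cong_sets[OF sets_kern refl] by blast

lemma norm_core_le: "0 \<le> r \<Longrightarrow> norm (core r y v) \<le> r"
  by (simp add: core_def)

lemma integrable_core: "0 \<le> r \<Longrightarrow> integrable (kern y) (core r y)"
proof -
  assume r: "0 \<le> r"
  interpret prob_space "kern y" by (rule prob_space_kern)
  show ?thesis
    by (rule integrable_const_bound[where B=r]) (use norm_core_le[OF r] in \<open>auto simp: measurable_kern_iff measurable_core_right\<close>)
qed

text \<open>What is discarded has norm \<open>t > r\<close>, and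
  \<open>t = t powr q * t powr (1 - q)\<close> with a negative second exponent.\<close>

lemma tail_moment:
  assumes r: "0 < r"
  shows "(\<integral>\<^sup>+ v. ennreal (norm (v - mean y - core r y v)) \<partial>kern y) \<le> ennreal (K * r powr (1 - q))"
proof -
  have "norm (v - mean y - core r y v) \<le> norm (v - mean y) powr q * r powr (1 - q)" for v
  proof (cases "norm (v - mean y) \<le> r")
    case False
    define t where "t = norm (v - mean y)"
    have t: "r < t" using False by (simp add: t_def)
    have "t = t powr q * t powr (1 - q)" using t r by (simp add: powr_add[symmetric])
    also have "\<dots> \<le> t powr q * r powr (1 - q)"
      using t r q by (intro mult_left_mono powr_mono2') auto
    finally show ?thesis using False by (simp add: core_def t_def)
  qed (simp add: core_def)
  then have "(\<integral>\<^sup>+ v. ennreal (norm (v - mean y - core r y v)) \<partial>kern y)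
      \<le> (\<integral>\<^sup>+ v. ennreal (norm (v - mean y) powr q) * ennreal (r powr (1 - q)) \<partial>kern y)"
    by (intro nn_integral_mono) (simp add: ennreal_mult'[symmetric] ennreal_leI)
  also have "\<dots> = (\<integral>\<^sup>+ v. ennreal (norm (v - mean y) powr q) \<partial>kern y) * ennreal (r powr (1 - q))"
    by (intro nn_integral_multc) (simp add: measurable_kern_iff)
  also have "\<dots> \<le> ennreal K * ennreal (r powr (1 - q))"
    using moment[of y] by (intro mult_right_mono) (auto simp: mean_def)
  finally show ?thesis using K by (simp add: ennreal_mult)
qed

text \<open>What is kept has norm \<open>t \<le> r\<close>, and
  \<open>t\<^sup>2 = t powr q * t powr (2 - q)\<close> with a nonnegative second exponent.\<close>

lemma core_second_moment:
  assumes r: "0 < r"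
  shows "(\<integral>\<^sup>+ v. ennreal ((norm (core r y v))\<^sup>2) \<partial>kern y) \<le> ennreal (K * r powr (2 - q))"
proof -
  have "(norm (core r y v))\<^sup>2 \<le> norm (v - mean y) powr q * r powr (2 - q)" for v
  proof (cases "norm (v - mean y) \<le> r \<and> v \<noteq> mean y")
    case True
    define t where "t = norm (v - mean y)"
    have t: "0 < t" "t \<le> r" using True by (auto simp: t_def)
    have "t\<^sup>2 = t powr q * t powr (2 - q)" using t by (simp add: powr_add[symmetric] powr_numeral)
    also have "\<dots> \<le> t powr q * r powr (2 - q)"
      using t q by (intro mult_left_mono powr_mono2) auto
    finally show ?thesis using True by (simp add: core_def t_def)
  qed (auto simp: core_def)
  then have "(\<integral>\<^sup>+ v. ennreal ((norm (core r y v))\<^sup>2) \<partial>kern y)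
      \<le> (\<integral>\<^sup>+ v. ennreal (norm (v - mean y) powr q) * ennreal (r powr (2 - q)) \<partial>kern y)"
    by (intro nn_integral_mono) (simp add: ennreal_mult'[symmetric] ennreal_leI)
  also have "\<dots> = (\<integral>\<^sup>+ v. ennreal (norm (v - mean y) powr q) \<partial>kern y) * ennreal (r powr (2 - q))"
    by (intro nn_integral_multc) (simp add: measurable_kern_iff)
  also have "\<dots> \<le> ennreal K * ennreal (r powr (2 - q))"
    using moment[of y] by (intro mult_right_mono) (auto simp: mean_def)
  finally show ?thesis using K by (simp add: ennreal_mult)
qed

text \<open>\<open>v - mean y\<close> has mean zero, so the bias is minus the mean of the discarded tail.\<close>

lemma norm_bias_le:
  assumes r: "0 < r"
  shows "norm (bias r y) \<le> K * r powr (1 - q)" "norm (bias r y) \<le> r"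
proof -
  interpret prob_space "kern y" by (rule prob_space_kern)
  have int: "integrable (kern y) (\<lambda>v. v - mean y - core r y v)"
    using r by (intro Bochner_Integration.integrable_diff integrable_kern integrable_core) auto
  have "(\<integral>v. v - mean y - core r y v \<partial>kern y) = mean y - mean y - bias r y"
    using r integrable_kern integrable_core[of r y]
    by (simp add: mean_def[symmetric] bias_def[symmetric] prob_space)
  then have "norm (bias r y) = norm (\<integral>v. v - mean y - core r y v \<partial>kern y)" by simp
  also have "ennreal \<dots> \<le> (\<integral>\<^sup>+ v. ennreal (norm (v - mean y - core r y v)) \<partial>kern y)"
    by (rule integral_norm_bound_ennreal[OF int])
  also have "\<dots> \<le> ennreal (K * r powr (1 - q))" by (rule tail_moment[OF r])
  finally show "norm (bias r y) \<le> K * r powr (1 - q)" using K by simp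
  have "norm (bias r y) \<le> (\<integral>v. norm (core r y v) \<partial>kern y)" unfolding bias_def by (rule integral_norm_bound)
  also have "\<dots> \<le> (\<integral>v. r \<partial>kern y)"
    using r integrable_core[of r y] norm_core_le[of r y] by (intro integral_mono) auto
  finally show "norm (bias r y) \<le> r" by (simp add: prob_space)
qed

text \<open>Each innovation splits into the centered truncation \<open>\<xi>\<close>, the bias and
  the discarded tail. Kolmogorov's inequality for \<open>\<xi>\<close> contributes
  \<open>4 / a\<^sup>2\<close>, the \<open>4\<close> being that of \<open>V\<close>; Markov's
  inequality for bias and tail, each of mean size at most \<open>c\<close>, contributes
  \<open>2 / a\<close>.\<close>

lemma noise_tail:
  assumes r: "0 < r" and a: "0 < a"
  shows "measure (P x) {\<omega> \<in> space M. \<exists>k\<le>n. 2 * a * r < norm (\<Sum>j<k. Phi (Suc j) \<omega> - mean (Phi j \<omega>))}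
    \<le> real n * (K * r powr (- q)) * (4 / a\<^sup>2 + 2 / a)"
proof -
  interpret prob_space "P x" by (rule prob)
  let ?F = "\<lambda>k. natural_filtration (P x) Phi k"
  define \<xi> where "\<xi> j \<omega> = core r (Phi j \<omega>) (Phi (Suc j) \<omega>) - bias r (Phi j \<omega>)" for j \<omega>
  define R where "R j \<omega> = norm (Phi (Suc j) \<omega> - mean (Phi j \<omega>) - core r (Phi j \<omega>) (Phi (Suc j) \<omega>))" for j \<omega>
  define c where "c = K * r powr (1 - q)"
  define V where "V = 4 * (K * r powr (2 - q))"
  have c0: "0 \<le> c" using K by (simp add: c_def)
  have core_meas: "(\<lambda>\<omega>. core r (Phi j \<omega>) (Phi i \<omega>)) \<in> borel_measurable N"
    if "Phi j \<in> borel_measurable N" "Phi i \<in> borel_measurable N" for i j and N :: "'w measure"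
    using measurable_compose[OF measurable_Pair[OF that] measurable_core] by simp
  have xi_meas: "\<xi> j \<in> borel_measurable N"
    if "Phi j \<in> borel_measurable N" "Phi (Suc j) \<in> borel_measurable N" for j and N :: "'w measure"
    unfolding \<xi>_def using that
    by (intro borel_measurable_diff core_meas measurable_compose[OF _ measurable_bias])
  have [measurable]: "\<xi> j \<in> borel_measurable (P x)" for j
    by (intro xi_meas Phi_measurable)
  have [measurable]: "R j \<in> borel_measurable (P x)" for j
    unfolding R_def by (rule measurable_compose[OF _ borel_measurable_norm]) (intro borel_measurable_diff core_meas Phi_measurable
        measurable_compose[OF Phi_measurable measurable_mean])
  have diff_bound: "norm (core r y v - bias r y) \<le> 2 * r" for y v
  proof -
    have "norm (core r y v - bias r y) \<le> norm (core r y v) + norm (bias r y)" by (rule norm_triangle_ineq4)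
    also have "\<dots> \<le> r + r" by (intro add_mono norm_core_le norm_bias_le(2) r less_imp_le[OF r])
    finally show ?thesis by simp
  qed
  have xi_bound: "norm (\<xi> j \<omega>) \<le> 2 * r" for j \<omega>
    unfolding \<xi>_def by (rule diff_bound)
  have xi_second: "expectation (\<lambda>\<omega>. (norm (\<xi> j \<omega>))\<^sup>2) \<le> V" for j
  proof -
    define U where "U \<omega> = (norm (core r (Phi j \<omega>) (Phi (Suc j) \<omega>)))\<^sup>2" for \<omega>
    define D where "D = K * r powr (2 - q)"
    have D0: "0 \<le> D" using K by (simp add: D_def)
    have U_meas: "U \<in> borel_measurable (P x)"
      unfolding U_def by (intro borel_measurable_power measurable_compose[OF core_meas borel_measurable_norm] Phi_measurable)
    have U_int: "integrable (P x) U"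
      by (rule integrable_const_bound[where B="r\<^sup>2", OF _ U_meas])
        (use norm_core_le r in \<open>auto simp: U_def intro!: power_mono\<close>)
    have "(\<integral>\<^sup>+\<omega>. ennreal (U \<omega>) \<partial>P x)
        = (\<integral>\<^sup>+\<omega>. \<integral>\<^sup>+v. ennreal ((norm (core r (Phi j \<omega>) v))\<^sup>2) \<partial>kern (Phi j \<omega>) \<partial>P x)"
      using nn_integral_step[where g="\<lambda>z. ennreal ((norm ((\<lambda>(y, v). core r y v) z))\<^sup>2)" and x=x and k=j]
      by (simp add: U_def)
    also have "\<dots> \<le> (\<integral>\<^sup>+\<omega>. ennreal D \<partial>P x)"
      unfolding D_def by (intro nn_integral_mono core_second_moment r)
    also have "\<dots> = ennreal D" by (simp add: emeasure_space_1)
    finally have U_exp: "expectation U \<le> D" by (intro integral_real_bounded D0)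
    have le: "(norm (\<xi> j \<omega>))\<^sup>2 \<le> 2 * U \<omega> + 2 * D" for \<omega>
    proof -
      let ?u = "core r (Phi j \<omega>) (Phi (Suc j) \<omega>)" and ?b = "bias r (Phi j \<omega>)"
      have "(norm (\<xi> j \<omega>))\<^sup>2 \<le> (norm ?u + norm ?b)\<^sup>2"
        unfolding \<xi>_def by (intro power_mono norm_triangle_ineq4) auto
      also have "\<dots> \<le> 2 * (norm ?u)\<^sup>2 + 2 * (norm ?b)\<^sup>2"
        using zero_le_power2[of "norm ?u - norm ?b"] by (simp add: power2_eq_square algebra_simps)
      \<comment> \<open>One factor is bounded by \<open>r\<close>, the other by the tail estimate,
        so that the squared bias obeys the same bound \<open>D\<close> as the second moment of the
        core.\<close>
      also have "(norm ?b)\<^sup>2 \<le> r * (K * r powr (1 - q))"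
        unfolding power2_eq_square using norm_bias_le[OF r] r by (intro mult_mono) auto
      also have "\<dots> = K * (r powr 1 * r powr (1 - q))" using r by simp
      also have "\<dots> = D" unfolding D_def by (simp only: powr_add[symmetric]) simp
      finally show ?thesis by (simp add: U_def)
    qed
    have "integrable (P x) (\<lambda>\<omega>. (norm (\<xi> j \<omega>))\<^sup>2)"
    proof (rule integrable_const_bound[where B="(2 * r)\<^sup>2"])
      have "(norm (\<xi> j \<omega>))\<^sup>2 \<le> (2 * r)\<^sup>2" for \<omega> by (intro power_mono xi_bound) auto
      then show "AE \<omega> in P x. norm ((norm (\<xi> j \<omega>))\<^sup>2) \<le> (2 * r)\<^sup>2" by simp
    qed measurable
    then have "expectation (\<lambda>\<omega>. (norm (\<xi> j \<omega>))\<^sup>2) \<le> expectation (\<lambda>\<omega>. 2 * U \<omega> + 2 * D)"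
      using le U_int by (intro integral_mono) auto
    also have "\<dots> = 2 * expectation U + 2 * D" using U_int by (simp add: prob_space)
    finally show ?thesis using U_exp by (simp add: V_def D_def)
  qed
  have R_nn: "(\<integral>\<^sup>+\<omega>. ennreal (R j \<omega>) \<partial>P x) \<le> ennreal c" for j
  proof -
    have "(\<integral>\<^sup>+\<omega>. ennreal (R j \<omega>) \<partial>P x) =
        (\<integral>\<^sup>+\<omega>. \<integral>\<^sup>+v. ennreal (norm (v - mean (Phi j \<omega>) - core r (Phi j \<omega>) v)) \<partial>kern (Phi j \<omega>) \<partial>P x)"
      using nn_integral_step[where g="\<lambda>z. ennreal (norm (snd z - mean (fst z) - (\<lambda>(y, v). core r y v) z))" and x=x and k=j]
      by (simp add: R_def)
    also have "\<dots> \<le> (\<integral>\<^sup>+\<omega>. ennreal c \<partial>P x)"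
      unfolding c_def by (intro nn_integral_mono tail_moment r)
    finally show ?thesis by (simp add: emeasure_space_1)
  qed
  have R_int: "integrable (P x) (R j)" for j
  proof (rule integrableI_bounded)
    have "(\<integral>\<^sup>+\<omega>. ennreal (norm (R j \<omega>)) \<partial>P x) = (\<integral>\<^sup>+\<omega>. ennreal (R j \<omega>) \<partial>P x)" by (simp add: R_def)
    also have "\<dots> < \<infinity>" by (rule le_less_trans[OF R_nn]) simp
    finally show "(\<integral>\<^sup>+\<omega>. ennreal (norm (R j \<omega>)) \<partial>P x) < \<infinity>" .
  qed measurable
  have R_exp: "expectation (R j) \<le> c" for j
    by (rule integral_real_bounded[OF c0 R_nn])
  \<comment> \<open>All summands are nonnegative, so \<open>Y\<close> dominates the bias and tail
    sums for every \<open>k \<le> n\<close> at once, and no maximal inequality is called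
    for.\<close>
  define Y where "Y \<omega> = (\<Sum>j<n. c + R j \<omega>)" for \<omega>
  have Y_exp: "expectation Y \<le> 2 * real n * c"
  proof -
    have "expectation Y = (\<Sum>j<n. c + expectation (R j))"
      unfolding Y_def using R_int by (simp add: prob_space)
    also have "\<dots> \<le> (\<Sum>j<n. c + c)" using R_exp by (intro sum_mono) auto
    finally show ?thesis by simp
  qed
  let ?A = "{\<omega> \<in> space (P x). \<exists>k\<le>n. a * r < norm (\<Sum>j<k. \<xi> j \<omega>)}"
  let ?B = "{\<omega> \<in> space (P x). a * r \<le> Y \<omega>}"
  have A_meas: "?A \<in> sets (P x)" by measurable
  have B_meas: "?B \<in> sets (P x)" unfolding Y_def by measurable
  have "{\<omega> \<in> space M. \<exists>k\<le>n. 2 * a * r < norm (\<Sum>j<k. Phi (Suc j) \<omega> - mean (Phi j \<omega>))} \<subseteq> ?A \<union> ?B"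
  proof
    fix \<omega> assume "\<omega> \<in> {\<omega> \<in> space M. \<exists>k\<le>n. 2 * a * r < norm (\<Sum>j<k. Phi (Suc j) \<omega> - mean (Phi j \<omega>))}"
    then obtain k where \<omega>: "\<omega> \<in> space (P x)" and k: "k \<le> n"
      "2 * a * r < norm (\<Sum>j<k. Phi (Suc j) \<omega> - mean (Phi j \<omega>))" by (auto simp: space_P)
    let ?t = "\<lambda>j. bias r (Phi j \<omega>) + (Phi (Suc j) \<omega> - mean (Phi j \<omega>) - core r (Phi j \<omega>) (Phi (Suc j) \<omega>))"
    have "norm (\<Sum>j<k. ?t j) \<le> (\<Sum>j<k. c + R j \<omega>)"
    proof (rule sum_norm_le)
      fix j
      show "norm (?t j) \<le> c + R j \<omega>"
        using norm_bias_le(1)[OF r, of "Phi j \<omega>"]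
        unfolding R_def c_def by (intro order_trans[OF norm_triangle_ineq] add_mono) auto
    qed
    also have "\<dots> \<le> Y \<omega>"
      unfolding Y_def using k c0 by (intro sum_mono2) (auto simp: R_def)
    finally have "norm (\<Sum>j<k. ?t j) \<le> Y \<omega>" .
    moreover have "(\<Sum>j<k. Phi (Suc j) \<omega> - mean (Phi j \<omega>)) = (\<Sum>j<k. \<xi> j \<omega>) + (\<Sum>j<k. ?t j)"
      unfolding sum.distrib[symmetric] by (intro sum.cong) (auto simp: \<xi>_def)
    ultimately have "2 * a * r < norm (\<Sum>j<k. \<xi> j \<omega>) + Y \<omega>"
      using k(2) norm_triangle_ineq[of "\<Sum>j<k. \<xi> j \<omega>" "\<Sum>j<k. ?t j"] by simp
    then have "a * r < norm (\<Sum>j<k. \<xi> j \<omega>) \<or> a * r \<le> Y \<omega>" by linarith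
    then show "\<omega> \<in> ?A \<union> ?B" using \<omega> k(1) by blast
  qed
  then have "prob {\<omega> \<in> space M. \<exists>k\<le>n. 2 * a * r < norm (\<Sum>j<k. Phi (Suc j) \<omega> - mean (Phi j \<omega>))} \<le> prob (?A \<union> ?B)"
    using A_meas B_meas by (intro finite_measure_mono) auto
  also have "\<dots> \<le> prob ?A + prob ?B" by (rule measure_Un_le[OF A_meas B_meas])
  also have "prob ?A \<le> real n * V / (a * r)\<^sup>2"
  proof (rule kolmogorov_maximal_inequality)
    show "subalgebra (P x) (?F k)" for k by (rule subalgebra_natural_filtration)
    show "\<xi> j \<in> borel_measurable (?F k)" if "j < k" for j k
      using that by (intro xi_meas measurable_natural_filtration) auto
    show "norm (\<xi> j \<omega>) \<le> 2 * r" for j \<omega> by (rule xi_bound)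
    show "expectation (\<lambda>\<omega>. (norm (\<xi> j \<omega>))\<^sup>2) \<le> V" for j by (rule xi_second)
    show "expectation (\<lambda>\<omega>. \<xi> k \<omega> \<bullet> W \<omega>) = 0"
      if W: "W \<in> borel_measurable (?F k)" "\<And>\<omega>. norm (W \<omega>) \<le> w" for k W w
    proof -
      define g where "g z = (core r (Phi k (fst z)) (snd z) - bias r (Phi k (fst z))) \<bullet> W (fst z)" for z
      have Phik: "(\<lambda>z. Phi k (fst z)) \<in> borel_measurable (?F k \<Otimes>\<^sub>M borel)"
        by (rule measurable_compose[OF measurable_fst measurable_natural_filtration]) simp
      have "(\<integral>\<omega>. g (\<omega>, Phi (Suc k) \<omega>) \<partial>P x) = 0"
      proof (rule integral_markov_eq_0)
        have "(\<lambda>z. core r (Phi k (fst z)) (snd z)) \<in> borel_measurable (?F k \<Otimes>\<^sub>M borel)"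
          using measurable_compose[OF measurable_Pair[OF Phik measurable_snd] measurable_core] by simp
        then show "g \<in> borel_measurable (?F k \<Otimes>\<^sub>M borel)"
          unfolding g_def
          by (intro borel_measurable_inner borel_measurable_diff measurable_compose[OF Phik measurable_bias]
              measurable_compose[OF measurable_fst W(1)])
        show "\<bar>g z\<bar> \<le> (2 * r) * w" for z
        proof -
          have "norm (core r (Phi k (fst z)) (snd z) - bias r (Phi k (fst z))) * norm (W (fst z)) \<le> (2 * r) * w"
            using W(2) r by (intro mult_mono diff_bound) auto
          then show ?thesis unfolding g_def by (rule order_trans[OF Cauchy_Schwarz_ineq2])
        qed
        \<comment> \<open>For fixed \<open>\<omega>\<close> the weight \<open>W \<omega>\<close> is
          a constant vector, and the core minus its mean integrates to zero.\<close>
        show "(\<integral>v. g (\<omega>, v) \<partial>kern (Phi k \<omega>)) = 0" for \<omega>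
        proof -
          interpret K: prob_space "kern (Phi k \<omega>)" by (rule prob_space_kern)
          have i: "integrable (kern (Phi k \<omega>)) (core r (Phi k \<omega>))" using r by (intro integrable_core) simp
          then have "(\<integral>v. core r (Phi k \<omega>) v - bias r (Phi k \<omega>) \<partial>kern (Phi k \<omega>)) = 0"
            by (simp add: K.prob_space bias_def[symmetric])
          then show ?thesis unfolding g_def using i by (simp add: integral_inner_left)
        qed
      qed
      then show ?thesis by (simp add: g_def \<xi>_def)
    qed
    show "0 < a * r" using a r by simp
  qed
  also have "prob ?B \<le> expectation Y / (a * r)"
  proof (rule integral_Markov_inequality_measure[where A="space (P x)"])
    show "integrable (P x) Y" unfolding Y_def using R_int by (intro Bochner_Integration.integrable_sum) auto
    have "0 \<le> Y \<omega>" for \<omega> unfolding Y_def using c0 by (intro sum_nonneg) (auto simp: R_def)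
    then show "AE \<omega> in P x. 0 \<le> Y \<omega>" by simp
  qed (use a r in auto)
  also have "\<dots> \<le> 2 * real n * c / (a * r)" using a r Y_exp by (intro divide_right_mono) auto
  also have "real n * V / (a * r)\<^sup>2 + 2 * real n * c / (a * r) = real n * (K * r powr (- q)) * (4 / a\<^sup>2 + 2 / a)"
  proof -
    have "r powr (2 - q) / r\<^sup>2 = r powr (- q)"
      using r powr_diff[of r "2 - q" 2] by (simp add: powr_numeral)
    moreover have "real n * V / (a * r)\<^sup>2 = real n * (K * (r powr (2 - q) / r\<^sup>2)) * (4 / a\<^sup>2)"
      by (simp add: V_def power_mult_distrib mult.commute mult.left_commute)
    moreover have "r powr (1 - q) / r = r powr (- q)"
      using r powr_diff[of r "1 - q" 1] by simp
    moreover have "2 * real n * c / (a * r) = real n * (K * (r powr (1 - q) / r)) * (2 / a)"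
      by (simp add: c_def mult.commute mult.left_commute)
    ultimately show ?thesis by (simp add: distrib_left)
  qed
  finally show ?thesis by simp
qed

end

section \<open>The innovation condition as a moment bound on the kernel\<close>

context markov_chain
begin

text \<open>Almost surely \<open>Phi 0\<close> equals \<open>y\<close>, so generating events are
  null or full, and complements and countable unions preserve this. Conditioning on time
  \<open>0\<close> thus amounts to taking expectations, which makes the first innovation
  explicit.\<close>

lemma initial_sigma_algebra_trivial:
  assumes "A \<in> sets (natural_filtration (P y) Phi 0)"
  shows "(AE \<omega> in P y. \<omega> \<in> A) \<or> (AE \<omega> in P y. \<omega> \<notin> A)"
  using assms unfolding sets_natural_filtration
proof (induction A rule: sigma_sets.induct)
  case (Basic A)
  then obtain B where A: "A = Phi 0 -` B \<inter> space (P y)" by (auto simp: space_P)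
  show ?case
  proof (cases "y \<in> B")
    case True
    have "AE \<omega> in P y. \<omega> \<in> A"
      using start[of y] AE_space[of "P y"] unfolding A by eventually_elim (use True in auto)
    then show ?thesis by simp
  next
    case False
    have "AE \<omega> in P y. \<omega> \<notin> A"
      using start[of y] AE_space[of "P y"] unfolding A by eventually_elim (use False in auto)
    then show ?thesis by simp
  qed
next
  case (Compl A)
  from Compl.IH show ?case
  proof
    assume "AE \<omega> in P y. \<omega> \<in> A"
    then have "AE \<omega> in P y. \<omega> \<notin> space M - A" by eventually_elim auto
    then show ?case by simp
  next
    assume "AE \<omega> in P y. \<omega> \<notin> A"
    then have "AE \<omega> in P y. \<omega> \<in> space M - A"
      using AE_space[of "P y"] by eventually_elim (auto simp: space_P)
    then show ?case by simp
  qed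
next
  case (Union A)
  show ?case
  proof (cases "\<exists>i. AE \<omega> in P y. \<omega> \<in> A i")
    case True
    then obtain i where "AE \<omega> in P y. \<omega> \<in> A i" by blast
    then have "AE \<omega> in P y. \<omega> \<in> (\<Union>i. A i)" by eventually_elim auto
    then show ?thesis by simp
  next
    case False
    then have "AE \<omega> in P y. \<forall>i. \<omega> \<notin> A i" using Union.IH by (simp add: AE_all_countable)
    then have "AE \<omega> in P y. \<omega> \<notin> (\<Union>i. A i)" by eventually_elim auto
    then show ?thesis by simp
  qed
qed simp

lemma real_cond_exp_initial:
  assumes f: "integrable (P y) f"
  shows "AE \<omega> in P y. real_cond_exp (P y) (natural_filtration (P y) Phi 0) f \<omega> = (\<integral>\<omega>. f \<omega> \<partial>P y)"
proof -
  interpret prob_space "P y" by (rule prob)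
  interpret sigma_finite_subalgebra "P y" "natural_filtration (P y) Phi 0"
    by (rule sigma_finite_subalgebra_natural_filtration)
  show ?thesis
  proof (rule real_cond_exp_charact)
    fix A assume A: "A \<in> sets (natural_filtration (P y) Phi 0)"
    then have [measurable]: "A \<in> sets (P y)" using subalgebra_natural_filtration by (auto simp: subalgebra_def)
    have [measurable]: "f \<in> borel_measurable (P y)" using f by simp
    from initial_sigma_algebra_trivial[OF A]
    show "set_lebesgue_integral (P y) A f = set_lebesgue_integral (P y) A (\<lambda>_. \<integral>\<omega>. f \<omega> \<partial>P y)"
      unfolding set_lebesgue_integral_def
    proof
      assume "AE \<omega> in P y. \<omega> \<in> A"
      then have ind: "AE \<omega> in P y. indicator A \<omega> = (1::real)" by eventually_elim simp
      have "(\<integral>\<omega>. indicator A \<omega> *\<^sub>R f \<omega> \<partial>P y) = (\<integral>\<omega>. f \<omega> \<partial>P y)"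
        by (rule integral_cong_AE) (use ind in auto)
      moreover have "(\<integral>\<omega>. indicator A \<omega> *\<^sub>R (\<integral>\<omega>. f \<omega> \<partial>P y) \<partial>P y) = (\<integral>\<omega>. (\<integral>\<omega>. f \<omega> \<partial>P y) \<partial>P y)"
        by (rule integral_cong_AE) (use ind in auto)
      ultimately show "(\<integral>\<omega>. indicator A \<omega> *\<^sub>R f \<omega> \<partial>P y) = (\<integral>\<omega>. indicator A \<omega> *\<^sub>R (\<integral>\<omega>. f \<omega> \<partial>P y) \<partial>P y)"
        by (simp add: prob_space)
    next
      assume "AE \<omega> in P y. \<omega> \<notin> A"
      then have ind: "AE \<omega> in P y. indicator A \<omega> = (0::real)" by eventually_elim simp
      show "(\<integral>\<omega>. indicator A \<omega> *\<^sub>R f \<omega> \<partial>P y) = (\<integral>\<omega>. indicator A \<omega> *\<^sub>R (\<integral>\<omega>. f \<omega> \<partial>P y) \<partial>P y)"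
        by (rule integral_cong_AE) (use ind in auto)
    qed
  qed (use f in auto)
qed

lemma innovation_1:
  assumes "integrable (P y) (Phi 1)"
  shows "AE \<omega> in P y. innovation (P y) Phi 1 \<omega> = Phi 1 \<omega> - (\<integral>\<omega>. Phi 1 \<omega> \<partial>P y)"
proof -
  have "AE \<omega> in P y. \<forall>b\<in>Basis. real_cond_exp (P y) (natural_filtration (P y) Phi 0) (\<lambda>\<omega>. Phi 1 \<omega> \<bullet> b) \<omega>
      = (\<integral>\<omega>. Phi 1 \<omega> \<partial>P y) \<bullet> b"
  proof (subst AE_ball_countable, intro countable_finite finite_Basis, intro ballI)
    fix b :: 'a
    have "(\<integral>\<omega>. Phi 1 \<omega> \<bullet> b \<partial>P y) = (\<integral>\<omega>. Phi 1 \<omega> \<partial>P y) \<bullet> b"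
      using assms by (rule integral_inner_left)
    then show "AE \<omega> in P y. real_cond_exp (P y) (natural_filtration (P y) Phi 0) (\<lambda>\<omega>. Phi 1 \<omega> \<bullet> b) \<omega>
      = (\<integral>\<omega>. Phi 1 \<omega> \<partial>P y) \<bullet> b"
      using real_cond_exp_initial[of y "\<lambda>\<omega>. Phi 1 \<omega> \<bullet> b"] assms by simp
  qed
  then show ?thesis
    by eventually_elim (simp add: innovation_def vec_cond_exp_def euclidean_representation)
qed

lemma integral_kern_drift:
  assumes "integrable (P y) (Phi 1)"
  shows "integrable (kern y) (\<lambda>v. v)" "(\<integral>v. v \<partial>kern y) = y + drift P Phi y"
  using assms unfolding distr_Phi_1[symmetric] drift_def
  by (simp_all add: integrable_distr_eq integral_distr del: One_nat_def)

text \<open>Fix a level \<open>K \<ge> 1\<close> beyond which all tail integrals are below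
  \<open>1\<close>. Values below \<open>K\<close> contribute at most \<open>K powr q\<close>; above
  it, \<open>t \<ge> 1\<close> gives \<open>t powr q \<le> t powr p\<close>.\<close>

lemma uniform_moment_bound:
  fixes p :: real
  assumes int: "\<And>y. integrable (P y) (Phi 1)" and q: "0 < q" "q \<le> p"
    and B1: "((\<lambda>K::real. SUP y. \<integral>\<^sup>+ \<omega>. ennreal (norm (innovation (P y) Phi 1 \<omega>) powr p
            * indicator {\<omega>. K \<le> norm (innovation (P y) Phi 1 \<omega>)} \<omega>) \<partial>P y) \<longlongrightarrow> 0) at_top"
  shows "\<exists>C\<ge>0. \<forall>y. (\<integral>\<^sup>+ v. ennreal (norm (v - (\<integral>u. u \<partial>kern y)) powr q) \<partial>kern y) \<le> ennreal C"
proof -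
  have "\<forall>\<^sub>F K in at_top. 1 \<le> (K::real) \<and> (SUP y. \<integral>\<^sup>+ \<omega>. ennreal (norm (innovation (P y) Phi 1 \<omega>) powr p
            * indicator {\<omega>. K \<le> norm (innovation (P y) Phi 1 \<omega>)} \<omega>) \<partial>P y) < 1"
    by (intro eventually_conj eventually_ge_at_top order_tendstoD(2)[OF B1]) simp
  then obtain K :: real where K: "1 \<le> K" "(SUP y. \<integral>\<^sup>+ \<omega>. ennreal (norm (innovation (P y) Phi 1 \<omega>) powr p
            * indicator {\<omega>. K \<le> norm (innovation (P y) Phi 1 \<omega>)} \<omega>) \<partial>P y) < 1"
    unfolding eventually_at_top_linorder by blast
  have "(\<integral>\<^sup>+ v. ennreal (norm (v - (\<integral>u. u \<partial>kern y)) powr q) \<partial>kern y) \<le> ennreal (K powr q + 1)" for y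
  proof -
    interpret prob_space "P y" by (rule prob)
    define m where "m = (\<integral>u. u \<partial>kern y)"
    define f where "f \<omega> = norm (Phi 1 \<omega> - m)" for \<omega>
    have [measurable]: "f \<in> borel_measurable (P y)" unfolding f_def by measurable
    have m: "m = (\<integral>\<omega>. Phi 1 \<omega> \<partial>P y)"
      unfolding m_def distr_Phi_1[symmetric] by (rule integral_distr) simp_all
    have "(\<integral>\<^sup>+ v. ennreal (norm (v - m) powr q) \<partial>kern y) = (\<integral>\<^sup>+ \<omega>. ennreal (f \<omega> powr q) \<partial>P y)"
      unfolding distr_Phi_1[symmetric] f_def by (rule nn_integral_distr) simp_all
    also have "\<dots> \<le> (\<integral>\<^sup>+ \<omega>. ennreal (K powr q) + ennreal (f \<omega> powr p * indicator {K..} (f \<omega>)) \<partial>P y)"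
    proof (rule nn_integral_mono)
      fix \<omega>
      have "f \<omega> powr q \<le> K powr q + f \<omega> powr p * indicator {K..} (f \<omega>)"
      proof (cases "K \<le> f \<omega>")
        case True
        then have "f \<omega> powr q \<le> f \<omega> powr p" using K q by (intro powr_mono) auto
        then show ?thesis using True by (simp add: add_increasing)
      next
        case False
        then have "f \<omega> powr q \<le> K powr q" using q by (intro powr_mono2) (auto simp: f_def)
        then show ?thesis using False by simp
      qed
      then show "ennreal (f \<omega> powr q) \<le> ennreal (K powr q) + ennreal (f \<omega> powr p * indicator {K..} (f \<omega>))"
        by (simp add: ennreal_plus[symmetric] ennreal_leI del: ennreal_plus)
    qed
    also have "\<dots> = ennreal (K powr q) + (\<integral>\<^sup>+ \<omega>. ennreal (f \<omega> powr p * indicator {K..} (f \<omega>)) \<partial>P y)"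
      by (subst nn_integral_add) (simp_all add: emeasure_space_1)
    also have "(\<integral>\<^sup>+ \<omega>. ennreal (f \<omega> powr p * indicator {K..} (f \<omega>)) \<partial>P y) =
        (\<integral>\<^sup>+ \<omega>. ennreal (norm (innovation (P y) Phi 1 \<omega>) powr p
            * indicator {\<omega>. K \<le> norm (innovation (P y) Phi 1 \<omega>)} \<omega>) \<partial>P y)"
    proof (rule nn_integral_cong_AE)
      show "AE \<omega> in P y. ennreal (f \<omega> powr p * indicator {K..} (f \<omega>)) =
        ennreal (norm (innovation (P y) Phi 1 \<omega>) powr p * indicator {\<omega>. K \<le> norm (innovation (P y) Phi 1 \<omega>)} \<omega>)"
        using innovation_1[OF int[of y]] by eventually_elim (simp add: f_def m indicator_def)
    qed
    also have "\<dots> \<le> (SUP y. \<integral>\<^sup>+ \<omega>. ennreal (norm (innovation (P y) Phi 1 \<omega>) powr p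
            * indicator {\<omega>. K \<le> norm (innovation (P y) Phi 1 \<omega>)} \<omega>) \<partial>P y)"
      by (rule SUP_upper) simp
    also have "\<dots> \<le> 1" using K(2) by (rule less_imp_le)
    finally show ?thesis by (simp add: m_def)
  qed
  then show ?thesis by (intro exI[of _ "K powr q + 1"]) auto
qed

lemma measurable_scaled_path:
  assumes "0 < r"
  shows "scaled_path \<beta> Phi r \<in> P y \<rightarrow>\<^sub>M borel_of_topology (skorokhod {0..})"
proof -
  have "scaled_path \<beta> Phi r = (\<lambda>\<omega>. step_path {0..} (r powr (1 + \<beta>)) (\<lambda>k. (1 / r) *\<^sub>R Phi k \<omega>))"
    by (rule ext) (simp add: scaled_path_def step_path_def)
  also have "\<dots> \<in> P y \<rightarrow>\<^sub>M borel_of_topology (skorokhod {0..})"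
    by (intro measurable_compose[OF _ measurable_step_path] measurable_coordinatewise_then_product)
      (use assms in auto)
  finally show ?thesis .
qed

end

section \<open>Expected deviation and the Dirac limit\<close>

text \<open>Off the event \<open>Bad\<close> of large noise the tracking hypothesis bounds the
  deviation by \<open>\<epsilon>\<close>; on \<open>Bad\<close> the universal bound
  \<open>T + 1\<close> remains, weighted by a small probability.\<close>

lemma (in moment_chain) path_deviation_bound:
  fixes \<mu> :: "real \<Rightarrow> 'a"
  assumes \<mu>: "continuous_on {0..T} \<mu>" and T: "0 < T" and r: "0 < r" and \<delta>: "0 < \<delta>" and \<epsilon>: "0 \<le> \<epsilon>"
    and start_close: "norm (x' - x) \<le> \<delta>"
    and close: "\<And>\<phi>. norm ((1 / r) *\<^sub>R \<phi> 0 - x) \<le> \<delta> \<Longrightarrow>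
      (\<forall>k. real k \<le> T * r powr (1 + \<beta>) \<longrightarrow>
        norm (\<Sum>j<k. \<phi> (Suc j) - mean (\<phi> j)) \<le> \<delta> * r) \<Longrightarrow>
      (\<forall>t\<in>{0..T}. norm ((1 / r) *\<^sub>R \<phi> (nat \<lfloor>t * r powr (1 + \<beta>)\<rfloor>) - \<mu> t) \<le> \<epsilon>)"
  shows "(\<integral>f. path_deviation \<mu> T f \<partial>scaled_law \<beta> P Phi r x')
    \<le> \<epsilon> + (T + 1) * (T * K * (16 / \<delta>\<^sup>2 + 4 / \<delta>) * r powr (1 + \<beta> - q))"
proof -
  let ?N = "P (r *\<^sub>R x')"
  interpret prob_space ?N by (rule prob)
  define n where "n = nat \<lfloor>T * r powr (1 + \<beta>)\<rfloor>"
  define G where "G \<omega> = path_deviation \<mu> T (scaled_path \<beta> Phi r \<omega>)" for \<omega>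
  define Bad where "Bad = {\<omega> \<in> space M. \<exists>k\<le>n. \<delta> * r < norm (\<Sum>j<k. Phi (Suc j) \<omega> - mean (Phi j \<omega>))}"
  have TR: "0 \<le> T * r powr (1 + \<beta>)" using T by simp
  have dev_meas: "path_deviation \<mu> T \<in> borel_measurable (borel_of_topology (skorokhod {0..}))"
    by (intro borel_measurable_continuous_map continuous_map_path_deviation \<mu> T)
  have path_meas: "scaled_path \<beta> Phi r \<in> ?N \<rightarrow>\<^sub>M borel_of_topology (skorokhod {0..})"
    by (rule measurable_scaled_path[OF r])
  have G_meas: "G \<in> borel_measurable ?N"
    unfolding G_def by (rule measurable_compose[OF path_meas dev_meas])
  have Bad_meas: "Bad \<in> sets ?N"
  proof -
    have [measurable]: "(\<lambda>\<omega>. mean (Phi j \<omega>)) \<in> borel_measurable ?N" for j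
      by (rule measurable_compose[OF Phi_measurable measurable_mean])
    have "Bad = {\<omega> \<in> space ?N. \<exists>k\<in>{..n}. \<delta> * r < norm (\<Sum>j<k. Phi (Suc j) \<omega> - mean (Phi j \<omega>))}"
      by (auto simp: Bad_def space_P)
    also have "\<dots> \<in> sets ?N" by measurable
    finally show ?thesis .
  qed
  have G_le: "G \<omega> \<le> T + 1" "0 \<le> G \<omega>" for \<omega>
    unfolding G_def by (rule path_deviation_bounded[OF T], rule path_deviation_nonneg[OF T])
  have G_good: "AE \<omega> in ?N. G \<omega> \<le> \<epsilon> + (T + 1) * indicator Bad \<omega>"
    using start[of "r *\<^sub>R x'"] AE_space[of ?N]
  proof eventually_elim
    fix \<omega> assume \<omega>: "Phi 0 \<omega> = r *\<^sub>R x'" "\<omega> \<in> space ?N"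
    show "G \<omega> \<le> \<epsilon> + (T + 1) * indicator Bad \<omega>"
    proof (cases "\<omega> \<in> Bad")
      case True
      then show ?thesis using G_le(1)[of \<omega>] \<epsilon> by simp
    next
      case False
      have dev: "\<forall>t\<in>{0..T}. norm ((1 / r) *\<^sub>R Phi (nat \<lfloor>t * r powr (1 + \<beta>)\<rfloor>) \<omega> - \<mu> t) \<le> \<epsilon>"
      proof (rule close)
        show "norm ((1 / r) *\<^sub>R Phi 0 \<omega> - x) \<le> \<delta>" using \<omega>(1) r start_close by simp
        show "\<forall>k. real k \<le> T * r powr (1 + \<beta>) \<longrightarrow> norm (\<Sum>j<k. Phi (Suc j) \<omega> - mean (Phi j \<omega>)) \<le> \<delta> * r"
        proof (intro allI impI)
          fix k assume "real k \<le> T * r powr (1 + \<beta>)"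
          then have "k \<le> n" unfolding n_def by (simp add: le_nat_floor)
          then show "norm (\<Sum>j<k. Phi (Suc j) \<omega> - mean (Phi j \<omega>)) \<le> \<delta> * r"
            using False \<omega>(2) by (auto simp: Bad_def space_P not_less)
        qed
      qed
      have "G \<omega> \<le> \<epsilon>"
        unfolding G_def using dev \<epsilon> by (intro path_deviation_le) (auto simp: scaled_path_def)
      then show ?thesis using False by simp
    qed
  qed
  \<comment> \<open>The threshold in \<open>noise_tail\<close> is \<open>2 * a * r\<close>, hence
    \<open>a = \<delta> / 2\<close>, which produces the constants
    \<open>16 / \<delta>\<^sup>2\<close> and \<open>4 / \<delta>\<close>.\<close>
  have "prob Bad \<le> real n * (K * r powr (- q)) * (4 / (\<delta> / 2)\<^sup>2 + 2 / (\<delta> / 2))"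
    using noise_tail[OF r, of "\<delta> / 2" "r *\<^sub>R x'" n] \<delta> unfolding Bad_def by simp
  also have "\<dots> \<le> (T * r powr (1 + \<beta>)) * (K * r powr (- q)) * (4 / (\<delta> / 2)\<^sup>2 + 2 / (\<delta> / 2))"
    using K \<delta> TR unfolding n_def by (intro mult_right_mono) (auto simp: of_nat_floor)
  also have "\<dots> = T * K * (16 / \<delta>\<^sup>2 + 4 / \<delta>) * (r powr (1 + \<beta>) * r powr (- q))"
    by (simp add: power_divide)
  also have "r powr (1 + \<beta>) * r powr (- q) = r powr (1 + \<beta> - q)" by (simp add: powr_add[symmetric])
  finally have Bad_prob: "prob Bad \<le> T * K * (16 / \<delta>\<^sup>2 + 4 / \<delta>) * r powr (1 + \<beta> - q)" .
  have "(\<integral>f. path_deviation \<mu> T f \<partial>scaled_law \<beta> P Phi r x') = (\<integral>\<omega>. G \<omega> \<partial>?N)"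
    unfolding scaled_law_def G_def by (rule integral_distr[OF path_meas dev_meas])
  also have "\<dots> \<le> (\<integral>\<omega>. \<epsilon> + (T + 1) * indicator Bad \<omega> \<partial>?N)"
  proof (rule integral_mono_AE)
    show "integrable ?N G"
      by (rule integrable_const_bound[where B="T + 1", OF _ G_meas]) (use G_le in auto)
    show "integrable ?N (\<lambda>\<omega>. \<epsilon> + (T + 1) * indicator Bad \<omega>)"
      by (rule integrable_const_bound[where B="\<epsilon> + (T + 1)"]) (use Bad_meas T \<epsilon> in \<open>auto simp: indicator_def\<close>)
  qed (rule G_good)
  also have "\<dots> = \<epsilon> + (T + 1) * prob Bad"
  proof -
    have "integrable ?N (indicator Bad :: 'w \<Rightarrow> real)"
      by (rule integrable_const_bound[where B=1]) (use Bad_meas in \<open>auto simp: indicator_def\<close>)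
    then show ?thesis
      using Bad_meas sets.sets_into_space[OF Bad_meas] by (simp add: prob_space Int_absorb2)
  qed
  also have "\<dots> \<le> \<epsilon> + (T + 1) * (T * K * (16 / \<delta>\<^sup>2 + 4 / \<delta>) * r powr (1 + \<beta> - q))"
    using Bad_prob T by (intro add_left_mono mult_left_mono) auto
  finally show ?thesis .
qed

theorem theorem1p6:
  fixes M :: "'w measure"
    and kern :: "'a::euclidean_space \<Rightarrow> 'a measure"
    and P :: "'a \<Rightarrow> 'w measure"
    and Phi :: "nat \<Rightarrow> 'w \<Rightarrow> 'a"
    and p \<beta> :: real
    and C :: "'a set"
    and \<Delta>inf h :: "'a \<Rightarrow> 'a"
    and Tmax :: "'a \<Rightarrow> real"
    and \<mu> :: "'a \<Rightarrow> real \<Rightarrow> 'a"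
    and x :: 'a
  assumes chain: "markov_chain M kern P Phi"
    and integrable: "\<And>y. integrable (P y) (Phi 1)"
    and B1: "1 < p"
      "((\<lambda>K::real. SUP y. \<integral>\<^sup>+ \<omega>. ennreal (norm (innovation (P y) Phi 1 \<omega>) powr p
            * indicator {\<omega>. K \<le> norm (innovation (P y) Phi 1 \<omega>)} \<omega>) \<partial>P y) \<longlongrightarrow> 0) at_top"
    and B2: "0 \<le> \<beta>" "\<beta> < min 1 (p - 1)"
      "(SUP y. ennreal ((1 + norm y powr \<beta>) * norm (drift P Phi y))) < \<infinity>"
    and B3: "open_cone C" "C \<subseteq> UNIV - {0}" "continuous_on C \<Delta>inf"
      "\<And>H. compact H \<Longrightarrow> H \<subseteq> C \<Longrightarrow>
        ((\<lambda>r::real. SUP y\<in>H. ennreal (norm ((r powr \<beta> * norm y powr \<beta>) *\<^sub>R drift P Phi (r *\<^sub>R y)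
            - \<Delta>inf y))) \<longlongrightarrow> 0) at_top"
    and h: "\<And>y. y \<in> C \<Longrightarrow> h y = norm y powr (- \<beta>) *\<^sub>R \<Delta>inf y"
    and B4: "\<And>y. y \<in> C \<Longrightarrow> 0 < Tmax y \<and> unique_ode_solution C h y (Tmax y) (\<mu> y)"
    and x: "x \<in> C"
  shows "\<exists>T. 0 < T \<and> T \<le> Tmax x \<and> (\<forall>Q. fluid_limit \<beta> P Phi x Q \<longrightarrow> dirac_on T Q (\<mu> x))"
proof -
  interpret markov_chain M kern P Phi by (rule chain)
  define q where "q = min p 2"
  \<comment> \<open>Since \<open>q - 1 = min 1 (p - 1)\<close>, the two bounds on
    \<open>\<beta>\<close> in (B2) together say exactly that the exponent
    \<open>1 + \<beta> - q\<close> is negative.\<close>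
  have q: "1 < q" "q \<le> 2" "q \<le> p" "1 + \<beta> - q < 0" using B1(1) B2(2) by (auto simp: q_def)
  obtain K where K: "0 \<le> K"
      "\<And>y. (\<integral>\<^sup>+ v. ennreal (norm (v - (\<integral>u. u \<partial>kern y)) powr q) \<partial>kern y) \<le> ennreal K"
    using uniform_moment_bound[OF integrable _ q(3) B1(2)] q(1) by auto
  note q_neg = q(4)
  interpret moment_chain M kern P Phi q K
    by unfold_locales (use q K integral_kern_drift(1)[OF integrable] in auto)
  have mean: "mean y = y + drift P Phi y" for y
    unfolding mean_def by (rule integral_kern_drift(2)[OF integrable])
  have C: "open C" "0 \<notin> C" using B3(1,2) by (auto simp: open_cone_def)
  obtain T where T: "0 < T" "T \<le> Tmax x" and close:
    "\<forall>\<epsilon>>0. \<exists>\<delta>>0. \<exists>r0>0. \<forall>r\<ge>r0. \<forall>\<phi>. norm ((1 / r) *\<^sub>R \<phi> 0 - x) \<le> \<delta> \<and>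
      (\<forall>k. real k \<le> T * r powr (1 + \<beta>) \<longrightarrow>
        norm (\<Sum>j<k. \<phi> (Suc j) - \<phi> j - drift P Phi (\<phi> j)) \<le> \<delta> * r) \<longrightarrow>
      (\<forall>t\<in>{0..T}. norm ((1 / r) *\<^sub>R \<phi> (nat \<lfloor>t * r powr (1 + \<beta>)\<rfloor>) - \<mu> x t) \<le> \<epsilon>)"
    by (rule scaled_recursion_close_to_ode[OF B2(1) C B3(3,4) h conjunct1[OF B4[OF x]] conjunct2[OF B4[OF x]] x])
      (assumption | rule that)+
  have "\<forall>t\<in>{0..Tmax x}. (\<mu> x has_vector_derivative h (\<mu> x t)) (at t within {0..Tmax x})"
    using B4[OF x] by (simp add: unique_ode_solution_def ode_solution_def)
  then have "continuous_on {0..Tmax x} (\<mu> x)"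
    unfolding continuous_on_eq_continuous_within by (blast intro: has_vector_derivative_continuous)
  then have \<mu>_cont: "continuous_on {0..T} (\<mu> x)"
    using T(2) by (elim continuous_on_subset) auto
  have "dirac_on (T / 2) Q (\<mu> x)" if fl: "fluid_limit \<beta> P Phi x Q" for Q
  proof -
    obtain r xs where Q: "prob_space Q" "sets Q = sets (borel_of_topology (skorokhod {0..}))"
      and r: "\<forall>n. 0 < r n" "filterlim r at_top sequentially" and xs: "xs \<longlonglongrightarrow> x"
      and conv: "weakly_converges (skorokhod {0..}) (\<lambda>n. scaled_law \<beta> P Phi (r n) (xs n)) Q"
      using fl unfolding fluid_limit_def by (elim conjE exE) (rule that; assumption)
    interpret Q: prob_space Q by (rule Q)
    let ?F = "path_deviation (\<mu> x) T"
    have cont: "continuous_map (skorokhod {0..}) euclideanreal ?F"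
      by (rule continuous_map_path_deviation[OF \<mu>_cont T(1)])
    have F: "0 \<le> ?F f" "?F f \<le> T + 1" for f
      by (rule path_deviation_nonneg[OF T(1)], rule path_deviation_bounded[OF T(1)])
    have "bounded (?F ` topspace (skorokhod {0..}))"
      using F by (intro boundedI[of _ "T + 1"]) auto
    \<comment> \<open>The only use of weak convergence.\<close>
    then have lim: "(\<lambda>n. \<integral>f. ?F f \<partial>scaled_law \<beta> P Phi (r n) (xs n)) \<longlonglongrightarrow> (\<integral>f. ?F f \<partial>Q)"
      using conv cont unfolding weakly_converges_def by simp
    \<comment> \<open>First \<open>\<epsilon>\<close> and then \<open>\<delta>\<close> are fixed;
      however large the constant depending on \<open>\<delta>\<close>, the negative power of
      \<open>r n\<close> removes the noise term as \<open>n\<close> grows.\<close>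
    have "(\<integral>f. ?F f \<partial>Q) \<le> 0 + \<epsilon>" if \<epsilon>: "0 < \<epsilon>" for \<epsilon>
    proof -
      from close[rule_format, OF \<epsilon>] obtain \<delta> r0 where \<delta>: "0 < \<delta>" and track: "\<forall>r\<ge>r0. \<forall>\<phi>. norm ((1 / r) *\<^sub>R \<phi> 0 - x) \<le> \<delta> \<and>
          (\<forall>k. real k \<le> T * r powr (1 + \<beta>) \<longrightarrow>
            norm (\<Sum>j<k. \<phi> (Suc j) - \<phi> j - drift P Phi (\<phi> j)) \<le> \<delta> * r) \<longrightarrow>
          (\<forall>t\<in>{0..T}. norm ((1 / r) *\<^sub>R \<phi> (nat \<lfloor>t * r powr (1 + \<beta>)\<rfloor>) - \<mu> x t) \<le> \<epsilon>)"
        by (elim exE conjE) (rule that)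
      let ?b = "\<lambda>n. \<epsilon> + (T + 1) * (T * K * (16 / \<delta>\<^sup>2 + 4 / \<delta>) * r n powr (1 + \<beta> - q))"
      have "?b \<longlonglongrightarrow> \<epsilon> + (T + 1) * (T * K * (16 / \<delta>\<^sup>2 + 4 / \<delta>) * 0)"
        by (intro tendsto_intros tendsto_neg_powr[OF q_neg r(2)])
      then have b: "?b \<longlonglongrightarrow> \<epsilon>" by simp
      have "\<forall>\<^sub>F n in sequentially. dist (xs n) x < \<delta>" by (rule tendstoD[OF xs \<delta>])
      moreover have "\<forall>\<^sub>F n in sequentially. r0 \<le> r n" using r(2) by (simp add: filterlim_at_top)
      ultimately have "\<forall>\<^sub>F n in sequentially. (\<integral>f. ?F f \<partial>scaled_law \<beta> P Phi (r n) (xs n)) \<le> ?b n"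
      proof eventually_elim
        fix n assume n: "dist (xs n) x < \<delta>" "r0 \<le> r n"
        show "(\<integral>f. ?F f \<partial>scaled_law \<beta> P Phi (r n) (xs n)) \<le> ?b n"
        proof (rule path_deviation_bound[OF \<mu>_cont T(1) r(1)[rule_format] \<delta> less_imp_le[OF \<epsilon>]])
          show "norm (xs n - x) \<le> \<delta>" using n(1) by (simp add: dist_norm)
        qed (rule track[THEN spec, THEN mp, OF n(2), THEN spec, THEN mp, OF conjI],
            assumption, simp add: mean diff_diff_eq)
      qed
      then have "(\<integral>f. ?F f \<partial>Q) \<le> \<epsilon>" by (rule tendsto_le[OF trivial_limit_sequentially b lim])
      then show ?thesis by simp
    qed
    then have "(\<integral>f. ?F f \<partial>Q) \<le> 0" by (rule field_le_epsilon)
    moreover have "0 \<le> (\<integral>f. ?F f \<partial>Q)" using F(1) by simp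
    ultimately have zero: "(\<integral>f. ?F f \<partial>Q) = 0" by simp
    have "?F \<in> borel_measurable Q"
      unfolding measurable_cong_sets[OF Q(2) refl] by (rule borel_measurable_continuous_map[OF cont])
    then have int: "integrable Q ?F"
      by (rule Q.integrable_const_bound[where B="T + 1", rotated]) (simp add: F)
    have "AE f in Q. ?F f = 0"
      by (rule iffD1[OF integral_nonneg_eq_0_iff_AE[OF int AE_I2[OF F(1)]] zero])
    then have "AE f in Q. \<forall>t\<in>{0..T / 2}. f t = \<mu> x t"
    proof eventually_elim
      case (elim f)
      show ?case
      proof
        fix t assume "t \<in> {0..T / 2}"
        then show "f t = \<mu> x t" using T(1) by (intro path_deviation_eq_0D[OF elim]) auto
      qed
    qed
    then show ?thesis using T(1) by (intro dirac_onI Q) auto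
  qed
  then show ?thesis using T by (intro exI[of _ "T / 2"]) auto
qed

end
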